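(* Let $s,\sigma>0$ and let $E$ be an ordered basis of $\mathbf R^d$. Then the operator $Z_E$ from $\mathscr S(\mathbf R^d)$ to $C^\infty(\mathbf R^{2d})$ restricts to a homeomorphism from $\mathcal S_s^\sigma(\mathbf R^d)$ to $\mathcal E^{\sigma,s}_{Z,E}(\mathbf R^{2d})$. The same holds true with $\Sigma_s^\sigma(\mathbf R^d)$ and $\mathcal E^{\sigma,s;0}_{Z,E}(\mathbf R^{2d})$ in place of $\mathcal S_s^\sigma(\mathbf R^d)$ and $\mathcal E^{\sigma,s}_{Z,E}(\mathbf R^{2d})$, respectively.
   Context: For an ordered basis $E=\{e_1,\dots,e_d\}$ of $\mathbf R^d$, the dual basis $E'=\{e_1',\dots,e_d'\}$ is defined by $\langle e_j,e_k'\rangle=2\pi\delta_{jk}$; $\Lambda_E=\{n_1e_1+\cdots+n_de_d : n\in\mathbf Z^d\}$ and $\Lambda_E'=\Lambda_{E'}$. Zak transform: $(Z_Ef)(x,\xi)=\sum_{j\in\Lambda_E}f(x-j)e^{i\langle j,\xi\rangle}$ for $f\in\mathscr S(\mathbf R^d)$. $F$ on $\mathbf R^{2d}$ is quasi-periodic of order $E$ if $F(x+k,\xi)=e^{i\langle k,\xi\rangle}F(x,\xi)$ and $F(x,\xi+\kappa)=F(x,\xi)$ for all $k\in\Lambda_E$, $\kappa\in\Lambda_E'$. Gelfand-Shilov spaces: $\mathcal S_s^\sigma(\mathbf R^d)$ (respectively $\Sigma_s^\sigma(\mathbf R^d)$) is the set of all $f\in C^\infty(\mathbf R^d)$ such that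 $$\|f\|_{\mathcal S_{s,h}^\sigma}=\sup_{\alpha,\beta\in\mathbf N^d}\sup_{x\in\mathbf R^d}\frac{|x^\alpha\partial^\beta f(x)|}{h^{|\alpha+\beta|}\alpha!^s\beta!^\sigma}$$ is finite for some $h>0$ (respectively for every $h>0$), with the inductive (respectively projective) limit topology with respect to $h>0$. Two-parameter Gevrey classes: for compact $K\subseteq\mathbf R^{2d}$, $\mathcal E^{\sigma,s}(K)$ (respectively $\mathcal E^{\sigma,s;0}(K)$) is the set of $F\in C^\infty(K)$ such that $$\sup_{\alpha,\beta\in\mathbf N^d}\sup_{(x,\xi)\in K}\frac{|\partial_x^\alpha\partial_\xi^\beta F(x,\xi)|}{h^{|\alpha+\beta|}\alpha!^\sigma\beta!^s}$$ is finite for some (respectively every) $h>0$, with the inductive (respectively projective) limit topology in $h$. $\mathcal E^{\sigma,s}(\mathbf R^{2d})$ and $\mathcal E^{\sigma,s;0}(\mathbf R^{2d})$ are the projective limits of $\mathcal E^{\sigma,s}(K_j)$ and $\mathcal E^{\sigma,s;0}(K_j)$, respectively, over an exhausting sequence of compact sets $K_j$ of $\mathbf R^{2d}$. $\mathcal E^{\sigma,s}_{Z,E}(\mathbf R^{2d})$ and $\mathcal E^{\sigma,s;0}_{Z,E}(\mathbf R^{2d})$ are the subspaces of quasi-periodic elements of order $E$ in $\mathcal E^{\sigma,s}(\mathbf R^{2d})$ and $\mathcal E^{\sigma,s;0}(\mathbf R^{2d})$, with the subspace topologies. *)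

theory Defs
  imports "HOL-Analysis.Analysis"
begin

subsection \<open>Bases, lattices, quasi-periodicity and the Zak transform\<close>

text \<open>
  \<open>\<real>\<^sup>d\<close> is \<^typ>\<open>real^'n\<close> with \<open>d = CARD('n)\<close>, and \<open>\<real>\<^sup>2\<^sup>d\<close> is the
  product \<^typ>\<open>(real^'n) \<times> (real^'n)\<close> with points \<open>(x, \<xi>)\<close>. An ordered basis is a family
  indexed by \<^typ>\<open>'n\<close>.
\<close>

definition ordered_basis :: "('n::finite \<Rightarrow> real^'n) \<Rightarrow> bool" where
  "ordered_basis E \<longleftrightarrow> inj E \<and> independent (range E) \<and> span (range E) = UNIV"

definition dual_basis :: "('n::finite \<Rightarrow> real^'n) \<Rightarrow> 'n \<Rightarrow> real^'n" where
  "dual_basis E = (THE E'. \<forall>j k. E j \<bullet> E' k = (if j = k then 2 * pi else 0))"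

definition lattice :: "('n::finite \<Rightarrow> real^'n) \<Rightarrow> (real^'n) set" where
  "lattice E = {\<Sum>i\<in>UNIV. of_int (n i) *\<^sub>R E i | n :: 'n \<Rightarrow> int. True}"

definition quasi_periodic :: "('n::finite \<Rightarrow> real^'n) \<Rightarrow> ((real^'n) \<times> (real^'n) \<Rightarrow> complex) \<Rightarrow> bool"
  where "quasi_periodic E F \<longleftrightarrow>
    (\<forall>k\<in>lattice E. \<forall>x \<xi>. F (x + k, \<xi>) = exp (\<i> * of_real (k \<bullet> \<xi>)) * F (x, \<xi>)) \<and>
    (\<forall>\<kappa>\<in>lattice (dual_basis E). \<forall>x \<xi>. F (x, \<xi> + \<kappa>) = F (x, \<xi>))"

definition zak :: "('n::finite \<Rightarrow> real^'n) \<Rightarrow> (real^'n \<Rightarrow> complex) \<Rightarrow> (real^'n) \<times> (real^'n) \<Rightarrow> complex"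
  where "zak E f = (\<lambda>(x, \<xi>). \<Sum>\<^sub>\<infinity>j\<in>lattice E. f (x - j) * exp (\<i> * of_real (j \<bullet> \<xi>)))"


subsection \<open>Partial derivatives and smoothness\<close>

definition partial :: "'v::real_normed_vector \<Rightarrow> ('v \<Rightarrow> complex) \<Rightarrow> 'v \<Rightarrow> complex" where
  "partial v f = (\<lambda>x. vector_derivative (\<lambda>t. f (x + t *\<^sub>R v)) (at 0))"

text \<open>
  For open \<open>U\<close> this is \<open>f \<in> C\<^sup>\<infinity>(U)\<close>: all iterated partial derivatives exist and are
  differentiable, hence continuous, on \<open>U\<close>. The values of \<open>f\<close> outside \<open>U\<close> are irrelevant.
\<close>
definition smooth_on :: "'v::euclidean_space set \<Rightarrow> ('v \<Rightarrow> complex) \<Rightarrow> bool" where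
  "smooth_on U f \<longleftrightarrow> (\<forall>vs. set vs \<subseteq> Basis \<longrightarrow> fold partial vs f differentiable_on U)"

definition smooth_near :: "'v::euclidean_space set \<Rightarrow> ('v \<Rightarrow> complex) \<Rightarrow> bool" where
  "smooth_near K f \<longleftrightarrow> (\<exists>U. open U \<and> K \<subseteq> U \<and> smooth_on U f)"

text \<open>
  Multi-indices are functions \<^typ>\<open>'n \<Rightarrow> nat\<close>. To write \<open>\<partial>\<^sup>\<alpha>\<close> as a composition of powers of
  first-order operators an enumeration of the coordinates is fixed; on smooth functions the choice
  of the enumeration does not matter.
\<close>
definition coords :: "'n::finite list" where
  "coords = (SOME is. distinct is \<and> set is = UNIV)"

definition multi_partial ::
    "('n::finite \<Rightarrow> 'v::real_normed_vector) \<Rightarrow> ('n \<Rightarrow> nat) \<Rightarrow> ('v \<Rightarrow> complex) \<Rightarrow> 'v \<Rightarrow> complex" where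
  "multi_partial b \<alpha> f = fold (\<lambda>i. partial (b i) ^^ \<alpha> i) coords f"

definition deriv_mi :: "('n::finite \<Rightarrow> nat) \<Rightarrow> (real^'n \<Rightarrow> complex) \<Rightarrow> real^'n \<Rightarrow> complex" where
  "deriv_mi = multi_partial (\<lambda>i. axis i 1)"

definition deriv_x ::
    "('n::finite \<Rightarrow> nat) \<Rightarrow> ((real^'n) \<times> (real^'n) \<Rightarrow> complex) \<Rightarrow> (real^'n) \<times> (real^'n) \<Rightarrow> complex" where
  "deriv_x = multi_partial (\<lambda>i. (axis i 1, 0))"

definition deriv_xi ::
    "('n::finite \<Rightarrow> nat) \<Rightarrow> ((real^'n) \<times> (real^'n) \<Rightarrow> complex) \<Rightarrow> (real^'n) \<times> (real^'n) \<Rightarrow> complex" where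
  "deriv_xi = multi_partial (\<lambda>i. (0, axis i 1))"

definition mi_size :: "('n::finite \<Rightarrow> nat) \<Rightarrow> nat" where
  "mi_size \<alpha> = (\<Sum>i\<in>UNIV. \<alpha> i)"

definition mi_fact :: "('n::finite \<Rightarrow> nat) \<Rightarrow> real" where
  "mi_fact \<alpha> = (\<Prod>i\<in>UNIV. fact (\<alpha> i))"

definition mi_power :: "real^'n::finite \<Rightarrow> ('n \<Rightarrow> nat) \<Rightarrow> real" where
  "mi_power x \<alpha> = (\<Prod>i\<in>UNIV. (x $ i) ^ \<alpha> i)"

definition schwartz :: "(real^'n::finite \<Rightarrow> complex) set" where
  "schwartz = {f. smooth_on UNIV f \<and>
    (\<forall>\<alpha> \<beta>. \<exists>C. \<forall>x. cmod (of_real (mi_power x \<alpha>) * deriv_mi \<beta> f x) \<le> C)}"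


subsection \<open>Topologies on spaces of functions\<close>

text \<open>
  The space of all \<open>f \<in> X\<close> with \<open>p f < \<infinity>\<close>, topologized by the (semi)norm \<open>p\<close>.
\<close>
definition seminorm_topology ::
    "('a \<Rightarrow> complex) set \<Rightarrow> (('a \<Rightarrow> complex) \<Rightarrow> ennreal) \<Rightarrow> ('a \<Rightarrow> complex) topology" where
  "seminorm_topology X p = topology (\<lambda>W. W \<subseteq> {f\<in>X. p f < \<infinity>} \<and>
     (\<forall>f\<in>W. \<exists>\<epsilon>>0. {g\<in>X. p g < \<infinity> \<and> p (\<lambda>x. g x - f x) < ennreal \<epsilon>} \<subseteq> W))"

definition abs_convex :: "('a \<Rightarrow> complex) set \<Rightarrow> bool" where
  "abs_convex U \<longleftrightarrow>
    (\<forall>f\<in>U. \<forall>g\<in>U. \<forall>a b. cmod a + cmod b \<le> 1 \<longrightarrow> (\<lambda>x. a * f x + b * g x) \<in> U)"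

text \<open>
  The locally convex inductive limit of an increasing family of topological vector spaces
  \<open>T i\<close>: the finest locally convex topology on the union for which all inclusions are
  continuous. A base of neighbourhoods of the origin is given by the absolutely convex sets whose
  intersection with every step is a neighbourhood of the origin in that step.
\<close>
definition inductive_limit ::
    "'i set \<Rightarrow> ('i \<Rightarrow> ('a \<Rightarrow> complex) topology) \<Rightarrow> ('a \<Rightarrow> complex) topology" where
  "inductive_limit I T = topology (\<lambda>W. W \<subseteq> (\<Union>i\<in>I. topspace (T i)) \<and>
     (\<forall>f\<in>W. \<exists>U. abs_convex U \<and>
        (\<forall>i\<in>I. \<exists>V. openin (T i) V \<and> (\<lambda>_. 0) \<in> V \<and> V \<subseteq> U) \<and>
        {g \<in> (\<Union>i\<in>I. topspace (T i)). (\<lambda>x. g x - f x) \<in> U} \<subseteq> W))"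

text \<open>
  The projective limit: the coarsest topology on the intersection for which all inclusions into
  the \<open>T i\<close> are continuous.
\<close>
definition projective_limit ::
    "'i set \<Rightarrow> ('i \<Rightarrow> ('a \<Rightarrow> complex) topology) \<Rightarrow> ('a \<Rightarrow> complex) topology" where
  "projective_limit I T =
     subtopology (topology_generated_by (\<Union>i\<in>I. {V. openin (T i) V})) (\<Inter>i\<in>I. topspace (T i))"

lemma openin_seminorm_topology:
  "openin (seminorm_topology X p) W \<longleftrightarrow> W \<subseteq> {f\<in>X. p f < \<infinity>} \<and>
     (\<forall>f\<in>W. \<exists>\<epsilon>>0. {g\<in>X. p g < \<infinity> \<and> p (\<lambda>x. g x - f x) < ennreal \<epsilon>} \<subseteq> W)"
proof -
  let ?N = "\<lambda>f \<epsilon>. {g\<in>X. p g < \<infinity> \<and> p (\<lambda>x. g x - f x) < ennreal \<epsilon>}"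
  have "istopology (\<lambda>W. W \<subseteq> {f\<in>X. p f < \<infinity>} \<and> (\<forall>f\<in>W. \<exists>\<epsilon>>0. ?N f \<epsilon> \<subseteq> W))"
    unfolding istopology_def
  proof (intro conjI allI impI ballI)
    fix S T f
    assume S: "S \<subseteq> {f\<in>X. p f < \<infinity>} \<and> (\<forall>f\<in>S. \<exists>\<epsilon>>0. ?N f \<epsilon> \<subseteq> S)"
      and T: "T \<subseteq> {f\<in>X. p f < \<infinity>} \<and> (\<forall>f\<in>T. \<exists>\<epsilon>>0. ?N f \<epsilon> \<subseteq> T)"
    show "S \<inter> T \<subseteq> {f\<in>X. p f < \<infinity>}" using S by blast
    assume "f \<in> S \<inter> T"
    then obtain a b where ab: "a > 0" "b > 0" "?N f a \<subseteq> S" "?N f b \<subseteq> T" using S T by blast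
    have "?N f (min a b) \<subseteq> ?N f a" "?N f (min a b) \<subseteq> ?N f b"
      using ennreal_leI[of "min a b" a] ennreal_leI[of "min a b" b] by (auto simp: order_less_le_trans)
    then show "\<exists>\<epsilon>>0. ?N f \<epsilon> \<subseteq> S \<inter> T" using ab by (intro exI[of _ "min a b"]) auto
  next
    fix \<K> f
    assume K: "\<forall>S\<in>\<K>. S \<subseteq> {f\<in>X. p f < \<infinity>} \<and> (\<forall>f\<in>S. \<exists>\<epsilon>>0. ?N f \<epsilon> \<subseteq> S)"
    show "\<Union>\<K> \<subseteq> {f\<in>X. p f < \<infinity>}" using K by blast
    assume "f \<in> \<Union>\<K>"
    then obtain S where "S \<in> \<K>" "f \<in> S" by blast
    with K obtain \<epsilon> where "\<epsilon> > 0" "?N f \<epsilon> \<subseteq> S" by blast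
    with \<open>S \<in> \<K>\<close> show "\<exists>\<epsilon>>0. ?N f \<epsilon> \<subseteq> \<Union>\<K>" by blast
  qed
  then show ?thesis unfolding seminorm_topology_def by (simp add: topology_inverse')
qed

lemma topspace_seminorm_topology: "topspace (seminorm_topology X p) = {f\<in>X. p f < \<infinity>}"
proof
  show "topspace (seminorm_topology X p) \<subseteq> {f\<in>X. p f < \<infinity>}"
    using openin_seminorm_topology openin_topspace by blast
  have "openin (seminorm_topology X p) {f\<in>X. p f < \<infinity>}"
    unfolding openin_seminorm_topology by (auto intro: exI[of _ "1::real"])
  then show "{f\<in>X. p f < \<infinity>} \<subseteq> topspace (seminorm_topology X p)"
    by (rule openin_subset)
qed

lemma openin_inductive_limit:
  "openin (inductive_limit I T) W \<longleftrightarrow> W \<subseteq> (\<Union>i\<in>I. topspace (T i)) \<and>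
     (\<forall>f\<in>W. \<exists>U. abs_convex U \<and>
        (\<forall>i\<in>I. \<exists>V. openin (T i) V \<and> (\<lambda>_. 0) \<in> V \<and> V \<subseteq> U) \<and>
        {g \<in> (\<Union>i\<in>I. topspace (T i)). (\<lambda>x. g x - f x) \<in> U} \<subseteq> W)"
proof -
  let ?X = "\<Union>i\<in>I. topspace (T i)"
  define B where "B U \<longleftrightarrow> abs_convex U \<and>
        (\<forall>i\<in>I. \<exists>V. openin (T i) V \<and> (\<lambda>_. 0) \<in> V \<and> V \<subseteq> U)" for U
  define N where "N f U = {g \<in> ?X. (\<lambda>x. g x - f x) \<in> U}" for f U
  have B_Int: "B (U \<inter> U')" if "B U" "B U'" for U U'
    unfolding B_def
  proof (intro conjI ballI)
    show "abs_convex (U \<inter> U')" using that unfolding B_def abs_convex_def by blast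
    fix i assume "i \<in> I"
    with that obtain V V' where "openin (T i) V \<and> (\<lambda>_. 0) \<in> V \<and> V \<subseteq> U"
      "openin (T i) V' \<and> (\<lambda>_. 0) \<in> V' \<and> V' \<subseteq> U'" unfolding B_def by metis
    then show "\<exists>V. openin (T i) V \<and> (\<lambda>_. 0) \<in> V \<and> V \<subseteq> U \<inter> U'"
      by (intro exI[of _ "V \<inter> V'"]) auto
  qed
  have "istopology (\<lambda>W. W \<subseteq> ?X \<and> (\<forall>f\<in>W. \<exists>U. B U \<and> N f U \<subseteq> W))"
    unfolding istopology_def
  proof (intro conjI allI impI ballI)
    fix S S' f
    assume S: "S \<subseteq> ?X \<and> (\<forall>f\<in>S. \<exists>U. B U \<and> N f U \<subseteq> S)"
      and S': "S' \<subseteq> ?X \<and> (\<forall>f\<in>S'. \<exists>U. B U \<and> N f U \<subseteq> S')"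
    show "S \<inter> S' \<subseteq> ?X" using S by blast
    assume "f \<in> S \<inter> S'"
    then obtain U U' where "B U" "N f U \<subseteq> S" "B U'" "N f U' \<subseteq> S'" using S S' by blast
    moreover have "N f (U \<inter> U') \<subseteq> N f U \<inter> N f U'" unfolding N_def by blast
    ultimately show "\<exists>U. B U \<and> N f U \<subseteq> S \<inter> S'" using B_Int by blast
  next
    fix \<K> f
    assume K: "\<forall>S\<in>\<K>. S \<subseteq> ?X \<and> (\<forall>f\<in>S. \<exists>U. B U \<and> N f U \<subseteq> S)"
    show "\<Union>\<K> \<subseteq> ?X" using K by blast
    assume "f \<in> \<Union>\<K>"
    then obtain S where "S \<in> \<K>" "f \<in> S" by blast
    with K obtain U where "B U" "N f U \<subseteq> S" by blast
    with \<open>S \<in> \<K>\<close> show "\<exists>U. B U \<and> N f U \<subseteq> \<Union>\<K>" by blast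
  qed
  then have "openin (topology (\<lambda>W. W \<subseteq> ?X \<and> (\<forall>f\<in>W. \<exists>U. B U \<and> N f U \<subseteq> W))) W
      \<longleftrightarrow> W \<subseteq> ?X \<and> (\<forall>f\<in>W. \<exists>U. B U \<and> N f U \<subseteq> W)"
    by (simp add: topology_inverse')
  then show ?thesis unfolding inductive_limit_def B_def N_def by (simp add: conj_assoc)
qed

lemma topspace_inductive_limit:
  assumes "\<And>i. i \<in> I \<Longrightarrow> (\<lambda>_. 0) \<in> topspace (T i)"
  shows "topspace (inductive_limit I T) = (\<Union>i\<in>I. topspace (T i))"
proof
  show "topspace (inductive_limit I T) \<subseteq> (\<Union>i\<in>I. topspace (T i))"
    using openin_inductive_limit[of I T "topspace (inductive_limit I T)"] by simp
  have "\<exists>U. abs_convex U \<and> (\<forall>i\<in>I. \<exists>V. openin (T i) V \<and> (\<lambda>_. 0) \<in> V \<and> V \<subseteq> U) \<and>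
        {g \<in> (\<Union>i\<in>I. topspace (T i)). (\<lambda>x. g x - f x) \<in> U} \<subseteq> (\<Union>i\<in>I. topspace (T i))" for f
    using assms by (intro exI[of _ UNIV]) (auto simp: abs_convex_def)
  then have "openin (inductive_limit I T) (\<Union>i\<in>I. topspace (T i))"
    unfolding openin_inductive_limit by blast
  then show "(\<Union>i\<in>I. topspace (T i)) \<subseteq> topspace (inductive_limit I T)"
    by (rule openin_subset)
qed

lemma topspace_projective_limit:
  assumes "I \<noteq> {}"
  shows "topspace (projective_limit I T) = (\<Inter>i\<in>I. topspace (T i))"
  using assms unfolding projective_limit_def by auto


subsection \<open>Gelfand-Shilov spaces\<close>

definition gs_norm :: "real \<Rightarrow> real \<Rightarrow> real \<Rightarrow> (real^'n::finite \<Rightarrow> complex) \<Rightarrow> ennreal" where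
  "gs_norm s \<sigma> h f = (SUP \<alpha>. SUP \<beta>. SUP x.
     ennreal (cmod (of_real (mi_power x \<alpha>) * deriv_mi \<beta> f x) /
       (h ^ (mi_size \<alpha> + mi_size \<beta>) * mi_fact \<alpha> powr s * mi_fact \<beta> powr \<sigma>)))"

definition gs_step :: "real \<Rightarrow> real \<Rightarrow> real \<Rightarrow> (real^'n::finite \<Rightarrow> complex) topology" where
  "gs_step s \<sigma> h = seminorm_topology {f. smooth_on UNIV f} (gs_norm s \<sigma> h)"

text \<open>\<open>\<S>\<^sub>s\<^sup>\<sigma>\<close> and \<open>\<Sigma>\<^sub>s\<^sup>\<sigma>\<close>, respectively\<close>

definition gs_roumieu :: "real \<Rightarrow> real \<Rightarrow> (real^'n::finite \<Rightarrow> complex) topology" where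
  "gs_roumieu s \<sigma> = inductive_limit {0<..} (gs_step s \<sigma>)"

definition gs_beurling :: "real \<Rightarrow> real \<Rightarrow> (real^'n::finite \<Rightarrow> complex) topology" where
  "gs_beurling s \<sigma> = projective_limit {0<..} (gs_step s \<sigma>)"


subsection \<open>Two-parameter Gevrey classes\<close>

definition gevrey_norm ::
    "real \<Rightarrow> real \<Rightarrow> ((real^'n::finite) \<times> (real^'n)) set \<Rightarrow> real \<Rightarrow> ((real^'n) \<times> (real^'n) \<Rightarrow> complex) \<Rightarrow> ennreal"
  where "gevrey_norm \<sigma> s K h F = (SUP \<alpha>. SUP \<beta>. SUP z\<in>K.
     ennreal (cmod (deriv_x \<alpha> (deriv_xi \<beta> F) z) /
       (h ^ (mi_size \<alpha> + mi_size \<beta>) * mi_fact \<alpha> powr \<sigma> * mi_fact \<beta> powr s)))"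

text \<open>
  \<open>C\<^sup>\<infinity>(K)\<close> consists of the functions that are smooth in some open neighbourhood of \<open>K\<close>. They
  are not identified when they agree on \<open>K\<close>; the seminorm only sees the derivatives on \<open>K\<close>, and
  in the projective limit over an exhaustion nothing is left to identify.
\<close>
definition gevrey_step ::
    "real \<Rightarrow> real \<Rightarrow> ((real^'n::finite) \<times> (real^'n)) set \<Rightarrow> real \<Rightarrow> ((real^'n) \<times> (real^'n) \<Rightarrow> complex) topology"
  where "gevrey_step \<sigma> s K h = seminorm_topology {F. smooth_near K F} (gevrey_norm \<sigma> s K h)"

definition gevrey_roumieu_on ::
    "real \<Rightarrow> real \<Rightarrow> ((real^'n::finite) \<times> (real^'n)) set \<Rightarrow> ((real^'n) \<times> (real^'n) \<Rightarrow> complex) topology"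
  where "gevrey_roumieu_on \<sigma> s K = inductive_limit {0<..} (gevrey_step \<sigma> s K)"

definition gevrey_beurling_on ::
    "real \<Rightarrow> real \<Rightarrow> ((real^'n::finite) \<times> (real^'n)) set \<Rightarrow> ((real^'n) \<times> (real^'n) \<Rightarrow> complex) topology"
  where "gevrey_beurling_on \<sigma> s K = projective_limit {0<..} (gevrey_step \<sigma> s K)"

definition exhaustion :: "(nat \<Rightarrow> 'v::topological_space set) \<Rightarrow> bool" where
  "exhaustion K \<longleftrightarrow> (\<forall>j. compact (K j)) \<and> (\<forall>j. K j \<subseteq> interior (K (Suc j))) \<and> (\<Union>j. K j) = UNIV"

text \<open>
  \<open>\<E>\<^sup>\<sigma>\<^sup>,\<^sup>s(\<real>\<^sup>2\<^sup>d)\<close> and \<open>\<E>\<^sup>\<sigma>\<^sup>,\<^sup>s\<^sup>;\<^sup>0(\<real>\<^sup>2\<^sup>d)\<close>, formed along a given exhaustion \<open>K\<close>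
\<close>
definition gevrey_roumieu ::
    "(nat \<Rightarrow> ((real^'n::finite) \<times> (real^'n)) set) \<Rightarrow> real \<Rightarrow> real \<Rightarrow> ((real^'n) \<times> (real^'n) \<Rightarrow> complex) topology"
  where "gevrey_roumieu K \<sigma> s = projective_limit UNIV (\<lambda>j. gevrey_roumieu_on \<sigma> s (K j))"

definition gevrey_beurling ::
    "(nat \<Rightarrow> ((real^'n::finite) \<times> (real^'n)) set) \<Rightarrow> real \<Rightarrow> real \<Rightarrow> ((real^'n) \<times> (real^'n) \<Rightarrow> complex) topology"
  where "gevrey_beurling K \<sigma> s = projective_limit UNIV (\<lambda>j. gevrey_beurling_on \<sigma> s (K j))"

definition gevrey_roumieu_qp ::
    "(nat \<Rightarrow> ((real^'n::finite) \<times> (real^'n)) set) \<Rightarrow> real \<Rightarrow> real \<Rightarrow> ('n \<Rightarrow> real^'n)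
      \<Rightarrow> ((real^'n) \<times> (real^'n) \<Rightarrow> complex) topology"
  where "gevrey_roumieu_qp K \<sigma> s E = subtopology (gevrey_roumieu K \<sigma> s) {F. quasi_periodic E F}"

definition gevrey_beurling_qp ::
    "(nat \<Rightarrow> ((real^'n::finite) \<times> (real^'n)) set) \<Rightarrow> real \<Rightarrow> real \<Rightarrow> ('n \<Rightarrow> real^'n)
      \<Rightarrow> ((real^'n) \<times> (real^'n) \<Rightarrow> complex) topology"
  where "gevrey_beurling_qp K \<sigma> s E = subtopology (gevrey_beurling K \<sigma> s) {F. quasi_periodic E F}"


subsection \<open>The underlying sets of the topologies\<close>

lemma partial_zero: "partial v (\<lambda>_. 0) = (\<lambda>_. 0)"
  by (simp add: partial_def)

lemma smooth_on_zero: "smooth_on U (\<lambda>_. 0)"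
proof -
  have "fold partial vs (\<lambda>_. 0) = (\<lambda>_. 0)" for vs :: "'a list"
    by (induction vs) (simp_all add: partial_zero)
  then show ?thesis by (simp add: smooth_on_def)
qed

lemma multi_partial_zero:
  fixes b :: "'n::finite \<Rightarrow> 'v::real_normed_vector"
  shows "multi_partial b \<alpha> (\<lambda>_. 0) = (\<lambda>_. 0)"
proof -
  have pow: "(partial v ^^ n) (\<lambda>_. 0) = (\<lambda>_. 0)" for v :: 'v and n
    by (induction n) (simp_all add: partial_zero)
  have "fold (\<lambda>i. partial (b i) ^^ \<alpha> i) is (\<lambda>_. 0) = (\<lambda>_. 0)" for "is"
    by (induction "is") (simp_all add: pow)
  then show ?thesis by (simp add: multi_partial_def)
qed

lemma topspace_gs_step:
  "topspace (gs_step s \<sigma> h) = {f. smooth_on UNIV f \<and> gs_norm s \<sigma> h f < \<infinity>}"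
  by (simp add: gs_step_def topspace_seminorm_topology)

lemma topspace_gs_roumieu:
  "topspace (gs_roumieu s \<sigma>) = {f. smooth_on UNIV f \<and> (\<exists>h>0. gs_norm s \<sigma> h f < \<infinity>)}"
proof -
  have "(\<lambda>_. 0) \<in> topspace (gs_step s \<sigma> h :: (real^'n \<Rightarrow> complex) topology)" for h
    by (simp add: topspace_gs_step smooth_on_zero gs_norm_def deriv_mi_def multi_partial_zero)
  then show ?thesis
    unfolding gs_roumieu_def by (subst topspace_inductive_limit) (auto simp: topspace_gs_step)
qed

lemma topspace_gs_beurling:
  "topspace (gs_beurling s \<sigma>) = {f. smooth_on UNIV f \<and> (\<forall>h>0. gs_norm s \<sigma> h f < \<infinity>)}"
proof -
  have pos: "{0::real<..} \<noteq> {}" "(\<forall>h\<in>{0::real<..}. P \<and> Q h) \<longleftrightarrow> P \<and> (\<forall>h>0. Q h)" for P Q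
    using zero_less_one[where 'a=real] by (blast, simp, blast)
  show ?thesis
    unfolding gs_beurling_def topspace_projective_limit[OF pos(1)]
    by (simp add: set_eq_iff topspace_gs_step pos(2))
qed

lemma topspace_gevrey_step:
  "topspace (gevrey_step \<sigma> s K h) = {F. smooth_near K F \<and> gevrey_norm \<sigma> s K h F < \<infinity>}"
  by (simp add: gevrey_step_def topspace_seminorm_topology)

lemma topspace_gevrey_roumieu_on:
  "topspace (gevrey_roumieu_on \<sigma> s K) = {F. smooth_near K F \<and> (\<exists>h>0. gevrey_norm \<sigma> s K h F < \<infinity>)}"
proof -
  have "smooth_near K (\<lambda>_. 0)"
    unfolding smooth_near_def using smooth_on_zero by blast
  then have "(\<lambda>_. 0) \<in> topspace (gevrey_step \<sigma> s K h)" for h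
    by (cases "K = {}") (simp_all add: topspace_gevrey_step gevrey_norm_def
        deriv_x_def deriv_xi_def multi_partial_zero bot_ennreal)
  then show ?thesis
    unfolding gevrey_roumieu_on_def
    by (subst topspace_inductive_limit) (auto simp: topspace_gevrey_step)
qed

lemma topspace_gevrey_beurling_on:
  "topspace (gevrey_beurling_on \<sigma> s K) = {F. smooth_near K F \<and> (\<forall>h>0. gevrey_norm \<sigma> s K h F < \<infinity>)}"
proof -
  have pos: "{0::real<..} \<noteq> {}" "(\<forall>h\<in>{0::real<..}. P \<and> Q h) \<longleftrightarrow> P \<and> (\<forall>h>0. Q h)" for P Q
    using zero_less_one[where 'a=real] by (blast, simp, blast)
  show ?thesis
    unfolding gevrey_beurling_on_def topspace_projective_limit[OF pos(1)]
    by (simp add: set_eq_iff topspace_gevrey_step pos(2))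
qed

lemma smooth_near_exhaustion:
  assumes "exhaustion K"
  shows "(\<forall>j. smooth_near (K j) F) \<longleftrightarrow> smooth_on UNIV F"
proof
  assume R: "smooth_on UNIV F"
  show "\<forall>j. smooth_near (K j) F"
    unfolding smooth_near_def using R by (intro allI exI[of _ UNIV]) auto
next
  assume L: "\<forall>j. smooth_near (K j) F"
  show "smooth_on UNIV F"
    unfolding smooth_on_def
  proof (intro allI impI)
    fix vs :: "'a list" assume vs: "set vs \<subseteq> Basis"
    have "fold partial vs F differentiable at x" for x
    proof -
      have "x \<in> (\<Union>j. K j)" using assms by (simp add: exhaustion_def)
      then obtain j where "x \<in> K j" by blast
      with L obtain U where U: "open U" "x \<in> U" "smooth_on U F"
        unfolding smooth_near_def by blast
      then show ?thesis
        using vs unfolding smooth_on_def by (meson differentiable_on_eq_differentiable_at)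
    qed
    then show "fold partial vs F differentiable_on UNIV"
      by (simp add: differentiable_on_eq_differentiable_at)
  qed
qed

lemma topspace_gevrey_roumieu_qp:
  assumes "exhaustion K"
  shows "topspace (gevrey_roumieu_qp K \<sigma> s E) = {F. smooth_on UNIV F \<and>
    (\<forall>j. \<exists>h>0. gevrey_norm \<sigma> s (K j) h F < \<infinity>) \<and> quasi_periodic E F}"
  unfolding gevrey_roumieu_qp_def gevrey_roumieu_def
  by (auto simp: topspace_projective_limit topspace_gevrey_roumieu_on
      simp flip: smooth_near_exhaustion[OF assms])

lemma topspace_gevrey_beurling_qp:
  assumes "exhaustion K"
  shows "topspace (gevrey_beurling_qp K \<sigma> s E) = {F. smooth_on UNIV F \<and>
    (\<forall>j. \<forall>h>0. gevrey_norm \<sigma> s (K j) h F < \<infinity>) \<and> quasi_periodic E F}"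
  unfolding gevrey_beurling_qp_def gevrey_beurling_def
  by (auto simp: topspace_projective_limit topspace_gevrey_beurling_on
      simp flip: smooth_near_exhaustion[OF assms])

end

theory Submission
  imports Defs "HOL-Complex_Analysis.Great_Picard"
begin

text \<open>
  The inverse of the Zak transform averages \<open>F (x, \<xi>)\<close> over a period in \<open>\<xi>\<close>. Averaging one dual basis
  direction at a time keeps every integral one-dimensional: such averages commute with all
  derivatives and annihilate the derivative of a periodic function, so integration by parts turns
  \<open>\<partial>\<^sub>\<xi>\<close> into multiplication by lattice points, that is, into decay of the average. In the other
  direction decay of \<open>f\<close> sums up to bounds for \<open>\<partial>\<^sub>\<xi>\<close> of the Zak series. Surjectivity is uniqueness of
  Fourier coefficients, again one variable at a time.

  Continuity of the inverse is delicate only in the Roumieu case, where the quasi-periodic functions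
  carry the subspace topology of an inductive limit. Bounded sequences of the steps
  have subsequences converging in larger steps; this yields, inside each zero neighbourhood of
  \<open>\<S>\<^sub>s\<^sup>\<sigma>\<close>, a ball of a single weighted seminorm whose weights \<open>W m\<close> dominate a multiple of \<open>h ^ m\<close> for
  every \<open>h\<close>. The corresponding weighted ball for all Gevrey functions is a neighbourhood in the
  ambient space.
\<close>

subsection \<open>Smooth functions\<close>

text \<open>Both directions compare x with a lattice point k, where x = y + k and y is bounded;
  powers of x and of k are then comparable only in the coordinates that are not small. Replacing
  |k_i| by the maximum of R and |k_i| (\<open>max_power\<close>) repairs this, and the surplus R^n
  is absorbed by C * \<epsilon>^n * n!^s for any \<epsilon> > 0. This is what s > 0 is for, and
  since \<epsilon> is free, the price is a change of constant and not of scale. The scale changes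
  only by fixed factors, 2 for the inverse and 2 * 2^s for the Zak transform, which neither limit
  topology notices. The 2^s comes from making the series summable: 2d further powers in each
  coordinate are spent, and (n + 2d)! is at most a constant times 2^n * n!. For general weights W
  the absorption trades a power of \<epsilon> for a higher order, so W has to satisfy W l *
  \<epsilon>^n \<le> W (l + n); with \<epsilon> = 1 this is monotonicity.\<close>

abbreviation smooth :: "('v::euclidean_space \<Rightarrow> complex) \<Rightarrow> bool" where
  "smooth \<equiv> smooth_on UNIV"

lemma partial_eq_derivative:
  assumes "(f has_derivative f') (at x)"
  shows "partial v f x = f' v"
proof -
  have "((\<lambda>t. x + t *\<^sub>R v) has_derivative (\<lambda>t. t *\<^sub>R v)) (at 0)"
    by (auto intro!: derivative_eq_intros)
  moreover have "(f has_derivative f') (at (x + 0 *\<^sub>R v))"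
    using assms by simp
  ultimately have "((\<lambda>t. f (x + t *\<^sub>R v)) has_derivative (\<lambda>t. f' (t *\<^sub>R v))) (at 0)"
    by (rule has_derivative_compose)
  moreover have "linear f'"
    using assms has_derivative_linear by blast
  ultimately have "((\<lambda>t. f (x + t *\<^sub>R v)) has_vector_derivative f' v) (at 0)"
    by (simp add: has_vector_derivative_def linear_cmul)
  then show ?thesis
    unfolding partial_def by (rule vector_derivative_at)
qed

lemma smooth_differentiable: "smooth f \<Longrightarrow> f differentiable (at x)"
  unfolding smooth_on_def
  by (metis (no_types) UNIV_I differentiable_on_def empty_subsetI fold_simps(1) list.set(1))

lemma smooth_partial: "smooth f \<Longrightarrow> b \<in> Basis \<Longrightarrow> smooth (partial b f)"
  unfolding smooth_on_def
  by (metis (no_types, lifting) fold_simps(2) insert_subset list.simps(15))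

lemma smooth_fold_partial: "smooth f \<Longrightarrow> set vs \<subseteq> Basis \<Longrightarrow> smooth (fold partial vs f)"
  by (induction vs arbitrary: f) (auto simp: smooth_partial)

lemma smooth_isCont: "smooth f \<Longrightarrow> isCont f x"
  by (simp add: differentiable_imp_continuous_within smooth_differentiable)

lemma smooth_continuous_on: "smooth f \<Longrightarrow> continuous_on A f"
  by (simp add: continuous_at_imp_continuous_on smooth_isCont)

text \<open>Replaces explicit formulas for higher derivatives: it is enough to find a class of
  differentiable functions that is closed under partial derivatives in coordinate
  directions.\<close>

lemma smooth_coinduct:
  assumes "P f"
    and diff: "\<And>g x. P g \<Longrightarrow> g differentiable (at x)"
    and step: "\<And>g b. P g \<Longrightarrow> b \<in> Basis \<Longrightarrow> P (partial b g)"
  shows "smooth f"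
proof -
  have "P (fold partial vs g)" if "P g" "set vs \<subseteq> Basis" for vs g
    using that by (induction vs arbitrary: g) (auto intro: step)
  then show ?thesis
    using assms(1) diff unfolding smooth_on_def
    by (simp add: differentiable_on_eq_differentiable_at)
qed

lemma has_derivative_partials:
  assumes "f differentiable (at x)"
  shows "(f has_derivative (\<lambda>v. \<Sum>b\<in>Basis. (v \<bullet> b) *\<^sub>R partial b f x)) (at x)"
proof -
  obtain f' where f': "(f has_derivative f') (at x)"
    using assms by (auto simp: differentiable_def)
  then have lin: "linear f'"
    using has_derivative_linear by blast
  have "f' v = (\<Sum>b\<in>Basis. (v \<bullet> b) *\<^sub>R partial b f x)" for v
  proof -
    have "f' v = f' (\<Sum>b\<in>Basis. (v \<bullet> b) *\<^sub>R b)"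
      by (simp add: euclidean_representation)
    also have "\<dots> = (\<Sum>b\<in>Basis. (v \<bullet> b) *\<^sub>R f' b)"
      by (simp add: linear_sum[OF lin] linear_cmul[OF lin])
    finally show ?thesis
      by (simp add: partial_eq_derivative[OF f'])
  qed
  then have "f' = (\<lambda>v. \<Sum>b\<in>Basis. (v \<bullet> b) *\<^sub>R partial b f x)"
    by blast
  with f' show ?thesis by simp
qed

lemma partial_expand:
  assumes "smooth f"
  shows "partial v f = (\<lambda>x. \<Sum>b\<in>Basis. (v \<bullet> b) *\<^sub>R partial b f x)"
  using partial_eq_derivative[OF has_derivative_partials[OF smooth_differentiable[OF assms]]]
  by blast

lemma has_derivative_partial:
  fixes f :: "'v::euclidean_space \<Rightarrow> complex"
  assumes "f differentiable (at x)"
  shows "(f has_derivative (\<lambda>v. partial v f x)) (at x)"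
proof -
  obtain f' where f': "(f has_derivative f') (at x)"
    using assms by (auto simp: differentiable_def)
  then have "f' = (\<lambda>v. partial v f x)"
    using partial_eq_derivative by fastforce
  with f' show ?thesis by simp
qed

lemma partial_comb_at:
  fixes f g :: "'v::euclidean_space \<Rightarrow> complex"
  assumes "f differentiable (at x)" "g differentiable (at x)"
  shows "partial v (\<lambda>x. a * f x + b * g x) x = a * partial v f x + b * partial v g x"
proof -
  have "((\<lambda>x. a * f x + b * g x) has_derivative (\<lambda>v. a * partial v f x + b * partial v g x)) (at x)"
    by (intro derivative_intros has_derivative_partial assms)
  then show ?thesis by (rule partial_eq_derivative)
qed

lemma partial_comb:
  assumes "smooth f" "smooth g"
  shows "partial v (\<lambda>x. a * f x + b * g x) = (\<lambda>x. a * partial v f x + b * partial v g x)"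
  using assms partial_comb_at smooth_differentiable by blast

lemma smooth_comb:
  fixes f g :: "'a::euclidean_space \<Rightarrow> complex"
  assumes "smooth f" "smooth g"
  shows "smooth (\<lambda>x. a * f x + b * g x)"
proof (rule smooth_coinduct[where P = "\<lambda>h. \<exists>f g. smooth f \<and> smooth g \<and> h = (\<lambda>x. a * f x + b * g x)"])
  show "\<exists>f' g'. smooth f' \<and> smooth g' \<and> (\<lambda>x. a * f x + b * g x) = (\<lambda>x. a * f' x + b * g' x)"
    using assms by blast
next
  fix h :: "'a \<Rightarrow> complex" and x :: 'a assume "\<exists>f g. smooth f \<and> smooth g \<and> h = (\<lambda>x. a * f x + b * g x)"
  then obtain f g where "smooth f" "smooth g" "h = (\<lambda>x. a * f x + b * g x)" by blast
  then show "h differentiable at x"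
    by (simp add: differentiable_add differentiable_mult smooth_differentiable)
next
  fix h :: "'a \<Rightarrow> complex" and c :: 'a assume "\<exists>f g. smooth f \<and> smooth g \<and> h = (\<lambda>x. a * f x + b * g x)" "c \<in> Basis"
  then show "\<exists>f g. smooth f \<and> smooth g \<and> partial c h = (\<lambda>x. a * f x + b * g x)"
    using partial_comb smooth_partial by metis
qed

lemma fold_partial_comb:
  assumes "smooth f" "smooth g" "set vs \<subseteq> Basis"
  shows "fold partial vs (\<lambda>x. a * f x + b * g x) = (\<lambda>x. a * fold partial vs f x + b * fold partial vs g x)"
  using assms by (induction vs arbitrary: f g) (auto simp: partial_comb smooth_partial)

lemma partial_const: "partial v (\<lambda>_. c) = (\<lambda>_. 0)"
  by (simp add: partial_def)

lemma smooth_const: "smooth (\<lambda>_. c)"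
  by (rule smooth_coinduct[where P = "\<lambda>g. \<exists>c. g = (\<lambda>_. c)"]) (auto simp: partial_const)

lemma smooth_cmult: "smooth f \<Longrightarrow> smooth (\<lambda>x. c * f x)"
  using smooth_comb[of f f c 0] by simp

lemma smooth_add: "smooth f \<Longrightarrow> smooth g \<Longrightarrow> smooth (\<lambda>x. f x + g x)"
  using smooth_comb[of f g 1 1] by simp

lemma partial_add:
  "smooth f \<Longrightarrow> smooth g \<Longrightarrow> partial v (\<lambda>x. f x + g x) = (\<lambda>x. partial v f x + partial v g x)"
  using partial_comb[of f g v 1 1] by simp

lemma smooth_diff: "smooth f \<Longrightarrow> smooth g \<Longrightarrow> smooth (\<lambda>x. f x - g x)"
  using smooth_comb[of f g 1 "-1"] by simp

lemma smooth_sum: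
  assumes "\<And>i. i \<in> I \<Longrightarrow> smooth (f i)"
  shows "smooth (\<lambda>x. \<Sum>i\<in>I. f i x)"
  using assms by (induction I rule: infinite_finite_induct) (auto simp: smooth_const smooth_add)

lemma partial_sum:
  assumes "\<And>i. i \<in> I \<Longrightarrow> smooth (f i)"
  shows "partial v (\<lambda>x. \<Sum>i\<in>I. f i x) = (\<lambda>x. \<Sum>i\<in>I. partial v (f i) x)"
  using assms
  by (induction I rule: infinite_finite_induct) (auto simp: partial_const smooth_sum partial_add)

lemma fold_partial_sum:
  assumes "\<And>i. i \<in> I \<Longrightarrow> smooth (f i)" "set vs \<subseteq> Basis"
  shows "fold partial vs (\<lambda>x. \<Sum>i\<in>I. f i x) = (\<lambda>x. \<Sum>i\<in>I. fold partial vs (f i) x)"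
  using assms by (induction vs arbitrary: f) (auto simp: partial_sum smooth_partial)

text \<open>\<open>smooth_on\<close> only speaks of coordinate directions, whereas the averages
  below run along dual basis vectors.\<close>

lemma smooth_partial_any: "smooth f \<Longrightarrow> smooth (partial v f)"
  unfolding partial_expand[of f v] scaleR_conv_of_real by (intro smooth_sum smooth_cmult smooth_partial)

lemma partial_translate: "partial v (\<lambda>x. f (x + c)) = (\<lambda>x. partial v f (x + c))"
  unfolding partial_def by (simp only: add.assoc add.commute[of c])

lemma smooth_translate:
  assumes "smooth f"
  shows "smooth (\<lambda>x. f (x + c))"
proof (rule smooth_coinduct[where P = "\<lambda>h. \<exists>f. smooth f \<and> h = (\<lambda>x. f (x + c))"])
  show "\<exists>g. smooth g \<and> (\<lambda>x. f (x + c)) = (\<lambda>x. g (x + c))" using assms by blast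
next
  fix g x assume "\<exists>f. smooth f \<and> g = (\<lambda>x. f (x + c))"
  then obtain f where f: "smooth f" "g = (\<lambda>x. f (x + c))" by blast
  then show "g differentiable at x"
    by (auto intro!: differentiable_compose[of f "\<lambda>x. x + c"] simp: smooth_differentiable)
next
  fix g :: "'a \<Rightarrow> complex" and b :: 'a
  assume "\<exists>f. smooth f \<and> g = (\<lambda>x. f (x + c))" "b \<in> Basis"
  then show "\<exists>f. smooth f \<and> partial b g = (\<lambda>x. f (x + c))"
    using partial_translate smooth_partial by metis
qed

lemma partial_fst:
  "partial (b, 0) (\<lambda>z. f (fst z)) = (\<lambda>z. partial b f (fst z))"
  "partial (0, c) (\<lambda>z. f (fst z)) = (\<lambda>z. 0)"
  by (simp_all add: partial_def)

lemma smooth_fst: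
  assumes "smooth f"
  shows "smooth (\<lambda>z::'a::euclidean_space \<times> 'b::euclidean_space. f (fst z))"
proof (rule smooth_coinduct[where P = "\<lambda>h. \<exists>f. smooth f \<and> h = (\<lambda>z. f (fst z))"])
  show "\<exists>g. smooth g \<and> (\<lambda>z. f (fst z)) = (\<lambda>z. g (fst z))" using assms by blast
next
  fix g :: "'a \<times> 'b \<Rightarrow> complex" and x :: "'a \<times> 'b" assume "\<exists>f. smooth f \<and> g = (\<lambda>z. f (fst z))"
  then obtain f where f: "smooth f" "g = (\<lambda>z. f (fst z))" by blast
  then show "g differentiable at x"
    by (auto intro!: differentiable_compose[of f fst] simp: smooth_differentiable bounded_linear_fst bounded_linear_imp_differentiable)
next
  fix g :: "'a \<times> 'b \<Rightarrow> complex" and b :: "'a \<times> 'b"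
  assume "\<exists>f. smooth f \<and> g = (\<lambda>z. f (fst z))" "b \<in> Basis"
  then obtain f where f: "smooth f" "g = (\<lambda>z. f (fst z))" by blast
  consider c where "c \<in> Basis" "b = (c, 0)" | c where "b = (0, c)"
    using \<open>b \<in> Basis\<close> by (auto simp: Basis_prod_def)
  then show "\<exists>f. smooth f \<and> partial b g = (\<lambda>z. f (fst z))"
  proof cases
    case 1
    then show ?thesis
      using f smooth_partial[of f c] by (auto simp: partial_fst)
  next
    case 2
    then show ?thesis
      using f smooth_const[of 0] by (auto simp: partial_fst)
  qed
qed

lemma partial_slice: "partial b (\<lambda>x. F (x, \<xi>)) = (\<lambda>x. partial (b, 0) F (x, \<xi>))"
  by (simp add: partial_def)

lemma fold_partial_slice:
  "fold partial vs (\<lambda>x. F (x, \<xi>)) = (\<lambda>x. fold partial (map (\<lambda>b. (b, 0)) vs) F (x, \<xi>))"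
  by (induction vs arbitrary: F) (simp_all add: partial_slice)

lemma smooth_slice:
  fixes F :: "'a::euclidean_space \<times> 'b::euclidean_space \<Rightarrow> complex"
  assumes "smooth F"
  shows "smooth (\<lambda>x. F (x, \<xi>))"
proof (rule smooth_coinduct[where P = "\<lambda>h. \<exists>F. smooth F \<and> h = (\<lambda>x. F (x, \<xi>))"])
  show "\<exists>G. smooth G \<and> (\<lambda>x. F (x, \<xi>)) = (\<lambda>x. G (x, \<xi>))" using assms by blast
next
  fix g :: "'a \<Rightarrow> complex" and x :: 'a assume "\<exists>F. smooth F \<and> g = (\<lambda>x. F (x, \<xi>))"
  then obtain F :: "'a \<times> 'b \<Rightarrow> complex" where f: "smooth F" "g = (\<lambda>x. F (x, \<xi>))" by blast
  then show "g differentiable at x"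
    by (auto intro!: differentiable_compose[of F "\<lambda>x. (x, \<xi>)"] simp: smooth_differentiable differentiable_Pair)
next
  fix g :: "'a \<Rightarrow> complex" and b :: 'a
  assume "\<exists>F. smooth F \<and> g = (\<lambda>x. F (x, \<xi>))" "b \<in> Basis"
  then obtain F :: "'a \<times> 'b \<Rightarrow> complex" where "smooth F" "g = (\<lambda>x. F (x, \<xi>))" by blast
  then show "\<exists>F. smooth F \<and> partial b g = (\<lambda>x. F (x, \<xi>))"
    using partial_slice[of b F \<xi>] smooth_partial[of F "(b, 0)"] \<open>b \<in> Basis\<close>
    by (auto simp: Basis_prod_def)
qed

subsection \<open>Characters\<close>

text \<open>The character of frequency k, viewed on the product space so that it can be
  differentiated and averaged together with functions of (x, \<xi>).\<close>

definition chr :: "'a::euclidean_space \<Rightarrow> 'b \<times> 'a \<Rightarrow> complex" where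
  "chr k z = exp (\<i> * of_real (k \<bullet> snd z))"

lemma norm_chr [simp]: "cmod (chr k z) = 1"
  by (simp add: chr_def)

lemma has_derivative_chr:
  fixes z :: "'b::euclidean_space \<times> 'a::euclidean_space"
  shows "(chr k has_derivative (\<lambda>v. \<i> * of_real (k \<bullet> snd v) * chr k z)) (at z)"
proof -
  have "((\<lambda>z. k \<bullet> snd z) has_derivative (\<lambda>v. k \<bullet> snd v)) (at z)"
    by (auto intro!: derivative_eq_intros)
  then have "((\<lambda>z. of_real (k \<bullet> snd z) :: complex) has_derivative (\<lambda>v. of_real (k \<bullet> snd v))) (at z)"
    by (rule has_derivative_of_real)
  then have 1: "((\<lambda>z. \<i> * of_real (k \<bullet> snd z) :: complex) has_derivative (\<lambda>v. \<i> * of_real (k \<bullet> snd v))) (at z)"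
    by (rule has_derivative_mult_right)
  have "(exp has_derivative (\<lambda>u. u * exp (\<i> * of_real (k \<bullet> snd z)))) (at (\<i> * of_real (k \<bullet> snd z) :: complex))"
    using DERIV_exp[of "\<i> * of_real (k \<bullet> snd z)"] unfolding has_field_derivative_def by (simp add: mult.commute[of _ "exp _"])
  from has_derivative_compose[OF 1 this] show ?thesis
    by (simp add: chr_def[abs_def])
qed

lemma partial_chr_mult:
  fixes G :: "'b::euclidean_space \<times> 'a::euclidean_space \<Rightarrow> complex"
  assumes "smooth G"
  shows "partial v (\<lambda>z. chr k z * G z)
    = (\<lambda>z. chr k z * (\<i> * of_real (k \<bullet> snd v) * G z + partial v G z))"
proof
  fix z
  have "((\<lambda>z. chr k z * G z) has_derivative
      (\<lambda>v. chr k z * partial v G z + \<i> * of_real (k \<bullet> snd v) * chr k z * G z)) (at z)"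
    using assms by (intro has_derivative_mult has_derivative_chr has_derivative_partial smooth_differentiable)
  then show "partial v (\<lambda>z. chr k z * G z) z = chr k z * (\<i> * of_real (k \<bullet> snd v) * G z + partial v G z)"
    by (simp add: partial_eq_derivative algebra_simps)
qed

lemma smooth_chr_mult:
  fixes G :: "'b::euclidean_space \<times> 'a::euclidean_space \<Rightarrow> complex"
  assumes "smooth G"
  shows "smooth (\<lambda>z. chr k z * G z)"
proof (rule smooth_coinduct[where P = "\<lambda>h. \<exists>G. smooth G \<and> h = (\<lambda>z. chr k z * G z)"])
  show "\<exists>H. smooth H \<and> (\<lambda>z. chr k z * G z) = (\<lambda>z. chr k z * H z)" using assms by blast
next
  fix g :: "'b \<times> 'a \<Rightarrow> complex" and z assume "\<exists>G. smooth G \<and> g = (\<lambda>z. chr k z * G z)"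
  then obtain G where "smooth G" "g = (\<lambda>z. chr k z * G z)" by blast
  moreover have "(chr k :: 'b \<times> 'a \<Rightarrow> complex) differentiable (at z)"
    unfolding differentiable_def using has_derivative_chr by metis
  ultimately show "g differentiable at z"
    by (simp add: differentiable_mult smooth_differentiable)
next
  fix g :: "'b \<times> 'a \<Rightarrow> complex" and b :: "'b \<times> 'a"
  assume "\<exists>G. smooth G \<and> g = (\<lambda>z. chr k z * G z)" "b \<in> Basis"
  then obtain G where "smooth G" "g = (\<lambda>z. chr k z * G z)" by blast
  moreover from this have "smooth (\<lambda>z. \<i> * of_real (k \<bullet> snd b) * G z + partial b G z)"
    using \<open>b \<in> Basis\<close> by (intro smooth_add smooth_cmult smooth_partial)
  ultimately show "\<exists>G. smooth G \<and> partial b g = (\<lambda>z. chr k z * G z)"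
    using partial_chr_mult[of G b k] by blast
qed

subsection \<open>Integrals along segments and symmetry of second derivatives\<close>

lemma continuous_on_segment:
  fixes f :: "'v::euclidean_space \<Rightarrow> complex"
  assumes "smooth f"
  shows "continuous_on A (\<lambda>t. f (x + t *\<^sub>R v))"
  by (rule continuous_on_compose2[OF smooth_continuous_on[OF assms, of UNIV]])
    (auto intro!: continuous_intros)

lemma has_derivative_segment_integral:
  fixes f :: "'v::euclidean_space \<Rightarrow> complex"
  assumes f: "smooth f"
  shows "((\<lambda>x. integral {a..b} (\<lambda>t. f (x + t *\<^sub>R w))) has_derivative
    (\<lambda>v. integral {a..b} (\<lambda>t. partial v f (x + t *\<^sub>R w)))) (at x)"
proof -
  \<comment> \<open>Differentiation under the integral needs the derivative as a jointly continuous
    map of (x, t), hence its packaging as a bounded linear function; continuity is then checked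
    componentwise.\<close>
  define D where "D x = Blinfun (\<lambda>v. partial v f x)" for x
  have hd: "(f has_derivative (\<lambda>v. partial v f x)) (at x)" for x
    by (intro has_derivative_partial smooth_differentiable f)
  have D: "blinfun_apply (D x) = (\<lambda>v. partial v f x)" for x
    unfolding D_def by (rule bounded_linear_Blinfun_apply[OF has_derivative_bounded_linear[OF hd]])
  have contD: "continuous_on A D" for A
    by (rule continuous_on_blinfun_componentwise)
      (simp add: D smooth_continuous_on[OF smooth_partial_any[OF f]])
  have "((\<lambda>x. integral (cbox a b) (\<lambda>t. f (x + t *\<^sub>R w))) has_derivative
      blinfun_apply (integral (cbox a b) (\<lambda>t. D (x + t *\<^sub>R w)))) (at x within UNIV)"
  proof (rule leibniz_rule)
    fix x t
    have "((\<lambda>x. x + t *\<^sub>R w) has_derivative (\<lambda>v. v)) (at x)"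
      by (auto intro!: derivative_eq_intros)
    from has_derivative_compose[OF this hd]
    show "((\<lambda>x. f (x + t *\<^sub>R w)) has_derivative blinfun_apply (D (x + t *\<^sub>R w))) (at x within UNIV)"
      by (simp add: D)
  next
    fix x show "(\<lambda>t. f (x + t *\<^sub>R w)) integrable_on cbox a b"
      by (intro integrable_continuous continuous_on_segment f)
  next
    have "continuous_on (UNIV \<times> cbox a b) (\<lambda>z. D (fst z + snd z *\<^sub>R w))"
      by (rule continuous_on_compose2[OF contD[of UNIV]]) (auto intro!: continuous_intros)
    then show "continuous_on (UNIV \<times> cbox a b) (\<lambda>(x, t). D (x + t *\<^sub>R w))"
      by (simp add: case_prod_unfold)
  qed auto
  moreover have "(\<lambda>t. D (x + t *\<^sub>R w)) integrable_on cbox a b"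
    by (intro integrable_continuous continuous_on_compose2[OF contD[of UNIV]])
      (auto intro!: continuous_intros)
  then have "blinfun_apply (integral (cbox a b) (\<lambda>t. D (x + t *\<^sub>R w)))
      = (\<lambda>v. integral (cbox a b) (\<lambda>t. partial v f (x + t *\<^sub>R w)))"
    by (intro ext) (simp add: blinfun_apply_integral D)
  ultimately show ?thesis
    by simp
qed

lemma partial_segment_integral:
  assumes "smooth f"
  shows "partial v (\<lambda>x. integral {a..b} (\<lambda>t. f (x + t *\<^sub>R w)))
    = (\<lambda>x. integral {a..b} (\<lambda>t. partial v f (x + t *\<^sub>R w)))"
  using partial_eq_derivative[OF has_derivative_segment_integral[OF assms]] by blast

lemma smooth_segment_integral:
  fixes f :: "'v::euclidean_space \<Rightarrow> complex"
  assumes "smooth f"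
  shows "smooth (\<lambda>x. integral {a..b} (\<lambda>t. f (x + t *\<^sub>R w)))"
proof (rule smooth_coinduct[where P = "\<lambda>h. \<exists>f. smooth f \<and> h = (\<lambda>x. integral {a..b} (\<lambda>t. f (x + t *\<^sub>R w)))"])
  show "\<exists>g. smooth g \<and> (\<lambda>x. integral {a..b} (\<lambda>t. f (x + t *\<^sub>R w)))
      = (\<lambda>x. integral {a..b} (\<lambda>t. g (x + t *\<^sub>R w)))"
    using assms by blast
next
  fix g and x :: 'v
  assume "\<exists>f. smooth f \<and> g = (\<lambda>x. integral {a..b} (\<lambda>t. f (x + t *\<^sub>R w)))"
  then show "g differentiable at x"
    using has_derivative_segment_integral[of _ a b w x] unfolding differentiable_def by blast
next
  fix g and c :: 'v
  assume "\<exists>f. smooth f \<and> g = (\<lambda>x. integral {a..b} (\<lambda>t. f (x + t *\<^sub>R w)))" "c \<in> Basis"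
  then show "\<exists>f. smooth f \<and> partial c g = (\<lambda>x. integral {a..b} (\<lambda>t. f (x + t *\<^sub>R w)))"
    using partial_segment_integral[of _ c a b w] smooth_partial by blast
qed

lemma has_vector_derivative_segment:
  fixes f :: "'v::euclidean_space \<Rightarrow> complex"
  assumes "smooth f"
  shows "((\<lambda>t. f (x + t *\<^sub>R v)) has_vector_derivative partial v f (x + t *\<^sub>R v)) (at t within A)"
proof -
  have "((\<lambda>t. x + t *\<^sub>R v) has_derivative (\<lambda>u. u *\<^sub>R v)) (at t within A)"
    by (auto intro!: derivative_eq_intros)
  from has_derivative_compose[OF this has_derivative_partial[OF smooth_differentiable[OF assms]]]
  have "((\<lambda>t. f (x + t *\<^sub>R v)) has_derivative (\<lambda>u. partial (u *\<^sub>R v) f (x + t *\<^sub>R v))) (at t within A)" .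
  moreover have "partial (u *\<^sub>R v) f z = u *\<^sub>R partial v f z" for u z
    using linear_cmul[OF has_derivative_linear[OF has_derivative_partial[OF smooth_differentiable[OF assms]]]] .
  ultimately show ?thesis
    by (simp add: has_vector_derivative_def)
qed

lemma segment_ftc:
  fixes f :: "'v::euclidean_space \<Rightarrow> complex"
  assumes "smooth f" "a \<le> b"
  shows "integral {a..b} (\<lambda>t. partial v f (x + t *\<^sub>R v)) = f (x + b *\<^sub>R v) - f (x + a *\<^sub>R v)"
  by (rule integral_unique, rule fundamental_theorem_of_calculus)
    (use assms has_vector_derivative_segment in auto)

text \<open>The increment f (x + u v) - f x is the integral of \<open>partial v f\<close> over
  {0..u}. Differentiating it along w, and writing the increment of \<open>partial w f\<close> as an
  integral too, gives two equal integrals for every u in {0..1}; their one-sided derivatives at u =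
  0 are the two mixed partials.\<close>

lemma partial_commute:
  fixes f :: "'v::euclidean_space \<Rightarrow> complex"
  assumes f: "smooth f"
  shows "partial v (partial w f) = partial w (partial v f)"
proof
  fix x
  note [simp] = smooth_partial_any f
  have eq: "integral {0..u} (\<lambda>t. partial w (partial v f) (x + t *\<^sub>R v))
      = integral {0..u} (\<lambda>t. partial v (partial w f) (x + t *\<^sub>R v))" if "u \<in> {0..1}" for u
  proof -
    have "(\<lambda>x. integral {0..u} (\<lambda>t. partial v f (x + t *\<^sub>R v)))
        = (\<lambda>x. 1 * f (x + u *\<^sub>R v) + (- 1) * f x)"
      using that by (simp add: segment_ftc)
    then have "partial w (\<lambda>x. integral {0..u} (\<lambda>t. partial v f (x + t *\<^sub>R v))) x
        = partial w f (x + u *\<^sub>R v) - partial w f x"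
      using smooth_translate[OF f, of "u *\<^sub>R v"]
      by (simp only: partial_comb[OF _ f] partial_translate) simp
    also have "\<dots> = integral {0..u} (\<lambda>t. partial v (partial w f) (x + t *\<^sub>R v))"
      using that by (simp add: segment_ftc)
    finally show ?thesis
      by (simp add: partial_segment_integral)
  qed
  have hv: "((\<lambda>u. integral {0..u} (\<lambda>t. partial a (partial b f) (x + t *\<^sub>R v))) has_vector_derivative
      partial a (partial b f) (x + 0 *\<^sub>R v)) (at 0 within {0..1::real})" for a b
    by (rule integral_has_vector_derivative) (auto intro!: continuous_on_segment)
  have "((\<lambda>u. integral {0..u} (\<lambda>t. partial v (partial w f) (x + t *\<^sub>R v))) has_vector_derivative
      partial w (partial v f) (x + 0 *\<^sub>R v)) (at 0 within {0..1::real})"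
    by (rule has_vector_derivative_transform[OF _ _ hv[of w v]]) (use eq in auto)
  then show "partial v (partial w f) x = partial w (partial v f) x"
    using vector_derivative_unique_within_closed_interval[of 0 1 0] hv[of v w] by fastforce
qed

lemma fold_partial_commute1:
  assumes "smooth f" "set vs \<subseteq> Basis"
  shows "fold partial vs (partial v f) = partial v (fold partial vs f)"
  using assms
proof (induction vs arbitrary: f)
  case (Cons a vs)
  then show ?case
    using partial_commute[of f a v] by (simp add: smooth_partial)
qed simp

lemma fold_partial_mset:
  assumes "smooth f" "set vs \<subseteq> Basis" "mset vs = mset ws"
  shows "fold partial vs f = fold partial ws f"
  using assms
proof (induction vs arbitrary: f ws)
  case Nil
  then show ?case by simp
next
  case (Cons v vs)
  have "v \<in> set ws"
    using Cons.prems(3) by (metis list.set_intros(1) set_mset_mset)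
  then obtain us us' where ws: "ws = us @ v # us'"
    by (meson split_list)
  have "set ws \<subseteq> Basis"
    using Cons.prems by (metis set_mset_mset)
  then have us: "set us \<subseteq> Basis" "v \<in> Basis" by (auto simp: ws)
  have "fold partial vs (partial v f) = fold partial (us @ us') (partial v f)"
    using Cons.prems us by (intro Cons.IH) (auto simp: ws smooth_partial)
  then have "fold partial (v # vs) f = fold partial (us @ us') (partial v f)"
    by simp
  also have "\<dots> = fold partial ws f"
    using Cons.prems us by (simp add: ws fold_partial_commute1)
  finally show ?case .
qed

subsection \<open>Locally uniform limits\<close>

text \<open>A limit \<open>g vs\<close> is supplied for every list of directions, so each order is
  treated separately: the theorem on derivatives of sequences, applied on an open ball around x,
  identifies \<open>g (vs @ [b])\<close> as the partial derivative of \<open>g vs\<close>.\<close>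

lemma smooth_limit:
  fixes f :: "nat \<Rightarrow> 'v::euclidean_space \<Rightarrow> complex"
  assumes f: "\<And>n. smooth (f n)"
    and lim: "\<And>vs R. set vs \<subseteq> Basis \<Longrightarrow>
      uniform_limit (cball 0 R) (\<lambda>n. fold partial vs (f n)) (g vs) sequentially"
  shows "smooth (g [])" "set vs \<subseteq> Basis \<Longrightarrow> fold partial vs (g []) = g vs"
proof -
  have hd: "(g vs has_derivative (\<lambda>v. \<Sum>b\<in>Basis. (v \<bullet> b) *\<^sub>R g (vs @ [b]) x)) (at x)"
    if vs: "set vs \<subseteq> Basis" for vs x
  proof -
    define S where "S = ball (0::'v) (norm x + 1)"
    have S: "convex S" "open S" "x \<in> S" "S \<subseteq> cball 0 (norm x + 1)"
      by (auto simp: S_def)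
    have ptw: "(\<lambda>n. fold partial vs (f n) y) \<longlonglongrightarrow> g vs y" if "y \<in> S" for y
      using tendsto_uniform_limitI[OF lim[OF vs]] S(4) that by blast
    have "\<exists>h. \<forall>y\<in>S. (\<lambda>n. fold partial vs (f n) y) \<longlonglongrightarrow> h y \<and>
        (h has_derivative (\<lambda>v. \<Sum>b\<in>Basis. (v \<bullet> b) *\<^sub>R g (vs @ [b]) y)) (at y within S)"
    proof (rule has_derivative_sequence[where f = "\<lambda>n. fold partial vs (f n)" and l = "g vs x", OF S(1) _ _ S(3) ptw[OF S(3)]])
      fix n y
      show "(fold partial vs (f n) has_derivative
          (\<lambda>v. \<Sum>b\<in>Basis. (v \<bullet> b) *\<^sub>R fold partial (vs @ [b]) (f n) y)) (at y within S)"
        using has_derivative_at_withinI[OF has_derivative_partials[OF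
              smooth_differentiable[OF smooth_fold_partial[OF f[of n] vs]]]] by simp
    next
      fix e :: real assume e: "e > 0"
      \<comment> \<open>The expansion over \<open>Basis\<close> has DIM('v) terms, and each one may
        contribute d * norm h.\<close>
      define d where "d = e / DIM('v)"
      have d: "d > 0" using e by (simp add: d_def)
      have "\<forall>\<^sub>F n in sequentially. \<forall>b\<in>Basis. \<forall>y\<in>S.
          dist (fold partial (vs @ [b]) (f n) y) (g (vs @ [b]) y) < d"
      proof (rule eventually_ball_finite, simp, intro ballI)
        fix b :: 'v assume "b \<in> Basis"
        then have "set (vs @ [b]) \<subseteq> Basis" using vs by simp
        from uniform_limitD[OF lim[OF this, of "norm x + 1"] d]
        show "\<forall>\<^sub>F n in sequentially. \<forall>y\<in>S. dist (fold partial (vs @ [b]) (f n) y) (g (vs @ [b]) y) < d"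
          by (rule eventually_mono) (use S(4) in blast)
      qed
      then show "\<forall>\<^sub>F n in sequentially. \<forall>y\<in>S. \<forall>h. norm ((\<Sum>b\<in>Basis. (h \<bullet> b) *\<^sub>R fold partial (vs @ [b]) (f n) y)
          - (\<Sum>b\<in>Basis. (h \<bullet> b) *\<^sub>R g (vs @ [b]) y)) \<le> e * norm h"
      proof (rule eventually_mono, intro ballI allI)
        fix n y h
        assume a: "\<forall>b\<in>Basis. \<forall>y\<in>S. dist (fold partial (vs @ [b]) (f n) y) (g (vs @ [b]) y) < d" and y: "y \<in> S"
        have "norm ((\<Sum>b\<in>Basis. (h \<bullet> b) *\<^sub>R fold partial (vs @ [b]) (f n) y) - (\<Sum>b\<in>Basis. (h \<bullet> b) *\<^sub>R g (vs @ [b]) y))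
            = norm (\<Sum>b\<in>Basis. (h \<bullet> b) *\<^sub>R (fold partial (vs @ [b]) (f n) y - g (vs @ [b]) y))"
          by (simp only: scaleR_diff_right sum_subtractf)
        also have "\<dots> \<le> of_nat (card (Basis :: 'v set)) * (norm h * d)"
        proof (rule sum_norm_bound)
          fix b :: 'v assume b: "b \<in> Basis"
          have "norm (fold partial (vs @ [b]) (f n) y - g (vs @ [b]) y) \<le> d"
            using a b y by (force simp: dist_norm)
          then show "norm ((h \<bullet> b) *\<^sub>R (fold partial (vs @ [b]) (f n) y - g (vs @ [b]) y)) \<le> norm h * d"
            unfolding norm_scaleR using Basis_le_norm[OF b, of h] by (intro mult_mono) auto
        qed
        also have "\<dots> = e * norm h" by (simp add: d_def)
        finally show "norm ((\<Sum>b\<in>Basis. (h \<bullet> b) *\<^sub>R fold partial (vs @ [b]) (f n) y)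
          - (\<Sum>b\<in>Basis. (h \<bullet> b) *\<^sub>R g (vs @ [b]) y)) \<le> e * norm h" .
      qed
    qed
    then obtain h where h: "\<And>y. y \<in> S \<Longrightarrow> (\<lambda>n. fold partial vs (f n) y) \<longlonglongrightarrow> h y"
      "(h has_derivative (\<lambda>v. \<Sum>b\<in>Basis. (v \<bullet> b) *\<^sub>R g (vs @ [b]) x)) (at x within S)"
      using S(3) by blast
    have "h y = g vs y" if "y \<in> S" for y
      using LIMSEQ_unique[OF h(1) ptw] that by blast
    then have "(g vs has_derivative (\<lambda>v. \<Sum>b\<in>Basis. (v \<bullet> b) *\<^sub>R g (vs @ [b]) x)) (at x within S)"
      by (intro has_derivative_transform[OF S(3) _ h(2)]) simp
    then show ?thesis
      using at_within_open[OF S(3,2)] by simp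
  qed
  have part: "partial b (g vs) = g (vs @ [b])" if "set vs \<subseteq> Basis" "b \<in> Basis" for vs b
  proof
    fix x
    have "partial b (g vs) x = (\<Sum>c\<in>Basis. (b \<bullet> c) *\<^sub>R g (vs @ [c]) x)"
      by (rule partial_eq_derivative[OF hd[OF that(1)]])
    also have "\<dots> = (\<Sum>c\<in>Basis. if c = b then g (vs @ [c]) x else 0)"
      using that(2) by (intro sum.cong) (auto simp: inner_Basis)
    finally show "partial b (g vs) x = g (vs @ [b]) x"
      using that(2) by simp
  qed
  show "smooth (g [])"
  proof (rule smooth_coinduct[where P = "\<lambda>h. \<exists>vs. set vs \<subseteq> Basis \<and> h = g vs"])
    show "\<exists>vs. set vs \<subseteq> Basis \<and> g [] = g vs" by (intro exI[of _ "[]"]) auto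
  next
    fix h and x :: 'v assume "\<exists>vs. set vs \<subseteq> Basis \<and> h = g vs"
    then obtain vs where "set vs \<subseteq> Basis" "h = g vs" by blast
    then show "h differentiable at x" unfolding differentiable_def using hd[of vs x] by auto
  next
    fix h and b :: 'v assume "\<exists>vs. set vs \<subseteq> Basis \<and> h = g vs" "b \<in> Basis"
    then obtain vs where "set (vs @ [b]) \<subseteq> Basis" "partial b h = g (vs @ [b])" using part by auto
    then show "\<exists>vs. set vs \<subseteq> Basis \<and> partial b h = g vs" by blast
  qed
  show "fold partial vs (g []) = g vs" if "set vs \<subseteq> Basis"
    using that by (induction vs rule: rev_induct) (auto simp: part)
qed

subsection \<open>Multi-indices\<close>

text \<open>Inductions on derivatives run over lists of directions; this list realizes
  \<open>multi_partial\<close> as a fold, and counting its entries recovers the multi-index.\<close>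

definition mi_list :: "('n::finite \<Rightarrow> 'v) \<Rightarrow> ('n \<Rightarrow> nat) \<Rightarrow> 'v list" where
  "mi_list b \<alpha> = concat (map (\<lambda>i. replicate (\<alpha> i) (b i)) coords)"

lemma coords: "distinct (coords :: 'n::finite list)" "set (coords :: 'n list) = UNIV"
proof -
  have "\<exists>is. distinct is \<and> set is = (UNIV :: 'n set)"
    using finite_distinct_list[OF finite] by blast
  from someI_ex[OF this] show "distinct (coords :: 'n list)" "set (coords :: 'n list) = UNIV"
    by (simp_all add: coords_def)
qed

lemma multi_partial_fold:
  fixes b :: "'n::finite \<Rightarrow> 'v::real_normed_vector"
  shows "multi_partial b \<alpha> f = fold partial (mi_list b \<alpha>) f"
proof -
  have rep: "fold partial (replicate n v) f = (partial v ^^ n) f" for n and v :: 'v and f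
    by (induction n arbitrary: f) (simp_all add: funpow_swap1)
  have "fold (\<lambda>i. partial (b i) ^^ \<alpha> i) is f = fold partial (concat (map (\<lambda>i. replicate (\<alpha> i) (b i)) is)) f" for "is" f
    by (induction "is" arbitrary: f) (simp_all add: rep)
  then show ?thesis by (simp add: multi_partial_def mi_list_def)
qed

lemma set_mi_list: "set (mi_list b \<alpha>) \<subseteq> range b"
  by (auto simp: mi_list_def)

lemma map_mi_list: "map g (mi_list b \<alpha>) = mi_list (\<lambda>i. g (b i)) \<alpha>"
  by (simp add: mi_list_def map_concat comp_def)

lemma count_mi_list:
  fixes b :: "'n::finite \<Rightarrow> 'v"
  assumes "inj b"
  shows "count_list (mi_list b \<alpha>) (b i) = \<alpha> i"
proof -
  have rep: "count_list (replicate n x) y = (if x = y then n else 0)" for n and x y :: 'v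
    by (induction n) auto
  have *: "count_list (concat (map (\<lambda>i. replicate (\<alpha> i) (b i)) is)) (b i) = (if i \<in> set is then \<alpha> i else 0)"
    if "distinct is" for "is"
    using that assms by (induction "is") (auto simp: inj_eq rep)
  show ?thesis
    unfolding mi_list_def using *[OF coords(1)] by (simp add: coords(2))
qed

lemma fold_partial_eq_multi_partial:
  fixes b :: "'n::finite \<Rightarrow> 'v::euclidean_space"
  assumes "smooth f" "inj b" "range b \<subseteq> Basis" "set vs \<subseteq> range b"
  shows "fold partial vs f = multi_partial b (\<lambda>i. count_list vs (b i)) f"
proof -
  have "count_list vs v = count_list (mi_list b (\<lambda>i. count_list vs (b i))) v" for v
  proof (cases "v \<in> range b")
    case True
    then obtain i where "v = b i" by blast
    then show ?thesis by (simp add: count_mi_list[OF assms(2)])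
  next
    case False
    then have "v \<notin> set vs" "v \<notin> set (mi_list b (\<lambda>i. count_list vs (b i)))"
      using assms(4) set_mi_list[of b] by auto
    then show ?thesis
      by (simp add: count_notin)
  qed
  then have "mset vs = mset (mi_list b (\<lambda>i. count_list vs (b i)))"
    unfolding multiset_eq_iff count_mset by blast
  then show ?thesis
    unfolding multi_partial_fold using assms by (intro fold_partial_mset order_trans[OF assms(4,3)])
qed

lemma Basis_vec_range: "(Basis :: (real^'n::finite) set) = range (\<lambda>i. axis i 1)"
  by (auto simp: Basis_vec_def)

lemma inj_axis: "inj (\<lambda>i. axis i (1::real) :: real^'n::finite)"
  by (auto simp: inj_def axis_eq_axis)

lemma fold_partial_deriv_mi:
  fixes f :: "real^'n::finite \<Rightarrow> complex"
  assumes "smooth f" "set vs \<subseteq> Basis"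
  shows "fold partial vs f = deriv_mi (\<lambda>i. count_list vs (axis i 1)) f"
  unfolding deriv_mi_def
  using assms fold_partial_eq_multi_partial[OF assms(1) inj_axis] by (simp add: Basis_vec_range)

subsection \<open>Averages over segments\<close>

text \<open>The parameter interval has length one, so the integral is already a mean. Centring it at
  z puts z in the interior, where the uniqueness argument for Fourier coefficients uses a two-sided
  derivative.\<close>

definition seg_avg :: "'v::euclidean_space \<Rightarrow> ('v \<Rightarrow> complex) \<Rightarrow> 'v \<Rightarrow> complex" where
  "seg_avg w F = (\<lambda>z. integral {-1/2..1/2} (\<lambda>t. F (z + t *\<^sub>R w)))"

lemma smooth_seg_avg: "smooth F \<Longrightarrow> smooth (seg_avg w F)"
  unfolding seg_avg_def by (rule smooth_segment_integral)

lemma partial_seg_avg: "smooth F \<Longrightarrow> partial v (seg_avg w F) = seg_avg w (partial v F)"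
  unfolding seg_avg_def by (rule partial_segment_integral)

lemma segment_integrable: "smooth F \<Longrightarrow> (\<lambda>t. F (z + t *\<^sub>R w)) integrable_on {a..b}"
  by (intro integrable_continuous_real continuous_on_segment)

lemma seg_avg_comb:
  assumes "smooth F" "smooth G"
  shows "seg_avg w (\<lambda>z. a * F z + b * G z) = (\<lambda>z. a * seg_avg w F z + b * seg_avg w G z)"
  unfolding seg_avg_def using assms
  by (simp add: integral_add segment_integrable integrable_on_mult_right)

lemma seg_avg_translate: "seg_avg w (\<lambda>z. F (z + c)) = (\<lambda>z. seg_avg w F (z + c))"
  by (simp add: seg_avg_def add.assoc add.commute[of c])

lemma seg_avg_bound:
  assumes "smooth F" "\<And>t. cmod (F (z + t *\<^sub>R w)) \<le> B"
  shows "cmod (seg_avg w F z) \<le> B"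
proof -
  have "norm (integral {-1/2..1/2} (\<lambda>t. F (z + t *\<^sub>R w))) \<le> integral {-1/2..1/2::real} (\<lambda>t. B)"
    by (rule integral_norm_bound_integral) (use assms segment_integrable in auto)
  then show ?thesis by (simp add: seg_avg_def)
qed

text \<open>The fundamental theorem of calculus along one full period leaves two boundary values,
  which coincide.\<close>

lemma seg_avg_partial_self:
  assumes "smooth F" "\<And>z. F (z + w) = F z"
  shows "seg_avg w (partial w F) = (\<lambda>_. 0)"
proof
  fix z
  have "seg_avg w (partial w F) z = F (z + (1/2) *\<^sub>R w) - F (z + (-1/2) *\<^sub>R w)"
    unfolding seg_avg_def using assms(1) by (intro segment_ftc) auto
  also have "z + (1/2) *\<^sub>R w = (z + (-1/2) *\<^sub>R w) + w"
    by (simp add: algebra_simps flip: scaleR_add_left)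
  finally show "seg_avg w (partial w F) z = 0"
    using assms(2) by simp
qed

definition avg :: "'v::euclidean_space list \<Rightarrow> ('v \<Rightarrow> complex) \<Rightarrow> 'v \<Rightarrow> complex" where
  "avg ws F = fold seg_avg ws F"

lemma avg_simps [simp]: "avg [] F = F" "avg (w # ws) F = avg ws (seg_avg w F)"
  by (simp_all add: avg_def)

lemma smooth_avg: "smooth F \<Longrightarrow> smooth (avg ws F)"
  by (induction ws arbitrary: F) (simp_all add: smooth_seg_avg)

lemma partial_avg: "smooth F \<Longrightarrow> partial v (avg ws F) = avg ws (partial v F)"
  by (induction ws arbitrary: F) (simp_all add: smooth_seg_avg partial_seg_avg)

lemma fold_partial_avg:
  "smooth F \<Longrightarrow> set vs \<subseteq> Basis \<Longrightarrow> fold partial vs (avg ws F) = avg ws (fold partial vs F)"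
  by (induction vs arbitrary: F) (simp_all add: partial_avg smooth_partial)

lemma avg_comb:
  assumes "smooth F" "smooth G"
  shows "avg ws (\<lambda>z. a * F z + b * G z) = (\<lambda>z. a * avg ws F z + b * avg ws G z)"
  using assms by (induction ws arbitrary: F G) (simp_all add: seg_avg_comb smooth_seg_avg)

lemma avg_diff:
  assumes "smooth F" "smooth G"
  shows "avg ws (\<lambda>z. F z - G z) = (\<lambda>z. avg ws F z - avg ws G z)"
  using avg_comb[OF assms, of ws 1 "-1"] by simp

lemma avg_add:
  assumes "smooth F" "smooth G"
  shows "avg ws (\<lambda>z. F z + G z) = (\<lambda>z. avg ws F z + avg ws G z)"
  using avg_comb[OF assms, of ws 1 1] by simp

lemma avg_cmult: "smooth F \<Longrightarrow> avg ws (\<lambda>z. c * F z) = (\<lambda>z. c * avg ws F z)"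
  using avg_comb[of F F ws c 0] by simp

lemma avg_zero: "avg ws (\<lambda>_. 0) = (\<lambda>_. 0)"
  by (induction ws) (simp_all add: seg_avg_def)

lemma avg_sum:
  assumes "\<And>i. i \<in> I \<Longrightarrow> smooth (F i)"
  shows "avg ws (\<lambda>z. \<Sum>i\<in>I. F i z) = (\<lambda>z. \<Sum>i\<in>I. avg ws (F i) z)"
  using assms
  by (induction I rule: infinite_finite_induct) (simp_all add: avg_zero avg_add smooth_sum)

lemma avg_translate: "avg ws (\<lambda>z. F (z + c)) = (\<lambda>z. avg ws F (z + c))"
  by (induction ws arbitrary: F) (simp_all add: seg_avg_translate)

text \<open>\<open>P\<close> singles out a set stable under translation along \<open>ws\<close>. The
  applications fix the first component, so that a bound on a single fibre suffices.\<close>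

lemma avg_bound:
  assumes "smooth F" "P z" "\<And>z w t. P z \<Longrightarrow> w \<in> set ws \<Longrightarrow> P (z + t *\<^sub>R w)"
    "\<And>z. P z \<Longrightarrow> cmod (F z) \<le> B"
  shows "cmod (avg ws F z) \<le> B"
  using assms
proof (induction ws arbitrary: F)
  case (Cons w ws)
  have "cmod (seg_avg w F y) \<le> B" if "P y" for y
    using Cons.prems that by (intro seg_avg_bound) auto
  then have "cmod (avg ws (seg_avg w F) z) \<le> B"
    using Cons.prems by (intro Cons.IH) (auto intro: smooth_seg_avg)
  then show ?case by simp
qed simp

text \<open>An average in another direction commutes with \<open>partial w\<close> and preserves the
  period w, so the derivative can be moved inward until the average along w itself is
  reached.\<close>

lemma avg_partial_self:
  assumes "smooth F" "w \<in> set ws" "\<And>z. F (z + w) = F z"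
  shows "avg ws (partial w F) = (\<lambda>_. 0)"
  using assms
proof (induction ws arbitrary: F)
  case (Cons a ws)
  show ?case
  proof (cases "a = w")
    case True
    then show ?thesis
      using seg_avg_partial_self[OF Cons.prems(1,3)] by (simp add: avg_zero)
  next
    case False
    have "seg_avg a F (z + w) = seg_avg a F z" for z
      using fun_cong[OF seg_avg_translate[of a F w], of z] Cons.prems(3) by simp
    then show ?thesis
      using Cons False by (simp add: smooth_seg_avg flip: partial_seg_avg)
  qed
qed simp

lemma partial_sum_direction:
  fixes F :: "'v::euclidean_space \<Rightarrow> complex"
  assumes "smooth F"
  shows "partial (\<Sum>i\<in>I. c i *\<^sub>R w i) F = (\<lambda>z. \<Sum>i\<in>I. of_real (c i) * partial (w i) F z)"
proof
  fix z
  have lin: "linear (\<lambda>v. partial v F z)"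
    by (rule has_derivative_linear[OF has_derivative_partial[OF smooth_differentiable[OF assms]]])
  show "partial (\<Sum>i\<in>I. c i *\<^sub>R w i) F z = (\<Sum>i\<in>I. of_real (c i) * partial (w i) F z)"
    by (simp add: linear_sum[OF lin] linear_cmul[OF lin] scaleR_conv_of_real)
qed

text \<open>The derivative is linear in its direction. Since the dual basis spans, this removes the
  \<xi>-derivative in every direction and not only along the periods.\<close>

lemma avg_partial_zero:
  assumes "smooth F" "\<And>i. i \<in> I \<Longrightarrow> w i \<in> set ws" "\<And>z i. i \<in> I \<Longrightarrow> F (z + w i) = F z"
  shows "avg ws (partial (\<Sum>i\<in>I. c i *\<^sub>R w i) F) = (\<lambda>_. 0)"
proof -
  have "avg ws (partial (w i) F) = (\<lambda>_. 0)" if "i \<in> I" for i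
    using assms that by (intro avg_partial_self) auto
  then show ?thesis
    using assms(1)
    by (simp add: partial_sum_direction avg_sum smooth_cmult smooth_partial_any avg_cmult)
qed

subsection \<open>Uniqueness of Fourier coefficients\<close>

lemma cis_integral:
  "integral {-1/2..1/2} (\<lambda>t. cis (2 * pi * of_int n * t)) = (if n = 0 then 1 else 0)"
proof (cases "n = 0")
  case False
  define c where "c = 2 * pi * of_int n"
  have c: "c \<noteq> 0" using False by (simp add: c_def)
  have d: "((\<lambda>t. cis (c * t) / (\<i> * of_real c)) has_vector_derivative cis (c * t)) (at t within A)" for t A
    using c unfolding cis_conv_exp
    by (auto intro!: derivative_eq_intros has_vector_derivative_real_field simp: field_simps)
  have "integral {-1/2..1/2} (\<lambda>t. cis (c * t)) = cis (c * (1/2)) / (\<i> * of_real c) - cis (c * (-1/2)) / (\<i> * of_real c)"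
    by (rule integral_unique, rule fundamental_theorem_of_calculus) (use d in auto)
  also have "cis (c * (1/2)) = cis (c * (-1/2) + 2 * pi * of_int n)"
    by (simp add: c_def)
  also have "\<dots> = cis (c * (-1/2)) * cis (2 * pi * of_int n)"
    by (simp only: cis_mult)
  also have "cis (2 * pi * of_int n) = 1"
    by (rule cis_multiple_2pi) auto
  finally show ?thesis using False by (simp add: c_def)
qed simp

text \<open>Averaging the constant sequence over its first terms turns the integrand into a geometric
  mean that tends to \<open>0\<close> off the origin.\<close>
lemma constant_coefficients_zero:
  assumes h: "continuous_on {-1/2..1/2} h" and s: "s = 1 \<or> s = - 1"
    and c: "\<And>n::nat. integral {-1/2..1/2} (\<lambda>t. cis (2 * pi * of_int (m + s * int n) * t) * h t) = a"
  shows "a = (0::complex)"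
proof -
  let ?I = "{-1/2..1/2::real}"
  define q where "q t = cis (2 * pi * of_int s * t)" for t
  define f where "f N t = (\<Sum>n<Suc N. cis (2 * pi * of_int (m + s * int n) * t) * h t) / of_nat (Suc N)" for N t
  have int: "(\<lambda>t. cis (2 * pi * of_int k * t) * h t) integrable_on ?I" for k
    by (intro integrable_continuous_real continuous_intros h)
  have intf: "f N integrable_on ?I" for N
    unfolding f_def by (intro integrable_on_divide integrable_sum int) auto
  have fa: "integral ?I (f N) = a" for N
    unfolding f_def integral_divide
    by (subst integral_sum)
      (simp_all only: finite_lessThan int c sum_constant card_lessThan, simp del: of_nat_Suc)
  obtain B where B: "\<And>t. t \<in> ?I \<Longrightarrow> cmod (h t) \<le> B"
    using compact_imp_bounded[OF compact_continuous_image[OF h compact_Icc]] unfolding bounded_iff by blast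
  have pow: "cis (2 * pi * of_int (m + s * int n) * t) = cis (2 * pi * of_int m * t) * q t ^ n" for n t
  proof -
    have "2 * pi * of_int (m + s * int n) * t = 2 * pi * of_int m * t + real n * (2 * pi * of_int s * t)"
      by (simp add: algebra_simps)
    then show ?thesis by (simp only: q_def Complex.DeMoivre cis_mult)
  qed
  \<comment> \<open>If q t = 1 then s * t is an integer, hence so is t up to sign, and 0 is the only
    integer in the segment.\<close>
  have q1: "q t \<noteq> 1" if "t \<in> ?I" "t \<noteq> 0" for t
  proof
    assume "q t = 1"
    then obtain k :: int where "2 * pi * of_int s * t = of_int k * (2 * pi)"
      by (auto simp: q_def cis_conv_exp exp_eq_1 mult.commute)
    then have "of_int s * t = of_int k" by simp
    then have "\<bar>t\<bar> = \<bar>of_int k\<bar>" using s by auto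
    then have "\<bar>k\<bar> < 1" using that by auto
    with \<open>\<bar>t\<bar> = \<bar>of_int k\<bar>\<close> that show False by simp
  qed
  have lim: "(\<lambda>N. f N t) \<longlonglongrightarrow> (if t = 0 then h 0 else 0)" if t: "t \<in> ?I" for t
  proof (cases "t = 0")
    case True
    have "f N 0 = h 0" for N
      by (simp add: f_def del: of_nat_Suc sum.lessThan_Suc)
    with True show ?thesis by simp
  next
    case False
    have geo: "f N t = cis (2 * pi * of_int m * t) * h t * ((1 - q t ^ Suc N) / (1 - q t)) / of_nat (Suc N)" for N
    proof -
      have "(\<Sum>n<Suc N. q t ^ n) = (1 - q t ^ Suc N) / (1 - q t)"
        using q1[OF t False] by (simp only: sum_gp_strict if_False)
      then show ?thesis
        unfolding f_def pow mult.commute[of _ "h t"] mult.assoc[symmetric]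
        by (simp only: sum_distrib_left[symmetric])
    qed
    have bd: "cmod (f N t) \<le> (cmod (h t) * 2 / cmod (1 - q t)) / real (Suc N)" for N
    proof -
      have "cmod (1 - q t ^ Suc N) \<le> 2"
        by (rule order_trans[OF norm_triangle_ineq4]) (simp add: q_def norm_mult norm_power)
      then have "cmod (h t) * cmod (1 - q t ^ Suc N) / cmod (1 - q t) / real (Suc N)
          \<le> cmod (h t) * 2 / cmod (1 - q t) / real (Suc N)"
        by (intro divide_right_mono mult_left_mono) auto
      then show ?thesis
        unfolding geo by (simp add: norm_mult norm_divide del: of_nat_Suc power_Suc)
    qed
    have "(\<lambda>N. (cmod (h t) * 2 / cmod (1 - q t)) * (1 / real (Suc N))) \<longlonglongrightarrow> (cmod (h t) * 2 / cmod (1 - q t)) * 0"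
      by (intro tendsto_mult tendsto_const) (use LIMSEQ_inverse_real_of_nat in \<open>simp add: inverse_eq_divide\<close>)
    then have "(\<lambda>N. (cmod (h t) * 2 / cmod (1 - q t)) / real (Suc N)) \<longlonglongrightarrow> 0"
      by simp
    then have "(\<lambda>N. f N t) \<longlonglongrightarrow> 0"
      by (rule Lim_null_comparison[rotated]) (use bd in \<open>auto intro!: always_eventually\<close>)
    then show ?thesis using False by simp
  qed
  have bdd: "cmod (f N t) \<le> B" if t: "t \<in> ?I" for N t
  proof -
    have "cmod (\<Sum>n<Suc N. cis (2 * pi * of_int (m + s * int n) * t) * h t) \<le> of_nat (card {..<Suc N}) * B"
      by (rule sum_norm_bound) (use B[OF t] in \<open>simp add: norm_mult\<close>)
    then show ?thesis
      unfolding f_def by (simp add: norm_divide field_simps del: of_nat_Suc sum.lessThan_Suc)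
  qed
  have "(\<lambda>N. integral ?I (f N)) \<longlonglongrightarrow> integral ?I (\<lambda>t. if t = 0 then h 0 else 0)"
    by (rule dominated_convergence(2)[OF intf _ bdd lim]) auto
  moreover have "integral ?I (\<lambda>t. if t = 0 then h 0 else 0) = integral ?I (\<lambda>t. 0)"
    by (rule integral_spike[of "{0}"]) auto
  ultimately have "(\<lambda>_::nat. a) \<longlonglongrightarrow> 0"
    by (simp only: fa integral_0)
  then show ?thesis
    by (simp add: LIMSEQ_const_iff)
qed

lemma has_vector_derivative_quotient:
  assumes "(f has_vector_derivative f') (at (0::real))"
  shows "((\<lambda>t. (f t - f 0) /\<^sub>R t) \<longlongrightarrow> f') (at 0)"
proof -
  have "((\<lambda>t. norm (f t - f 0 - t *\<^sub>R f') / norm t) \<longlongrightarrow> 0) (at 0)"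
    using assms by (simp add: has_vector_derivative_def has_derivative_at)
  moreover have "\<forall>\<^sub>F t in at 0. norm (f t - f 0 - t *\<^sub>R f') / norm t = norm ((f t - f 0) /\<^sub>R t - f')"
  proof -
    have "norm (f t - f 0 - t *\<^sub>R f') / norm t = norm ((f t - f 0) /\<^sub>R t - f')" if "t \<noteq> 0" for t
    proof -
      have "(f t - f 0) /\<^sub>R t - f' = inverse t *\<^sub>R (f t - f 0 - t *\<^sub>R f')"
        using that by (simp add: algebra_simps)
      then show ?thesis by (simp add: divide_inverse mult.commute)
    qed
    then show ?thesis by (simp add: eventually_at_filter)
  qed
  ultimately have "((\<lambda>t. norm ((f t - f 0) /\<^sub>R t - f')) \<longlongrightarrow> 0) (at 0)"
    by (rule Lim_transform_eventually)
  then show ?thesis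
    using Lim_null[of "\<lambda>t. (f t - f 0) /\<^sub>R t"] tendsto_norm_zero_iff by metis
qed

text \<open>Chernoff's argument: the coefficients of \<open>(g t - g 0) / (cis (2 * pi * t) - 1)\<close> telescope.\<close>
lemma fourier_coefficients_zero:
  fixes g :: "real \<Rightarrow> complex"
  assumes g: "continuous_on {-1/2..1/2} g" and g': "(g has_vector_derivative g') (at 0)"
    and z: "\<And>n::int. integral {-1/2..1/2} (\<lambda>t. cis (2 * pi * of_int n * t) * g t) = 0"
  shows "g 0 = 0"
proof -
  let ?I = "{-1/2..1/2::real}"
  define q where "q t = cis (2 * pi * t)" for t
  \<comment> \<open>The value at 0 is the limit of the quotient, because q has derivative 2 * pi *
    \<i> there; thus h is continuous on the whole segment.\<close>
  define h where "h t = (if t = 0 then g' / (2 * pi * \<i>) else (g t - g 0) / (q t - 1))" for t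
  have q1: "q t \<noteq> 1" if "t \<in> ?I" "t \<noteq> 0" for t
  proof
    assume "q t = 1"
    then obtain k :: int where "2 * pi * t = of_int k * (2 * pi)"
      by (auto simp: q_def cis_conv_exp exp_eq_1 mult.commute)
    then have "t = of_int k" by simp
    then have "\<bar>k\<bar> < 1" using that by auto
    with \<open>t = of_int k\<close> that show False by simp
  qed
  have qh: "(q t - 1) * h t = g t - g 0" if "t \<in> ?I" for t
    using q1[OF that] by (auto simp: h_def q_def)
  have lim0: "(h \<longlongrightarrow> h 0) (at 0)"
  proof -
    have q': "(q has_vector_derivative (2 * pi * \<i>)) (at 0)"
      unfolding q_def cis_conv_exp
      by (auto intro!: derivative_eq_intros has_vector_derivative_real_field)
    have "((\<lambda>t. (g t - g 0) /\<^sub>R t) \<longlongrightarrow> g') (at 0)" "((\<lambda>t. (q t - q 0) /\<^sub>R t) \<longlongrightarrow> 2 * pi * \<i>) (at 0)"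
      using has_vector_derivative_quotient[OF g'] has_vector_derivative_quotient[OF q'] by auto
    then have "((\<lambda>t. ((g t - g 0) /\<^sub>R t) / ((q t - q 0) /\<^sub>R t)) \<longlongrightarrow> g' / (2 * pi * \<i>)) (at 0)"
      by (intro tendsto_divide) auto
    moreover have "\<forall>\<^sub>F t in at 0. ((g t - g 0) /\<^sub>R t) / ((q t - q 0) /\<^sub>R t) = h t"
      by (auto simp: eventually_at_filter h_def q_def scaleR_conv_of_real intro!: always_eventually)
    ultimately have "(h \<longlongrightarrow> g' / (2 * pi * \<i>)) (at 0)"
      by (rule Lim_transform_eventually)
    then show ?thesis by (simp add: h_def)
  qed
  have h: "continuous_on ?I h"
    unfolding continuous_on_def
  proof
    fix t assume t: "t \<in> ?I"
    show "(h \<longlongrightarrow> h t) (at t within ?I)"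
    proof (cases "t = 0")
      case True
      then show ?thesis using lim0 tendsto_within_subset by blast
    next
      case False
      have "(g \<longlongrightarrow> g t) (at t within ?I)"
        using g t by (simp add: continuous_on_def)
      then have "((\<lambda>t. (g t - g 0) / (q t - 1)) \<longlongrightarrow> (g t - g 0) / (q t - 1)) (at t within ?I)"
        unfolding q_def using q1[OF t False] by (intro tendsto_intros) (auto simp: q_def)
      moreover have "\<forall>\<^sub>F u in at t within ?I. (g u - g 0) / (q u - 1) = h u"
        using eventually_neq_at_within[of 0 t ?I] by eventually_elim (simp add: h_def)
      ultimately have "(h \<longlongrightarrow> (g t - g 0) / (q t - 1)) (at t within ?I)"
        by (rule Lim_transform_eventually)
      then show ?thesis
        using False by (simp add: h_def)
    qed
  qed
  define c where "c n = integral ?I (\<lambda>t. cis (2 * pi * of_int n * t) * h t)" for n :: int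
  have int: "(\<lambda>t. cis (2 * pi * of_int k * t) * u t) integrable_on ?I" if "continuous_on ?I u" for k u
    by (intro integrable_continuous_real continuous_intros that)
  \<comment> \<open>Raising the index by one multiplies the integrand by q, so the difference
    integrates (q - 1) * h = g - g 0. The coefficients of g vanish, and the constant g 0 is seen
    only by n = 0.\<close>
  have diff: "c (n + 1) - c n = (if n = 0 then - g 0 else 0)" for n
  proof -
    have "c (n + 1) - c n = integral ?I (\<lambda>t. cis (2 * pi * of_int (n + 1) * t) * h t - cis (2 * pi * of_int n * t) * h t)"
      unfolding c_def by (rule integral_diff[symmetric]) (intro int h)+
    also have "\<dots> = integral ?I (\<lambda>t. cis (2 * pi * of_int n * t) * g t - g 0 * cis (2 * pi * of_int n * t))"
    proof (rule integral_cong)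
      fix t assume t: "t \<in> ?I"
      have "cis (2 * pi * of_int (n + 1) * t) = cis (2 * pi * of_int n * t) * q t"
        unfolding q_def cis_mult by (simp add: algebra_simps)
      then have "cis (2 * pi * of_int (n + 1) * t) * h t - cis (2 * pi * of_int n * t) * h t
          = cis (2 * pi * of_int n * t) * ((q t - 1) * h t)"
        by (simp only: left_diff_distrib right_diff_distrib mult.assoc mult_1_left)
      then show "cis (2 * pi * of_int (n + 1) * t) * h t - cis (2 * pi * of_int n * t) * h t
          = cis (2 * pi * of_int n * t) * g t - g 0 * cis (2 * pi * of_int n * t)"
        by (simp only: qh[OF t] right_diff_distrib mult.commute[of "g 0"])
    qed
    also have "\<dots> = 0 - g 0 * (if n = 0 then 1 else 0)"
      by (subst integral_diff, rule int[OF g], intro integrable_continuous_real continuous_intros)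
        (simp only: z integral_mult_right cis_integral)
    finally show ?thesis by simp
  qed
  \<comment> \<open>The sequence c is constant on the positive indices and on the nonpositive ones,
    so both values are zero; the jump between 0 and 1, which is - g 0, must vanish as well.\<close>
  have "c (1 + 1 * int n) = c 1" for n
    using diff[of "1 + int k" for k] by (induction n) (auto simp: algebra_simps)
  then have "c 1 = 0"
    unfolding c_def by (intro constant_coefficients_zero[OF h, of 1 1]) auto
  moreover have "c (0 + (- 1) * int n) = c 0" for n
  proof (induction n)
    case (Suc n)
    then show ?case using diff[of "- 1 - int n"] by (simp add: algebra_simps)
  qed simp
  then have "c 0 = 0"
    unfolding c_def by (intro constant_coefficients_zero[OF h, of "- 1" 0]) auto
  ultimately show ?thesis
    using diff[of 0] by simp
qed

subsection \<open>Lattices and dual bases\<close>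

text \<open>Rounding the coefficients down leaves fractional parts in [0, 1). It serves twice: for
  \<open>E\<close> it moves x, and for the dual basis it moves \<xi>, into a fixed ball.\<close>

lemma lattice_representative:
  fixes B :: "'n::finite \<Rightarrow> real^'n"
  assumes "x = (\<Sum>i\<in>UNIV. c i *\<^sub>R B i)"
  shows "\<exists>k\<in>lattice B. norm (x - k) \<le> (\<Sum>i\<in>UNIV. norm (B i))"
proof
  let ?k = "\<Sum>i\<in>UNIV. of_int \<lfloor>c i\<rfloor> *\<^sub>R B i"
  show "?k \<in> lattice B" by (auto simp: lattice_def)
  have "x - ?k = (\<Sum>i\<in>UNIV. frac (c i) *\<^sub>R B i)"
    by (simp add: assms frac_def scaleR_diff_left sum_subtractf)
  also have "norm \<dots> \<le> (\<Sum>i\<in>UNIV. norm (B i))"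
  proof (rule sum_norm_le)
    fix i
    have "\<bar>frac (c i)\<bar> \<le> 1" using frac_lt_1[of "c i"] frac_ge_0[of "c i"] by simp
    then show "norm (frac (c i) *\<^sub>R B i) \<le> norm (B i)"
      by (simp add: mult_left_le_one_le)
  qed
  finally show "norm (x - ?k) \<le> (\<Sum>i\<in>UNIV. norm (B i))" .
qed

lemma lattice_minus: "k \<in> lattice B \<Longrightarrow> - k \<in> lattice B"
proof -
  assume "k \<in> lattice B"
  then obtain n where "k = (\<Sum>i\<in>UNIV. of_int (n i) *\<^sub>R B i)" by (auto simp: lattice_def)
  then have "- k = (\<Sum>i\<in>UNIV. of_int (- n i) *\<^sub>R B i)" by (simp add: sum_negf)
  then show "- k \<in> lattice B"
    unfolding lattice_def by (intro CollectI exI[of _ "\<lambda>i. - n i"]) simp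
qed

lemma lattice_add: "k \<in> lattice B \<Longrightarrow> l \<in> lattice B \<Longrightarrow> k + l \<in> lattice B"
proof -
  assume "k \<in> lattice B" "l \<in> lattice B"
  then obtain n m where "k = (\<Sum>i\<in>UNIV. of_int (n i) *\<^sub>R B i)" "l = (\<Sum>i\<in>UNIV. of_int (m i) *\<^sub>R B i)"
    by (auto simp: lattice_def)
  then have "k + l = (\<Sum>i\<in>UNIV. of_int (n i + m i) *\<^sub>R B i)"
    by (simp add: sum.distrib scaleR_add_left)
  then show "k + l \<in> lattice B"
    unfolding lattice_def by (intro CollectI exI[of _ "\<lambda>i. n i + m i"]) simp
qed

lemma zero_in_lattice: "0 \<in> lattice B"
  unfolding lattice_def by (intro CollectI exI[of _ "\<lambda>_. 0"]) simp

lemma basis_in_lattice: "B i \<in> lattice B"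
proof -
  have "(\<Sum>j\<in>UNIV. of_int (if j = i then 1 else 0) *\<^sub>R B j) = (\<Sum>j\<in>UNIV. if j = i then B j else 0)"
    by (rule sum.cong) auto
  then show ?thesis
    unfolding lattice_def by (intro CollectI exI[of _ "\<lambda>j. if j = i then 1 else 0"]) simp
qed

locale zak_basis =
  fixes E :: "'n::finite \<Rightarrow> real^'n"
  assumes basis: "ordered_basis E"
begin

abbreviation "E' \<equiv> dual_basis E"

lemma orthogonal_to_basis:
  assumes "\<And>j. E j \<bullet> w = 0"
  shows "w = 0"
proof -
  have "v \<bullet> w = 0" if "v \<in> span (range E)" for v
    using that by (induction rule: span_induct_alt) (auto simp: inner_add_left assms)
  moreover have "w \<in> span (range E)" using basis by (simp add: ordered_basis_def)
  ultimately show ?thesis by force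
qed

text \<open>Existence: the functional that is 2 * pi on E k and 0 on the other basis vectors is the
  inner product with some vector. Uniqueness is \<open>orthogonal_to_basis\<close>. Together they
  unlock the definite description in \<open>dual_basis\<close>.\<close>

lemma inner_dual_basis: "E j \<bullet> E' k = (if j = k then 2 * pi else 0)"
proof -
  have "\<exists>w. \<forall>j. E j \<bullet> w = (if j = k then 2 * pi else 0)" for k
  proof -
    have "independent (range E)" "inj E" using basis by (auto simp: ordered_basis_def)
    then obtain \<phi> :: "real^'n \<Rightarrow> real" where \<phi>: "linear \<phi>" "\<And>v. v \<in> range E \<Longrightarrow> \<phi> v = (if v = E k then 2 * pi else 0)"
      using linear_independent_extend[of "range E" "\<lambda>v. if v = E k then 2 * pi else 0"] by auto
    have "E j \<bullet> (\<Sum>b\<in>Basis. \<phi> b *\<^sub>R b) = \<phi> (\<Sum>b\<in>Basis. (E j \<bullet> b) *\<^sub>R b)" for j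
      by (simp add: linear_sum[OF \<phi>(1)] linear_cmul[OF \<phi>(1)] inner_sum_right mult.commute del: euclidean_representation)
    then have "E j \<bullet> (\<Sum>b\<in>Basis. \<phi> b *\<^sub>R b) = (if j = k then 2 * pi else 0)" for j
      using \<phi>(2)[of "E j"] \<open>inj E\<close> by (simp add: euclidean_representation inj_eq)
    then show ?thesis by blast
  qed
  then obtain W where W: "\<And>j k. E j \<bullet> W k = (if j = k then 2 * pi else 0)" by metis
  have "W' = W" if "\<forall>j k. E j \<bullet> W' k = (if j = k then 2 * pi else 0)" for W'
  proof
    fix k
    have "W' k - W k = 0"
      by (rule orthogonal_to_basis) (simp add: inner_diff_right W that)
    then show "W' k = W k" by simp
  qed
  then have "E' = W"
    unfolding dual_basis_def using W by (intro the_equality) auto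
  then show ?thesis by (simp add: W)
qed

lemma expand_dual: "\<xi> = (\<Sum>l\<in>UNIV. (\<xi> \<bullet> E l / (2 * pi)) *\<^sub>R E' l)"
proof -
  have "\<xi> - (\<Sum>l\<in>UNIV. (\<xi> \<bullet> E l / (2 * pi)) *\<^sub>R E' l) = 0"
    by (rule orthogonal_to_basis)
      (simp add: inner_diff_right inner_sum_right inner_dual_basis inner_commute if_distrib cong: if_cong)
  then show ?thesis by simp
qed

lemma expand_basis: "x = (\<Sum>l\<in>UNIV. (x \<bullet> E' l / (2 * pi)) *\<^sub>R E l)"
proof -
  have "x \<in> span (range E)" using basis by (simp add: ordered_basis_def)
  then show ?thesis
  proof (induction rule: span_induct_alt)
    case base
    then show ?case by simp
  next
    case (step c v y)
    then obtain j where j: "v = E j" by blast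
    have "(\<Sum>l\<in>UNIV. ((c *\<^sub>R v + y) \<bullet> E' l / (2 * pi)) *\<^sub>R E l)
        = c *\<^sub>R (\<Sum>l\<in>UNIV. (E j \<bullet> E' l / (2 * pi)) *\<^sub>R E l) + (\<Sum>l\<in>UNIV. (y \<bullet> E' l / (2 * pi)) *\<^sub>R E l)"
      by (simp add: j inner_add_left add_divide_distrib scaleR_add_left sum.distrib scaleR_sum_right)
    also have "(\<Sum>l\<in>UNIV. (E j \<bullet> E' l / (2 * pi)) *\<^sub>R E l) = (\<Sum>l\<in>UNIV. if j = l then E l else 0)"
      by (rule sum.cong) (auto simp: inner_dual_basis)
    finally show ?case using step j by simp
  qed
qed

definition lat :: "('n \<Rightarrow> int) \<Rightarrow> real^'n" where
  "lat n = (\<Sum>i\<in>UNIV. of_int (n i) *\<^sub>R E i)"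

lemma lat_inner_dual: "lat n \<bullet> E' l = 2 * pi * of_int (n l)"
  by (simp add: lat_def inner_sum_left inner_dual_basis if_distrib cong: if_cong)

lemma bij_lat: "bij_betw lat UNIV (lattice E)"
proof -
  have "inj lat"
  proof (rule injI)
    fix n m assume "lat n = lat m"
    then have "of_int (n l) = (of_int (m l) :: real)" for l
      using lat_inner_dual[of n l] lat_inner_dual[of m l] by simp
    then show "n = m" by (intro ext) (simp only: of_int_eq_iff)
  qed
  moreover have "range lat = lattice E" by (auto simp: lat_def lattice_def)
  ultimately show ?thesis by (simp add: bij_betw_def)
qed

lemma chr_dual_periodic:
  assumes "k \<in> lattice E" "\<kappa> \<in> lattice E'"
  shows "chr k (z + (x, \<kappa>)) = chr k z"
proof -
  obtain n where n: "k = lat n" using assms(1) by (auto simp: lat_def lattice_def)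
  obtain m where m: "\<kappa> = (\<Sum>l\<in>UNIV. of_int (m l) *\<^sub>R E' l)" using assms(2) by (auto simp: lattice_def)
  have "k \<bullet> \<kappa> = (\<Sum>l\<in>UNIV. of_int (m l) * (2 * pi * of_int (n l)))"
    by (simp add: n m inner_sum_right lat_inner_dual)
  also have "\<dots> = 2 * pi * of_int (\<Sum>l\<in>UNIV. m l * n l)"
    by (simp add: sum_distrib_left mult_ac)
  finally have "exp (\<i> * of_real (k \<bullet> \<kappa>)) = exp (2 * of_int (\<Sum>l\<in>UNIV. m l * n l) * pi * \<i>)"
    by (simp add: mult_ac)
  then have "exp (\<i> * of_real (k \<bullet> \<kappa>)) = 1"
    by (simp only: exp_integer_2pi Ints_of_int)
  then show ?thesis
    by (simp add: chr_def inner_add_right ring_distribs exp_add)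
qed

lemma near_lattice: "\<exists>k\<in>lattice E. norm (x - k) \<le> (\<Sum>i\<in>UNIV. norm (E i))"
  by (rule lattice_representative[OF expand_basis])

lemma near_dual_lattice: "\<exists>\<kappa>\<in>lattice E'. norm (\<xi> - \<kappa>) \<le> (\<Sum>i\<in>UNIV. norm (E' i))"
  by (rule lattice_representative[OF expand_dual])

section \<open>Fourier coefficients in the frequency variable\<close>

definition dirs :: "((real^'n) \<times> (real^'n)) list" where
  "dirs = map (\<lambda>l. (0, E' l)) coords"

definition xi_periodic :: "((real^'n) \<times> (real^'n) \<Rightarrow> complex) \<Rightarrow> bool" where
  "xi_periodic F \<longleftrightarrow> (\<forall>z. \<forall>\<kappa>\<in>lattice E'. F (z + (0, \<kappa>)) = F z)"

lemma xi_periodic_partial: "xi_periodic F \<Longrightarrow> xi_periodic (partial v F)"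
proof -
  assume "xi_periodic F"
  then have "(\<lambda>z. F (z + (0, \<kappa>))) = F" if "\<kappa> \<in> lattice E'" for \<kappa>
    using that by (auto simp: xi_periodic_def)
  then show ?thesis
    unfolding xi_periodic_def using partial_translate[of v F] by metis
qed

lemma xi_periodic_fold_partial: "xi_periodic F \<Longrightarrow> xi_periodic (fold partial vs F)"
  by (induction vs arbitrary: F) (simp_all add: xi_periodic_partial)

lemma xi_periodic_chr: "xi_periodic F \<Longrightarrow> k \<in> lattice E \<Longrightarrow> xi_periodic (\<lambda>z. chr k z * F z)"
  by (simp add: xi_periodic_def chr_dual_periodic)

lemma xi_periodic_seg_avg: "xi_periodic F \<Longrightarrow> xi_periodic (seg_avg w F)"
proof -
  assume "xi_periodic F"
  then have "(\<lambda>z. F (z + (0, \<kappa>))) = F" if "\<kappa> \<in> lattice E'" for \<kappa>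
    using that by (auto simp: xi_periodic_def)
  then show ?thesis
    unfolding xi_periodic_def using seg_avg_translate[of w F] by metis
qed

text \<open>Integration by parts over a period. The product \<open>chr k z * F z\<close> is periodic
  and (0, b) is a combination of the directions in \<open>dirs\<close>, so the derivative of the
  product averages to zero; the product rule splits this zero into the two sides.\<close>

lemma avg_chr_partial:
  assumes "smooth F" "xi_periodic F" "k \<in> lattice E"
  shows "avg dirs (\<lambda>z. chr k z * partial (0, b) F z)
    = (\<lambda>z. - \<i> * of_real (k \<bullet> b) * avg dirs (\<lambda>z. chr k z * F z) z)"
proof -
  have b: "(0, b) = (\<Sum>l\<in>UNIV. (b \<bullet> E l / (2 * pi)) *\<^sub>R (0 :: real^'n, E' l))"
    by (simp add: prod_eq_iff fst_sum snd_sum flip: expand_dual)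
  have "(0, E' l) \<in> set dirs" for l
    by (auto simp: dirs_def coords)
  moreover have "chr k (z + (0, E' l)) * F (z + (0, E' l)) = chr k z * F z" for z l
    using xi_periodic_chr[OF assms(2,3)] basis_in_lattice[of E' l] unfolding xi_periodic_def by blast
  ultimately have "avg dirs (partial (0, b) (\<lambda>z. chr k z * F z)) = (\<lambda>_. 0)"
    unfolding b by (intro avg_partial_zero smooth_chr_mult assms(1)) auto
  moreover have "partial (0, b) (\<lambda>z. chr k z * F z)
      = (\<lambda>z. (\<i> * of_real (k \<bullet> b)) * (chr k z * F z) + 1 * (chr k z * partial (0, b) F z))"
    unfolding partial_chr_mult[OF assms(1)] by (simp add: algebra_simps)
  ultimately have "(\<lambda>z. (\<i> * of_real (k \<bullet> b)) * avg dirs (\<lambda>z. chr k z * F z) z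
      + 1 * avg dirs (\<lambda>z. chr k z * partial (0, b) F z) z) = (\<lambda>_. 0)"
    by (simp only: avg_comb smooth_chr_mult assms(1) smooth_partial_any)
  then show ?thesis
    by (simp add: fun_eq_iff add_eq_0_iff)
qed

lemma avg_chr_fold_partial:
  assumes "smooth F" "xi_periodic F" "k \<in> lattice E"
  shows "avg dirs (\<lambda>z. chr k z * fold partial (map (Pair 0) vs) F z)
    = (\<lambda>z. (\<Prod>b\<leftarrow>vs. - \<i> * of_real (k \<bullet> b)) * avg dirs (\<lambda>z. chr k z * F z) z)"
  using assms(1,2)
proof (induction vs arbitrary: F)
  case (Cons b vs)
  then show ?case
    using avg_chr_partial[OF Cons.prems assms(3)] by (simp add: smooth_partial_any xi_periodic_partial mult_ac)
qed simp

text \<open>Averaging \<open>chr (of_int m *\<^sub>R E a) z * H z\<close> in the first direction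
  produces a function whose coefficients in the remaining directions all vanish. By induction it is
  zero for every integer m, and then the one-variable result applies on the segment through each
  point.\<close>

lemma fourier_uniqueness_aux:
  assumes "distinct ls" "smooth H" "xi_periodic H"
    and "\<And>n. avg (map (\<lambda>l. (0, E' l)) ls) (\<lambda>z. chr (\<Sum>l\<in>set ls. of_int (n l) *\<^sub>R E l) z * H z) = (\<lambda>_. 0)"
  shows "H = (\<lambda>_. 0)"
  using assms
proof (induction ls arbitrary: H)
  case Nil
  then show ?case by (simp add: chr_def)
next
  case (Cons a ls)
  have seg: "seg_avg (0, E' a) (\<lambda>z. chr (of_int m *\<^sub>R E a) z * H z) = (\<lambda>_. 0)" for m
  proof (rule Cons.IH)
    show "distinct ls" using Cons.prems by simp
    show "smooth (seg_avg (0, E' a) (\<lambda>z. chr (of_int m *\<^sub>R E a) z * H z))"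
      using Cons.prems by (intro smooth_seg_avg smooth_chr_mult)
    have "of_int m *\<^sub>R E a = lat (\<lambda>l. if l = a then m else 0)"
      by (simp add: lat_def if_distrib[of of_int] if_distrib[of "\<lambda>c. c *\<^sub>R _"] cong: if_cong)
    then have "of_int m *\<^sub>R E a \<in> lattice E" using bij_betwE[OF bij_lat] by simp
    then show "xi_periodic (seg_avg (0, E' a) (\<lambda>z. chr (of_int m *\<^sub>R E a) z * H z))"
      using Cons.prems by (intro xi_periodic_seg_avg xi_periodic_chr)
    fix n
    let ?k = "\<Sum>l\<in>set ls. of_int (n l) *\<^sub>R E l"
    \<comment> \<open>The characters of the remaining directions are constant along E' a, so they
      can be moved under the average in that direction.\<close>
    have k0: "?k \<bullet> E' a = 0"
      using Cons.prems(1) by (auto simp: inner_sum_left inner_dual_basis intro!: sum.neutral)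
    have k1: "(\<Sum>l\<in>set (a # ls). of_int ((n(a := m)) l) *\<^sub>R E l) = of_int m *\<^sub>R E a + ?k"
      using Cons.prems(1) by (auto intro!: sum.cong)
    have "(\<lambda>z. chr ?k z * seg_avg (0, E' a) (\<lambda>z. chr (of_int m *\<^sub>R E a) z * H z) z)
        = seg_avg (0, E' a) (\<lambda>z. chr (of_int m *\<^sub>R E a + ?k) z * H z)"
    proof
      fix z :: "(real^'n) \<times> (real^'n)"
      have e: "chr ?k z * (chr (of_int m *\<^sub>R E a) y * H y) = chr (of_int m *\<^sub>R E a + ?k) y * H y"
        if "y = z + t *\<^sub>R (0, E' a)" for t y
      proof -
        have "chr ?k y = chr ?k z"
          by (simp add: that chr_def inner_add_right k0)
        moreover have "chr (of_int m *\<^sub>R E a + ?k) y = chr (of_int m *\<^sub>R E a) y * chr ?k y"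
          by (simp add: chr_def inner_add_left distrib_left exp_add)
        ultimately show ?thesis by simp
      qed
      show "chr ?k z * seg_avg (0, E' a) (\<lambda>z. chr (of_int m *\<^sub>R E a) z * H z) z
          = seg_avg (0, E' a) (\<lambda>z. chr (of_int m *\<^sub>R E a + ?k) z * H z) z"
        unfolding seg_avg_def integral_mult_right[symmetric] by (simp only: e[OF refl])
    qed
    then show "avg (map (\<lambda>l. (0, E' l)) ls) (\<lambda>z. chr ?k z * seg_avg (0, E' a) (\<lambda>z. chr (of_int m *\<^sub>R E a) z * H z) z) = (\<lambda>_. 0)"
      using Cons.prems(4)[of "n(a := m)"] unfolding k1 by simp
  qed
  show ?case
  proof
    fix z
    define g where "g t = H (z + t *\<^sub>R (0, E' a))" for t
    have "g 0 = 0"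
    proof (rule fourier_coefficients_zero)
      show "continuous_on {-1/2..1/2} g"
        unfolding g_def by (rule continuous_on_segment) (rule Cons.prems)
      show "(g has_vector_derivative partial (0, E' a) H (z + 0 *\<^sub>R (0, E' a))) (at 0)"
        unfolding g_def by (rule has_vector_derivative_segment) (rule Cons.prems)
      fix m :: int
      \<comment> \<open>Along the segment the character is its value at z times
        \<open>cis (2 * pi * of_int m * t)\<close>, which turns the vanishing average into a
        vanishing one-variable coefficient of g.\<close>
      have "chr (of_int m *\<^sub>R E a) (z + t *\<^sub>R (0, E' a)) = chr (of_int m *\<^sub>R E a) z * cis (2 * pi * of_int m * t)" for t
        by (simp add: chr_def inner_add_right inner_dual_basis cis_conv_exp distrib_left exp_add mult_ac)
      then have "chr (of_int m *\<^sub>R E a) z * integral {-1/2..1/2} (\<lambda>t. cis (2 * pi * of_int m * t) * g t) = 0"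
        using fun_cong[OF seg[of m], of z]
        by (simp add: seg_avg_def g_def mult.assoc integral_mult_right)
      then show "integral {-1/2..1/2} (\<lambda>t. cis (2 * pi * of_int m * t) * g t) = 0"
        by (simp add: chr_def)
    qed
    then show "H z = 0" by (simp add: g_def flip: zero_prod_def)
  qed
qed

lemma fourier_uniqueness:
  assumes "smooth H" "xi_periodic H"
    and "\<And>k. k \<in> lattice E \<Longrightarrow> avg dirs (\<lambda>z. chr k z * H z) = (\<lambda>_. 0)"
  shows "H = (\<lambda>_. 0)"
proof (rule fourier_uniqueness_aux[OF coords(1) assms(1,2)])
  fix n
  show "avg (map (\<lambda>l. (0, E' l)) coords) (\<lambda>z. chr (\<Sum>l\<in>set coords. of_int (n l) *\<^sub>R E l) z * H z) = (\<lambda>_. 0)"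
    using assms(3)[of "lat n"] bij_betwE[OF bij_lat] by (simp add: coords(2) lat_def dirs_def)
qed

text \<open>Orthogonality of characters without evaluating an integral: u has no \<xi>-derivative,
  so integration by parts shows that k \<bullet> b times the average is zero, and b can be chosen
  with k \<bullet> b \<noteq> 0.\<close>

lemma avg_chr_fst:
  assumes "smooth u" "k \<in> lattice E"
  shows "avg dirs (\<lambda>z. chr k z * u (fst z)) = (\<lambda>z. if k = 0 then u (fst z) else 0)"
proof (cases "k = 0")
  case True
  have "avg ws (\<lambda>z. u (fst z)) = (\<lambda>z. u (fst z))" if "\<forall>w\<in>set ws. fst w = 0" for ws :: "((real^'n) \<times> (real^'n)) list"
    using that by (induction ws) (auto simp: seg_avg_def)
  moreover have "\<forall>w\<in>set dirs. fst w = 0" by (auto simp: dirs_def)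
  ultimately show ?thesis using True by (simp add: chr_def)
next
  case False
  then obtain b where b: "k \<bullet> b \<noteq> 0" using inner_eq_zero_iff[of k] by blast
  have "xi_periodic (\<lambda>z. u (fst z))" by (simp add: xi_periodic_def)
  from avg_chr_partial[OF smooth_fst[OF assms(1)] this assms(2), of b]
  have "(\<lambda>z. - \<i> * of_real (k \<bullet> b) * avg dirs (\<lambda>z. chr k z * u (fst z)) z) = (\<lambda>_. 0)"
    by (simp add: partial_fst avg_zero)
  then show ?thesis using b False by (simp add: fun_eq_iff)
qed

subsection \<open>The inverse of the Zak transform\<close>

text \<open>The point \<xi> = 0 is only a base point: for smooth periodic functions the average does
  not depend on \<xi>, see \<open>avg_xi_constant\<close>.\<close>

definition zak_inv :: "((real^'n) \<times> (real^'n) \<Rightarrow> complex) \<Rightarrow> real^'n \<Rightarrow> complex" where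
  "zak_inv F = (\<lambda>x. avg dirs F (x, 0))"

lemma quasi_periodic_alt:
  "quasi_periodic E F \<longleftrightarrow> xi_periodic F \<and> (\<forall>k\<in>lattice E. \<forall>z. F (z + (k, 0)) = chr k z * F z)"
  by (auto simp: quasi_periodic_def xi_periodic_def chr_def)

lemma smooth_zak_inv: "smooth F \<Longrightarrow> smooth (zak_inv F)"
  unfolding zak_inv_def by (intro smooth_slice smooth_avg)

lemma zak_inv_comb:
  assumes "smooth F" "smooth G"
  shows "zak_inv (\<lambda>z. a * F z + b * G z) = (\<lambda>x. a * zak_inv F x + b * zak_inv G x)"
  by (simp add: zak_inv_def avg_comb[OF assms])

lemma fold_partial_zak_inv:
  assumes "smooth F" "set us \<subseteq> Basis"
  shows "fold partial us (zak_inv F) x = avg dirs (fold partial (map (\<lambda>b. (b, 0)) us) F) (x, 0)"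
proof -
  have "set (map (\<lambda>b. (b, 0)) us) \<subseteq> (Basis :: ((real^'n) \<times> (real^'n)) set)"
    using assms(2) by (auto simp: Basis_prod_def)
  then show ?thesis
    using assms by (simp add: zak_inv_def fold_partial_slice fold_partial_avg)
qed

text \<open>The character depends on \<xi> alone, so multiplication by it commutes with
  x-derivatives.\<close>

lemma fst_periodic_fold_partial:
  assumes "smooth F" "\<And>z. F (z + (k, 0)) = chr k z * F z" "set us \<subseteq> Basis"
  shows "fold partial (map (\<lambda>b. (b, 0)) us) F (z + (k, 0)) = chr k z * fold partial (map (\<lambda>b. (b, 0)) us) F z"
  using assms
proof (induction us arbitrary: F z)
  case (Cons b us)
  have "(\<lambda>z. F (z + (k, 0))) = (\<lambda>z. chr k z * F z)" using Cons.prems by blast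
  then have "partial (b, 0) F (z + (k, 0)) = chr k z * partial (b, 0) F z" for z
    using fun_cong[OF partial_translate[of "(b, 0)" F "(k, 0)"], of z]
    by (simp add: partial_chr_mult Cons.prems)
  then show ?case
    using Cons.prems Cons.IH[of "partial (b, 0) F"] by (simp add: smooth_partial_any)
qed simp

text \<open>Quasi-periodicity replaces the shift of x by k with the factor \<open>chr k\<close>.
  Hence the value of the inverse at y + k is a Fourier coefficient over the fibre at y, and each
  \<xi>-derivative multiplies it by - \<i> * (k \<bullet> b).\<close>

lemma zak_inv_coefficient:
  assumes "smooth F" "quasi_periodic E F" "k \<in> lattice E" "set us \<subseteq> Basis"
  shows "(\<Prod>b\<leftarrow>vs. - \<i> * of_real (k \<bullet> b)) * fold partial us (zak_inv F) (y + k)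
    = avg dirs (\<lambda>z. chr k z * fold partial (map (Pair 0) vs) (fold partial (map (\<lambda>b. (b, 0)) us) F) z) (y, 0)"
proof -
  let ?G = "fold partial (map (\<lambda>b. (b, 0)) us) F"
  have us: "set (map (\<lambda>b. (b, 0)) us) \<subseteq> (Basis :: ((real^'n) \<times> (real^'n)) set)"
    using assms(4) by (auto simp: Basis_prod_def)
  have G: "smooth ?G" "xi_periodic ?G"
    using assms(2) smooth_fold_partial[OF assms(1) us]
    by (auto simp: quasi_periodic_alt xi_periodic_fold_partial)
  have "(\<lambda>z. ?G (z + (k, 0))) = (\<lambda>z. chr k z * ?G z)"
    using fst_periodic_fold_partial[OF assms(1) _ assms(4)] assms(2,3)
    by (auto simp: quasi_periodic_alt fun_eq_iff)
  then have "avg dirs ?G (y + k, 0) = avg dirs (\<lambda>z. chr k z * ?G z) (y, 0)"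
    using fun_cong[OF avg_translate[of dirs ?G "(k, 0)"], of "(y, 0)"] by simp
  then show ?thesis
    using fun_cong[OF avg_chr_fold_partial[OF G assms(3), of vs], of "(y, 0)"]
    by (simp add: fold_partial_zak_inv[OF assms(1,4)])
qed

text \<open>Turns \<xi>-derivatives at y into decay at y + k. By periodicity the hypothesis concerns
  only \<xi> in a fixed ball, so in the end everything is controlled on one compact set.\<close>

lemma zak_inv_bound:
  assumes "smooth F" "quasi_periodic E F" "k \<in> lattice E" "set us \<subseteq> Basis" "set vs \<subseteq> Basis"
    and "\<And>\<xi>. norm \<xi> \<le> (\<Sum>i\<in>UNIV. norm (E' i)) \<Longrightarrow>
      cmod (fold partial (map (Pair 0) vs) (fold partial (map (\<lambda>b. (b, 0)) us) F) (y, \<xi>)) \<le> B"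
  shows "(\<Prod>b\<leftarrow>vs. \<bar>k \<bullet> b\<bar>) * cmod (fold partial us (zak_inv F) (y + k)) \<le> B"
proof -
  let ?G = "fold partial (map (Pair 0) vs) (fold partial (map (\<lambda>b. (b, 0)) us) F)"
  have vs: "set (map (\<lambda>b. (b, 0)) us) \<subseteq> (Basis :: ((real^'n) \<times> (real^'n)) set)"
    "set (map (Pair 0) vs) \<subseteq> (Basis :: ((real^'n) \<times> (real^'n)) set)"
    using assms(4,5) by (auto simp: Basis_prod_def)
  then have G: "smooth ?G" by (intro smooth_fold_partial assms(1))
  have "xi_periodic ?G"
    using assms(2) by (auto simp: quasi_periodic_alt xi_periodic_fold_partial)
  have B: "cmod (?G (y, \<xi>)) \<le> B" for \<xi>
  proof -
    obtain \<kappa> where \<kappa>: "\<kappa> \<in> lattice E'" "norm (\<xi> - \<kappa>) \<le> (\<Sum>i\<in>UNIV. norm (E' i))"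
      using near_dual_lattice by blast
    have "?G ((y, \<xi> - \<kappa>) + (0, \<kappa>)) = ?G (y, \<xi> - \<kappa>)"
      using \<open>xi_periodic ?G\<close> \<kappa>(1) unfolding xi_periodic_def by blast
    then show ?thesis using assms(6)[OF \<kappa>(2)] by simp
  qed
  have prod: "cmod (\<Prod>b\<leftarrow>vs. - \<i> * of_real (k \<bullet> b)) = (\<Prod>b\<leftarrow>vs. \<bar>k \<bullet> b\<bar>)"
    by (induction vs) (simp_all add: norm_mult)
  have "(\<Prod>b\<leftarrow>vs. \<bar>k \<bullet> b\<bar>) * cmod (fold partial us (zak_inv F) (y + k))
      = cmod (avg dirs (\<lambda>z. chr k z * ?G z) (y, 0))"
    unfolding zak_inv_coefficient[OF assms(1-4), symmetric] norm_mult prod ..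
  also have "\<dots> \<le> B"
    by (rule avg_bound[where P = "\<lambda>z. fst z = y"])
      (use G B in \<open>auto simp: smooth_chr_mult norm_mult dirs_def\<close>)
  finally show ?thesis .
qed

end

subsection \<open>Multi-index estimates\<close>

lemma power_le_fact_mult_exp: "0 \<le> x \<Longrightarrow> x ^ n \<le> fact n * exp (x::real)"
proof -
  assume x: "0 \<le> x"
  have "summable (\<lambda>n. x ^ n /\<^sub>R fact n)" by (rule summable_exp_generic)
  then have "(\<Sum>k\<in>{n}. x ^ k /\<^sub>R fact k) \<le> (\<Sum>k. x ^ k /\<^sub>R fact k)"
    by (rule sum_le_suminf) (use x in auto)
  then show ?thesis by (simp add: exp_def field_simps)
qed

lemma power_powr_swap: "(x ^ n) powr s = (x powr s) ^ n" for x :: real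
  by (induction n) (simp_all add: powr_mult)

text \<open>With x chosen so that x powr s = R / \<epsilon>, the claim is the s-th power of x^n
  \<le> n! * exp x, a single term of the exponential series. It lets factorials absorb any geometric
  growth at any prescribed rate.\<close>

lemma power_le_fact_powr:
  fixes R \<epsilon> s :: real
  assumes "R > 0" "\<epsilon> > 0" "s > 0"
  obtains C where "C \<ge> 1" "\<And>n. R ^ n \<le> C * \<epsilon> ^ n * fact n powr s"
proof
  define x where "x = (R / \<epsilon>) powr (1 / s)"
  have x: "x > 0" using assms by (simp add: x_def)
  show "exp x powr s \<ge> 1" using x assms by (intro ge_one_powr_ge_zero) auto
  fix n
  have "x powr s = R / \<epsilon>" using assms by (simp add: x_def powr_powr)
  moreover have "(x ^ n) powr s = (x powr s) ^ n"
    by (rule power_powr_swap)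
  ultimately have "(x ^ n) powr s = (R / \<epsilon>) ^ n"
    by simp
  moreover have "(x ^ n) powr s \<le> (fact n * exp x) powr s"
    using x assms power_le_fact_mult_exp[of x n] by (intro powr_mono2) auto
  ultimately have "(R / \<epsilon>) ^ n \<le> exp x powr s * fact n powr s"
    by (simp add: powr_mult mult.commute)
  then have "(R / \<epsilon>) ^ n * \<epsilon> ^ n \<le> exp x powr s * fact n powr s * \<epsilon> ^ n"
    using assms by (intro mult_right_mono) auto
  then show "R ^ n \<le> exp x powr s * \<epsilon> ^ n * fact n powr s"
    using assms by (simp add: power_divide mult_ac)
qed

text \<open>The binomial coefficient is at most 2^(n + p). This is the origin of the factor 2 powr s
  in the scale of the Zak estimate.\<close>

lemma fact_add_powr:
  fixes s :: real
  assumes "s > 0"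
  shows "fact (n + p) powr s \<le> (2 ^ p * fact p) powr s * (2 powr s) ^ n * fact n powr s"
proof -
  have "(fact (n + p) :: nat) = (n + p choose n) * (fact n * fact p)"
    using binomial_fact_lemma[of n "n + p"] by (simp add: mult_ac)
  then have "(fact (n + p) :: nat) \<le> 2 ^ (n + p) * (fact n * fact p)"
    using binomial_le_pow2[of "n + p" n] by simp
  then have "real (fact (n + p)) \<le> real (2 ^ (n + p) * (fact n * fact p))"
    by (simp only: of_nat_le_iff)
  then have "fact (n + p) \<le> ((2 ^ p * fact p) * 2 ^ n * fact n :: real)"
    by (simp add: power_add mult_ac)
  then have "fact (n + p) powr s \<le> ((2 ^ p * fact p) * 2 ^ n * fact n) powr s"
    using assms by (intro powr_mono2) auto
  also have "\<dots> = (2 ^ p * fact p) powr s * (2 ^ n) powr s * fact n powr s"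
    by (simp only: powr_mult)
  also have "(2 ^ n) powr s = (2 powr s) ^ n"
    by (rule power_powr_swap)
  finally show ?thesis .
qed

lemma mi_fact_pos: "mi_fact \<alpha> > 0"
  by (simp add: mi_fact_def prod_pos)

lemma mi_fact_powr: "mi_fact \<alpha> powr s = (\<Prod>i\<in>UNIV. fact (\<alpha> i) powr s)"
  unfolding mi_fact_def by (rule prod_powr_distrib)

lemma power_mi_size: "c ^ mi_size \<alpha> = (\<Prod>i\<in>UNIV. (c :: 'a::comm_monoid_mult) ^ \<alpha> i)"
  by (simp add: mi_size_def power_sum)

lemma power_mi_size_le:
  fixes R \<epsilon> s :: real
  assumes "R > 0" "\<epsilon> > 0" "s > 0"
  obtains C where "C \<ge> 1"
    "\<And>\<alpha> :: 'n::finite \<Rightarrow> nat. R ^ mi_size \<alpha> \<le> C * \<epsilon> ^ mi_size \<alpha> * mi_fact \<alpha> powr s"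
proof -
  obtain C where C: "C \<ge> 1" "\<And>n. R ^ n \<le> C * \<epsilon> ^ n * fact n powr s"
    using power_le_fact_powr[OF assms] by blast
  have "R ^ mi_size \<alpha> \<le> C ^ CARD('n) * \<epsilon> ^ mi_size \<alpha> * mi_fact \<alpha> powr s" for \<alpha> :: "'n \<Rightarrow> nat"
  proof -
    have "R ^ mi_size \<alpha> \<le> (\<Prod>i\<in>UNIV. C * \<epsilon> ^ \<alpha> i * fact (\<alpha> i) powr s)"
      unfolding power_mi_size using assms C(2) by (intro prod_mono) auto
    also have "\<dots> = C ^ CARD('n) * \<epsilon> ^ mi_size \<alpha> * mi_fact \<alpha> powr s"
      by (simp add: prod.distrib power_mi_size mi_fact_powr)
    finally show ?thesis .
  qed
  then show ?thesis using that[of "C ^ CARD('n)"] C(1) one_le_power by blast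
qed

lemma mi_fact_shift:
  fixes s :: real
  assumes "s > 0"
  obtains C where "C \<ge> 1" "\<And>\<beta> :: 'n::finite \<Rightarrow> nat.
    mi_fact (\<lambda>i. \<beta> i + p) powr s \<le> C * (2 powr s) ^ mi_size \<beta> * mi_fact \<beta> powr s"
proof -
  define c :: real where "c = (2 ^ p * fact p) powr s"
  have "(2 ^ p * fact p :: real) \<ge> 1 * 1" by (intro mult_mono) auto
  then have "c \<ge> 1" using assms unfolding c_def by (intro ge_one_powr_ge_zero) auto
  have "mi_fact (\<lambda>i. \<beta> i + p) powr s \<le> c ^ CARD('n) * (2 powr s) ^ mi_size \<beta> * mi_fact \<beta> powr s" for \<beta> :: "'n \<Rightarrow> nat"
  proof -
    have "mi_fact (\<lambda>i. \<beta> i + p) powr s \<le> (\<Prod>i\<in>UNIV. c * (2 powr s) ^ \<beta> i * fact (\<beta> i) powr s)"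
      unfolding mi_fact_powr c_def using fact_add_powr[OF assms] by (intro prod_mono) auto
    also have "\<dots> = c ^ CARD('n) * (2 powr s) ^ mi_size \<beta> * mi_fact \<beta> powr s"
      by (simp add: prod.distrib power_mi_size mi_fact_powr)
    finally show ?thesis .
  qed
  then show ?thesis using that[of "c ^ CARD('n)"] \<open>c \<ge> 1\<close> one_le_power by blast
qed

text \<open>A stand-in for |y^p| that does not degenerate where a coordinate is small, so that a
  bounded translation of y costs only a constant factor per degree.\<close>

definition max_power :: "real \<Rightarrow> real^'n::finite \<Rightarrow> ('n \<Rightarrow> nat) \<Rightarrow> real" where
  "max_power R y p = (\<Prod>i\<in>UNIV. max R \<bar>y $ i\<bar> ^ p i)"

text \<open>Keeping the coordinates with \<open>\<bar>y $ i\<bar> \<ge> R\<close> in \<open>\<gamma>\<close> and the others in \<open>\<delta>\<close> makes the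
  supports disjoint, so the factorials multiply.\<close>
lemma max_power_split:
  fixes p :: "'n::finite \<Rightarrow> nat"
  assumes "R > 0"
  obtains \<gamma> \<delta> :: "'n \<Rightarrow> nat" where "max_power R y p = \<bar>mi_power y \<gamma>\<bar> * R ^ mi_size \<delta>"
    "mi_size p = mi_size \<gamma> + mi_size \<delta>" "mi_fact p = mi_fact \<gamma> * mi_fact \<delta>" "\<And>i. \<gamma> i \<le> p i" "\<And>i. \<delta> i \<le> p i"
proof
  let ?\<gamma> = "\<lambda>i. if \<bar>y $ i\<bar> \<ge> R then p i else 0" and ?\<delta> = "\<lambda>i. if \<bar>y $ i\<bar> \<ge> R then 0 else p i"
  have "max_power R y p = (\<Prod>i\<in>UNIV. \<bar>y $ i\<bar> ^ ?\<gamma> i * R ^ ?\<delta> i)"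
    unfolding max_power_def by (rule prod.cong) auto
  then show "max_power R y p = \<bar>mi_power y ?\<gamma>\<bar> * R ^ mi_size ?\<delta>"
    by (simp only: prod.distrib power_mi_size mi_power_def abs_prod power_abs)
  show "mi_size p = mi_size ?\<gamma> + mi_size ?\<delta>"
    unfolding mi_size_def sum.distrib[symmetric] by (rule sum.cong) auto
  show "mi_fact p = mi_fact ?\<gamma> * mi_fact ?\<delta>"
    unfolding mi_fact_def prod.distrib[symmetric] by (rule prod.cong) auto
qed auto

lemma max_power_ge:
  assumes "\<And>i. \<bar>x $ i\<bar> \<le> c * max R \<bar>y $ i\<bar>"
  shows "\<bar>mi_power x \<beta>\<bar> \<le> c ^ mi_size \<beta> * max_power R y \<beta>"
proof -
  have "\<bar>mi_power x \<beta>\<bar> \<le> (\<Prod>i\<in>UNIV. (c * max R \<bar>y $ i\<bar>) ^ \<beta> i)"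
    unfolding mi_power_def abs_prod power_abs using assms by (intro prod_mono) (auto intro: power_mono)
  then show ?thesis
    by (simp add: power_mult_distrib prod.distrib power_mi_size max_power_def)
qed

lemma finite_mi_below: "finite {\<gamma> :: 'n::finite \<Rightarrow> nat. \<forall>i. \<gamma> i \<le> p i}"
proof -
  have "{\<gamma> :: 'n \<Rightarrow> nat. \<forall>i. \<gamma> i \<le> p i} = PiE UNIV (\<lambda>i. {..p i})"
    by (auto simp: PiE_UNIV_domain)
  then show ?thesis by (simp add: finite_PiE)
qed

text \<open>The splitting of \<open>max_power\<close> depends on the point, but only finitely many
  pairs below p can occur; adding up the bounds for all of them gives one that is uniform in
  x.\<close>

lemma max_power_bound:
  assumes "R > 0" "\<And>\<gamma>. (\<And>i. \<gamma> i \<le> p i) \<Longrightarrow> \<exists>C. \<forall>x\<in>A. \<bar>mi_power (y x) \<gamma>\<bar> * g x \<le> C"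
    and g: "\<And>x. x \<in> A \<Longrightarrow> g x \<ge> 0"
  shows "\<exists>B. \<forall>x\<in>A. max_power R (y x) p * g x \<le> B"
proof -
  let ?G = "{\<gamma>. \<forall>i. \<gamma> i \<le> p i}"
  obtain C where C: "\<And>\<gamma> x. \<gamma> \<in> ?G \<Longrightarrow> x \<in> A \<Longrightarrow> \<bar>mi_power (y x) \<gamma>\<bar> * g x \<le> C \<gamma>"
    using assms(2) by (simp add: Ball_def) metis
  define B where "B = (\<Sum>\<gamma>\<in>?G. \<Sum>\<delta>\<in>?G. \<bar>C \<gamma>\<bar> * R ^ mi_size \<delta>)"
  have "max_power R (y x) p * g x \<le> B" if x: "x \<in> A" for x
  proof -
    obtain \<gamma> \<delta> where *: "max_power R (y x) p = \<bar>mi_power (y x) \<gamma>\<bar> * R ^ mi_size \<delta>" "\<gamma> \<in> ?G" "\<delta> \<in> ?G"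
      by (rule max_power_split[OF assms(1), of "y x" p]) auto
    have "max_power R (y x) p * g x = (\<bar>mi_power (y x) \<gamma>\<bar> * g x) * R ^ mi_size \<delta>"
      by (simp add: *(1) mult_ac)
    also have "\<dots> \<le> \<bar>C \<gamma>\<bar> * R ^ mi_size \<delta>"
      using C[OF *(2) x] assms(1) by (intro mult_right_mono) auto
    also have "\<dots> \<le> (\<Sum>\<delta>\<in>?G. \<bar>C \<gamma>\<bar> * R ^ mi_size \<delta>)"
      using *(3) assms(1) by (intro member_le_sum finite_mi_below) auto
    also have "\<dots> \<le> B"
      unfolding B_def using *(2) assms(1)
      by (intro member_le_sum[of \<gamma> ?G "\<lambda>\<gamma>. \<Sum>\<delta>\<in>?G. \<bar>C \<gamma>\<bar> * R ^ mi_size \<delta>"] finite_mi_below sum_nonneg) auto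
    finally show ?thesis .
  qed
  then show ?thesis by blast
qed

lemma prod_list_axis:
  fixes k :: "real^'n::finite"
  assumes "set vs \<subseteq> Basis"
  shows "(\<Prod>b\<leftarrow>vs. k \<bullet> b) = mi_power k (\<lambda>i. count_list vs (axis i 1))"
  using assms
proof (induction vs)
  case Nil
  then show ?case by (simp add: mi_power_def)
next
  case (Cons b vs)
  then obtain j where j: "b = axis j 1" by (auto simp: Basis_vec_range)
  have "mi_power k (\<lambda>i. count_list (b # vs) (axis i 1))
      = (\<Prod>i\<in>UNIV. (if i = j then k $ i else 1) * (k $ i) ^ count_list vs (axis i 1))"
    unfolding mi_power_def by (rule prod.cong) (auto simp: j axis_eq_axis)
  also have "\<dots> = k $ j * mi_power k (\<lambda>i. count_list vs (axis i 1))"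
    by (simp add: prod.distrib mi_power_def)
  finally show ?case using Cons by (simp add: j inner_axis)
qed

text \<open>In the enumeration \<open>int_decode\<close> the absolute value of the n-th integer is
  about n / 2, which allows comparison with 4 / (n + 1)^2.\<close>

lemma summable_int_inverse_square: "(\<lambda>m::int. 1 / (1 + \<bar>real_of_int m\<bar>)\<^sup>2) summable_on UNIV"
proof -
  have "summable (\<lambda>n. 4 * (1 / real (Suc n) ^ 2))"
    using inverse_power_summable[of 2, where 'a = real] summable_Suc_iff[of "\<lambda>n. inverse (real n ^ 2)"]
    by (intro summable_mult) (simp add: inverse_eq_divide)
  then have "summable (\<lambda>n. norm (1 / (1 + \<bar>real_of_int (int_decode n)\<bar>)\<^sup>2))"
  proof (rule summable_comparison_test')
    fix n :: nat
    have "real (Suc n) \<le> 2 * (1 + \<bar>real_of_int (int_decode n)\<bar>)"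
      by (auto simp: int_decode_def sum_decode_def)
    moreover have "1 / a\<^sup>2 \<le> 4 * (1 / N\<^sup>2)" if "N \<le> 2 * a" "0 < N" "0 < a" for N a :: real
    proof -
      have "N\<^sup>2 \<le> (2 * a)\<^sup>2" using that by (intro power_mono) auto
      with that show ?thesis by (simp add: power_mult_distrib field_simps)
    qed
    ultimately show "norm (norm (1 / (1 + \<bar>real_of_int (int_decode n)\<bar>)\<^sup>2)) \<le> 4 * (1 / real (Suc n) ^ 2)"
      by simp
  qed
  then have "(\<lambda>n. 1 / (1 + \<bar>real_of_int (int_decode n)\<bar>)\<^sup>2) summable_on UNIV"
    by (rule norm_summable_imp_summable_on)
  then show ?thesis
    using summable_on_reindex_bij_betw[OF bij_int_decode, of "\<lambda>m. 1 / (1 + \<bar>real_of_int m\<bar>)\<^sup>2"] by simp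
qed

subsection \<open>The Zak series\<close>

text \<open>Basis vectors of the product have the form (b, 0) or (0, b) with b \<noteq> 0, so the
  second component tells the two kinds apart.\<close>

definition x_dirs :: "((real^'n::finite) \<times> (real^'n)) list \<Rightarrow> (real^'n) list" where
  "x_dirs vs = map fst (filter (\<lambda>v. snd v = 0) vs)"

definition xi_dirs :: "((real^'n::finite) \<times> (real^'n)) list \<Rightarrow> (real^'n) list" where
  "xi_dirs vs = map snd (filter (\<lambda>v. snd v \<noteq> 0) vs)"

lemma set_x_dirs: "set vs \<subseteq> Basis \<Longrightarrow> set (x_dirs vs) \<subseteq> Basis"
  by (auto simp: x_dirs_def Basis_prod_def)

lemma set_xi_dirs: "set vs \<subseteq> Basis \<Longrightarrow> set (xi_dirs vs) \<subseteq> Basis"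
  by (auto simp: xi_dirs_def Basis_prod_def)

text \<open>The translation is written as addition of - j so that the rules for
  \<open>f (x + c)\<close> apply as they stand.\<close>

definition zak_term :: "(real^'n::finite \<Rightarrow> complex) \<Rightarrow> real^'n \<Rightarrow> (real^'n) \<times> (real^'n) \<Rightarrow> complex" where
  "zak_term f j = (\<lambda>z. chr j z * f (fst z + - j))"

lemma smooth_zak_term: "smooth f \<Longrightarrow> smooth (zak_term f j)"
  unfolding zak_term_def by (intro smooth_chr_mult smooth_fst smooth_translate)

lemma partial_zak_term:
  assumes "smooth f"
  shows "partial (b, 0) (zak_term f j) = zak_term (partial b f) j"
    and "partial (0, b) (zak_term f j) = (\<lambda>z. \<i> * of_real (j \<bullet> b) * zak_term f j z)"
proof -
  have s: "smooth (\<lambda>z::(real^'a) \<times> (real^'a). f (fst z + - j))"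
    by (rule smooth_fst[OF smooth_translate[OF assms]])
  show "partial (b, 0) (zak_term f j) = zak_term (partial b f) j"
    unfolding zak_term_def partial_chr_mult[OF s] partial_fst(1)[of b "\<lambda>x. f (x + - j)"] partial_translate
    by simp
  show "partial (0, b) (zak_term f j) = (\<lambda>z. \<i> * of_real (j \<bullet> b) * zak_term f j z)"
    unfolding zak_term_def partial_chr_mult[OF s] partial_fst(2)[of b "\<lambda>x. f (x + - j)"]
    by (simp add: mult_ac)
qed

lemma fold_partial_cmult:
  "smooth f \<Longrightarrow> set vs \<subseteq> Basis \<Longrightarrow> fold partial vs (\<lambda>x. c * f x) = (\<lambda>x. c * fold partial vs f x)"
  using fold_partial_comb[of f f vs c 0] by simp

lemma fold_partial_zak_term:
  assumes "smooth f" "set vs \<subseteq> Basis"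
  shows "fold partial vs (zak_term f j)
    = (\<lambda>z. (\<Prod>b\<leftarrow>xi_dirs vs. \<i> * of_real (j \<bullet> b)) * zak_term (fold partial (x_dirs vs) f) j z)"
  using assms
proof (induction vs arbitrary: f)
  case Nil
  then show ?case by (simp add: xi_dirs_def x_dirs_def)
next
  case (Cons v vs)
  then consider b where "b \<in> Basis" "v = (b, 0)" | b where "b \<in> Basis" "v = (0, b)"
    by (auto simp: Basis_prod_def)
  then show ?case
  proof cases
    case 1
    then show ?thesis
      using Cons by (simp add: partial_zak_term smooth_partial xi_dirs_def x_dirs_def)
  next
    case 2
    then have b: "b \<noteq> 0" by auto
    have "fold partial (v # vs) (zak_term f j) = fold partial vs (\<lambda>z. (\<i> * of_real (j \<bullet> b)) * zak_term f j z)"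
      using 2 Cons.prems by (simp add: partial_zak_term)
    also have "\<dots> = (\<lambda>z. (\<i> * of_real (j \<bullet> b)) * fold partial vs (zak_term f j) z)"
      using Cons.prems by (intro fold_partial_cmult smooth_zak_term) auto
    finally show ?thesis
      using Cons.IH[OF Cons.prems(1)] Cons.prems(2) 2 b by (simp add: xi_dirs_def x_dirs_def mult.assoc)
  qed
qed

lemma cmod_fold_partial_zak_term:
  assumes "smooth f" "set vs \<subseteq> Basis"
  shows "cmod (fold partial vs (zak_term f j) z)
    = \<bar>mi_power j (\<lambda>i. count_list (xi_dirs vs) (axis i 1))\<bar>
      * cmod (deriv_mi (\<lambda>i. count_list (x_dirs vs) (axis i 1)) f (fst z - j))"
proof -
  have "cmod (\<Prod>b\<leftarrow>us. \<i> * of_real (j \<bullet> b)) = \<bar>\<Prod>b\<leftarrow>us. j \<bullet> b\<bar>" for us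
    by (induction us) (simp_all add: norm_mult abs_mult)
  then show ?thesis
    unfolding fold_partial_zak_term[OF assms]
    using assms by (simp add: zak_term_def norm_mult prod_list_axis set_xi_dirs
        fold_partial_deriv_mi[OF assms(1) set_x_dirs])
qed

context zak_basis
begin

text \<open>For j = lat n the factor at l is 1 / (1 + |n l|)^2, because pairing with E' l extracts 2
  * pi * n l. This is the summable majorant for all Zak series.\<close>

definition lat_weight :: "real^'n \<Rightarrow> real" where
  "lat_weight j = (\<Prod>l\<in>UNIV. 1 / (1 + \<bar>j \<bullet> E' l / (2 * pi)\<bar>)\<^sup>2)"

lemma lat_weight_pos: "lat_weight j > 0"
proof -
  have "1 + \<bar>j \<bullet> E' l / (2 * pi)\<bar> > 0" for l
    by (simp add: add_pos_nonneg)
  then show ?thesis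
    unfolding lat_weight_def by (intro prod_pos ballI divide_pos_pos zero_less_power) auto
qed

text \<open>In lattice coordinates the weight is a product of functions of one integer each, so
  summability factorizes. The product theorem is applied to
  \<open>Infinite_Set_Sum.abs_summable_on\<close>, which explains the conversions.\<close>

lemma lat_weight_summable: "lat_weight summable_on lattice E"
proof -
  have "Infinite_Set_Sum.abs_summable_on (\<lambda>m::int. 1 / (1 + \<bar>real_of_int m\<bar>)\<^sup>2) UNIV"
    unfolding abs_summable_equivalent[symmetric] using summable_int_inverse_square by simp
  then have "Infinite_Set_Sum.abs_summable_on (\<lambda>n. \<Prod>l\<in>(UNIV::'n set). 1 / (1 + \<bar>real_of_int (n l)\<bar>)\<^sup>2)
      (PiE UNIV (\<lambda>_. UNIV))"
    by (intro abs_summable_on_prod_PiE) auto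
  then have "Infinite_Sum.abs_summable_on (\<lambda>n. \<Prod>l\<in>(UNIV::'n set). 1 / (1 + \<bar>real_of_int (n l)\<bar>)\<^sup>2) UNIV"
    unfolding abs_summable_equivalent by (simp add: PiE_UNIV_domain)
  then have "(\<lambda>n. \<Prod>l\<in>(UNIV::'n set). 1 / (1 + \<bar>real_of_int (n l)\<bar>)\<^sup>2) summable_on UNIV"
    by (rule abs_summable_summable)
  then have "(\<lambda>n. lat_weight (lat n)) summable_on UNIV"
    by (simp add: lat_weight_def lat_inner_dual)
  then show ?thesis
    using summable_on_reindex_bij_betw[OF bij_lat, of lat_weight] by simp
qed

text \<open>The base bounds 1 + |j \<bullet> E' l / (2 * pi)| relative to P in the next estimate;
  the exponent collects d squared factors.\<close>

definition lat_const :: real where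
  "lat_const = (1 + 2 * real CARD('n) * (\<Sum>l\<in>UNIV. norm (E' l))) ^ (2 * CARD('n))"

lemma lat_const_ge: "lat_const \<ge> 1"
  unfolding lat_const_def by (intro one_le_power) (simp add: sum_nonneg)

text \<open>For norm x \<le> R every |j_i| is at most twice the maximum of R and |(x - j)_i|. These
  maxima are at least 1, so their product P dominates each of them and norm j \<le> 2 * d * P. Thus
  2d powers in every coordinate of x - j pay for the weight.\<close>

lemma lat_weight_bound:
  assumes R: "R \<ge> 1" and x: "norm x \<le> R"
  shows "1 \<le> lat_const * lat_weight j * max_power R (x - j) (\<lambda>_. 2 * CARD('n))"
proof -
  define m where "m i = max R \<bar>(x - j) $ i\<bar>" for i
  define P where "P = (\<Prod>i\<in>UNIV. m i)"
  have m1: "m i \<ge> 1" for i using R by (simp add: m_def)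
  have P1: "P \<ge> 1" unfolding P_def using m1 by (intro prod_ge_1) auto
  have mP: "m i \<le> P" for i
  proof -
    have "m i * 1 \<le> m i * (\<Prod>i\<in>UNIV - {i}. m i)"
      using m1 order_trans[OF zero_le_one m1[of i]] by (intro mult_left_mono prod_ge_1) auto
    then show ?thesis by (simp add: P_def prod.remove[of UNIV i])
  qed
  have "\<bar>j $ i\<bar> \<le> 2 * P" for i
  proof -
    have "\<bar>x $ i\<bar> \<le> R" using x component_le_norm_cart[of x i] by linarith
    moreover have "R \<le> m i" "\<bar>x $ i - j $ i\<bar> \<le> m i" by (simp_all add: m_def)
    ultimately have "\<bar>j $ i\<bar> \<le> 2 * m i" by linarith
    then show ?thesis using mP[of i] by linarith
  qed
  then have "norm j \<le> (\<Sum>i\<in>(UNIV::'n set). 2 * P)"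
    using norm_le_l1_cart[of j] by (meson order_trans sum_mono)
  then have nj: "norm j \<le> 2 * real CARD('n) * P" by simp
  let ?c = "1 + 2 * real CARD('n) * (\<Sum>l\<in>UNIV. norm (E' l))"
  have f: "(1 + \<bar>j \<bullet> E' l / (2 * pi)\<bar>)\<^sup>2 \<le> (?c * P)\<^sup>2" for l
  proof -
    have "\<bar>j \<bullet> E' l / (2 * pi)\<bar> \<le> \<bar>j \<bullet> E' l\<bar> / 1"
      unfolding abs_divide using pi_gt3 by (intro divide_left_mono) auto
    also have "\<dots> \<le> norm j * norm (E' l)"
      using Cauchy_Schwarz_ineq2 by simp
    also have "\<dots> \<le> (2 * real CARD('n) * P) * (\<Sum>l\<in>UNIV. norm (E' l))"
      using nj P1 by (intro mult_mono member_le_sum) auto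
    finally have "1 + \<bar>j \<bullet> E' l / (2 * pi)\<bar> \<le> ?c * P"
      using P1 by (simp add: algebra_simps)
    then show ?thesis by (intro power_mono) auto
  qed
  have "(\<Prod>l\<in>(UNIV::'n set). (1 + \<bar>j \<bullet> E' l / (2 * pi)\<bar>)\<^sup>2) \<le> (\<Prod>l\<in>(UNIV::'n set). (?c * P)\<^sup>2)"
    by (intro prod_mono) (use f in auto)
  also have "\<dots> = lat_const * P ^ (2 * CARD('n))"
    by (simp add: lat_const_def power_mult_distrib power_mult[symmetric])
  also have "P ^ (2 * CARD('n)) = max_power R (x - j) (\<lambda>_. 2 * CARD('n))"
    by (simp only: P_def m_def max_power_def prod_power_distrib)
  finally have "(\<Prod>l\<in>(UNIV::'n set). (1 + \<bar>j \<bullet> E' l / (2 * pi)\<bar>)\<^sup>2)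
      \<le> lat_const * max_power R (x - j) (\<lambda>_. 2 * CARD('n))" .
  moreover have "(\<Prod>l\<in>(UNIV::'n set). (1 + \<bar>j \<bullet> E' l / (2 * pi)\<bar>)\<^sup>2) = 1 / lat_weight j"
    by (simp add: lat_weight_def prod_dividef)
  ultimately have "1 / lat_weight j \<le> lat_const * max_power R (x - j) (\<lambda>_. 2 * CARD('n))"
    by (simp only:)
  then show ?thesis
    using lat_weight_pos[of j] by (simp add: field_simps)
qed

text \<open>The \<xi>-derivatives bring down powers of j, which cost 2 per degree when rewritten as
  powers of x - j; the additional exponent 2d in each coordinate buys the summable weight.\<close>

lemma zak_term_bound:
  assumes f: "smooth f" and vs: "set vs \<subseteq> Basis" and R: "R \<ge> 1" and z: "norm (fst z) \<le> R"
    and B: "\<And>y. max_power R y (\<lambda>i. count_list (xi_dirs vs) (axis i 1) + 2 * CARD('n))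
        * cmod (deriv_mi (\<lambda>i. count_list (x_dirs vs) (axis i 1)) f y) \<le> B"
  shows "cmod (fold partial vs (zak_term f j) z)
    \<le> 2 ^ mi_size (\<lambda>i::'n. count_list (xi_dirs vs) (axis i 1)) * lat_const * B * lat_weight j"
proof -
  define \<beta> :: "'n \<Rightarrow> nat" where "\<beta> = (\<lambda>i. count_list (xi_dirs vs) (axis i 1))"
  define y where "y = fst z - j"
  define D where "D = cmod (deriv_mi (\<lambda>i. count_list (x_dirs vs) (axis i 1)) f y)"
  have D0: "D \<ge> 0" by (simp add: D_def)
  have mp: "max_power R y p \<ge> 0" for p
    using R by (auto simp: max_power_def intro!: prod_nonneg)
  have "\<bar>mi_power j \<beta>\<bar> \<le> 2 ^ mi_size \<beta> * max_power R y \<beta>"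
  proof (rule max_power_ge)
    fix i
    have "\<bar>fst z $ i\<bar> \<le> R" using z component_le_norm_cart[of "fst z" i] by linarith
    moreover have "R \<le> max R \<bar>y $ i\<bar>" "\<bar>fst z $ i - j $ i\<bar> \<le> max R \<bar>y $ i\<bar>" by (simp_all add: y_def)
    ultimately show "\<bar>j $ i\<bar> \<le> 2 * max R \<bar>y $ i\<bar>" by linarith
  qed
  then have "\<bar>mi_power j \<beta>\<bar> * D \<le> 2 ^ mi_size \<beta> * max_power R y \<beta> * D * 1"
    using D0 by (simp add: mult_right_mono)
  also have "\<dots> \<le> 2 ^ mi_size \<beta> * max_power R y \<beta> * D * (lat_const * lat_weight j * max_power R y (\<lambda>_. 2 * CARD('n)))"
    using lat_weight_bound[OF R z, of j] D0 mp by (intro mult_left_mono) (auto simp: y_def)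
  also have "\<dots> = 2 ^ mi_size \<beta> * lat_const * (max_power R y (\<lambda>i. \<beta> i + 2 * CARD('n)) * D) * lat_weight j"
    by (simp add: max_power_def power_add prod.distrib mult_ac)
  also have "\<dots> \<le> 2 ^ mi_size \<beta> * lat_const * B * lat_weight j"
    using B[of y] lat_weight_pos[of j] lat_const_ge
    by (intro mult_right_mono mult_left_mono) (auto simp: \<beta>_def D_def)
  finally show ?thesis
    using f vs by (simp add: cmod_fold_partial_zak_term \<beta>_def D_def y_def)
qed

end

lemma schwartz_smooth: "f \<in> schwartz \<Longrightarrow> smooth f"
  by (simp add: schwartz_def)

lemma deriv_x_deriv_xi:
  "deriv_x \<alpha> (deriv_xi \<beta> F)
    = fold partial (mi_list (\<lambda>i. (0, axis i 1)) \<beta> @ mi_list (\<lambda>i. (axis i 1, 0)) \<alpha>) F"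
  by (simp add: deriv_x_def deriv_xi_def multi_partial_fold)

lemma set_mi_list_axis:
  "set (mi_list (\<lambda>i. axis i 1) \<alpha>) \<subseteq> (Basis :: (real^'n::finite) set)"
  "set (mi_list (\<lambda>i. (axis i 1, 0)) \<alpha>) \<subseteq> (Basis :: ((real^'n::finite) \<times> (real^'n)) set)"
  "set (mi_list (\<lambda>i. (0, axis i 1)) \<alpha>) \<subseteq> (Basis :: ((real^'n::finite) \<times> (real^'n)) set)"
  by (auto simp: mi_list_def Basis_prod_def Basis_vec_range)

lemma dirs_mi_list:
  fixes \<alpha> \<beta> :: "'n::finite \<Rightarrow> nat"
  defines "vs \<equiv> mi_list (\<lambda>i. (0, axis i 1)) \<beta> @ mi_list (\<lambda>i. (axis i 1, 0)) \<alpha> :: ((real^'n) \<times> (real^'n)) list"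
  shows "count_list (x_dirs vs) (axis i 1) = \<alpha> i" "count_list (xi_dirs vs) (axis i 1) = \<beta> i"
proof -
  have ax: "axis i (1::real) \<noteq> (0 :: real^'n)" for i by (simp add: axis_eq_0_iff)
  have f: "filter P (mi_list b \<gamma>) = (if Q then mi_list b \<gamma> else [])"
    if "\<And>i. P (b i) = Q" for P Q and b :: "'n \<Rightarrow> (real^'n) \<times> (real^'n)" and \<gamma>
    using that by (auto intro!: filter_True filter_False simp: mi_list_def)
  have "x_dirs vs = mi_list (\<lambda>i. axis i 1) \<alpha>"
    by (simp add: x_dirs_def vs_def f[where Q = True] f[where Q = False] ax map_mi_list)
  moreover have "xi_dirs vs = mi_list (\<lambda>i. axis i 1) \<beta>"
    by (simp add: xi_dirs_def vs_def f[where Q = True] f[where Q = False] ax map_mi_list)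
  ultimately show "count_list (x_dirs vs) (axis i 1) = \<alpha> i" "count_list (xi_dirs vs) (axis i 1) = \<beta> i"
    by (simp_all add: count_mi_list[OF inj_axis])
qed

text \<open>Derivative bounds in which the weight depends only on the order; \<open>W m = M * h ^ m\<close> recovers
  the norms, and the general form is needed for the projective description of the inductive limit.\<close>

definition gs_bounded ::
    "real \<Rightarrow> real \<Rightarrow> (nat \<Rightarrow> real) \<Rightarrow> (real^'n::finite \<Rightarrow> complex) \<Rightarrow> bool" where
  "gs_bounded s \<sigma> W f \<longleftrightarrow> (\<forall>\<alpha> \<beta> x. cmod (of_real (mi_power x \<alpha>) * deriv_mi \<beta> f x)
     \<le> W (mi_size \<alpha> + mi_size \<beta>) * (mi_fact \<alpha> powr s * mi_fact \<beta> powr \<sigma>))"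

definition gevrey_bounded ::
    "real \<Rightarrow> real \<Rightarrow> ((real^'n::finite) \<times> (real^'n)) set \<Rightarrow> (nat \<Rightarrow> real) \<Rightarrow> ((real^'n) \<times> (real^'n) \<Rightarrow> complex) \<Rightarrow> bool" where
  "gevrey_bounded \<sigma> s K W F \<longleftrightarrow> (\<forall>\<alpha> \<beta>. \<forall>z\<in>K. cmod (deriv_x \<alpha> (deriv_xi \<beta> F) z)
     \<le> W (mi_size \<alpha> + mi_size \<beta>) * (mi_fact \<alpha> powr \<sigma> * mi_fact \<beta> powr s))"

lemma gs_bounded_schwartz: "smooth f \<Longrightarrow> gs_bounded s \<sigma> W f \<Longrightarrow> f \<in> schwartz"
  by (auto simp: schwartz_def gs_bounded_def)

context zak_basis
begin

lemma zak_alt: "zak E f = (\<lambda>z. \<Sum>\<^sub>\<infinity>j\<in>lattice E. zak_term f j z)"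
  by (auto simp: zak_def zak_term_def chr_def mult.commute fun_eq_iff)

lemma lattice_enumeration: "\<exists>b :: nat \<Rightarrow> real^'n. bij_betw b UNIV (lattice E)"
proof -
  have lat: "lattice E = range lat" "inj lat"
    using bij_lat by (auto simp: bij_betw_def)
  have "inj (\<lambda>m::int. \<lambda>_::'n. m)" by (auto simp: inj_def fun_eq_iff)
  then have "infinite (UNIV :: ('n \<Rightarrow> int) set)"
    using finite_imageD[of "\<lambda>m::int. \<lambda>_::'n. m" UNIV] infinite_UNIV_int finite_subset[OF subset_UNIV] by blast
  then have "infinite (lattice E)"
    using lat finite_imageD by metis
  moreover have "countable (lattice E)"
    by (simp add: lat)
  ultimately show ?thesis
    using bij_betw_from_nat_into by blast
qed

lemma schwartz_term_bound:
  assumes "f \<in> schwartz" "set vs \<subseteq> Basis" "R \<ge> 1"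
  shows "\<exists>M. \<forall>j z. norm (fst z) \<le> R \<longrightarrow> cmod (fold partial vs (zak_term f j) z) \<le> M * lat_weight j"
proof -
  let ?D = "\<lambda>y. cmod (deriv_mi (\<lambda>i. count_list (x_dirs vs) (axis i 1)) f y)"
  have "\<exists>B. \<forall>y\<in>UNIV. max_power R y (\<lambda>i. count_list (xi_dirs vs) (axis i 1) + 2 * CARD('n)) * ?D y \<le> B"
    using assms by (intro max_power_bound) (auto simp: schwartz_def norm_mult)
  then obtain B where "\<And>y. max_power R y (\<lambda>i. count_list (xi_dirs vs) (axis i 1) + 2 * CARD('n)) * ?D y \<le> B"
    by auto
  from zak_term_bound[OF schwartz_smooth[OF assms(1)] assms(2,3) _ this] show ?thesis by blast
qed

text \<open>An enumeration of the lattice turns the unordered sum into partial sums, to which the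
  Weierstrass test with majorant M * \<open>lat_weight\<close> and then \<open>smooth_limit\<close>
  apply. Convergence is uniform on whole strips, unbounded in \<xi>, so it survives averaging along
  fibres.\<close>

lemma zak_series:
  fixes b :: "nat \<Rightarrow> real^'n"
  assumes f: "f \<in> schwartz" and b: "bij_betw b UNIV (lattice E)"
  shows "summable (\<lambda>n. lat_weight (b n))"
    and "set vs \<subseteq> Basis \<Longrightarrow> uniform_limit {z. norm (fst z) \<le> R} (\<lambda>N z. \<Sum>n<N. fold partial vs (zak_term f (b n)) z)
      (\<lambda>z. \<Sum>n. fold partial vs (zak_term f (b n)) z) sequentially"
    and "zak E f = (\<lambda>z. \<Sum>n. zak_term f (b n) z)"
    and "smooth (zak E f)"
    and "set vs \<subseteq> Basis \<Longrightarrow> fold partial vs (zak E f) = (\<lambda>z. \<Sum>n. fold partial vs (zak_term f (b n)) z)"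
proof -
  have "(\<lambda>n. lat_weight (b n)) summable_on UNIV"
    using summable_on_reindex_bij_betw[OF b, of lat_weight] lat_weight_summable by simp
  then show sum: "summable (\<lambda>n. lat_weight (b n))"
    by (rule summable_on_imp_summable)
  have lim: "uniform_limit {z. norm (fst z) \<le> R} (\<lambda>N z. \<Sum>n<N. fold partial vs (zak_term f (b n)) z)
      (\<lambda>z. \<Sum>n. fold partial vs (zak_term f (b n)) z) sequentially"
    if vs: "set vs \<subseteq> Basis" for vs R
  proof -
    obtain M where "\<And>j z. norm (fst z) \<le> max 1 R \<Longrightarrow> cmod (fold partial vs (zak_term f j) z) \<le> M * lat_weight j"
      using schwartz_term_bound[OF f vs, of "max 1 R"] max.cobounded1[of 1 R] by meson
    then show ?thesis
      by (intro Weierstrass_m_test[where M = "\<lambda>n. M * lat_weight (b n)"] summable_mult sum) auto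
  qed
  then show "set vs \<subseteq> Basis \<Longrightarrow> uniform_limit {z. norm (fst z) \<le> R} (\<lambda>N z. \<Sum>n<N. fold partial vs (zak_term f (b n)) z)
      (\<lambda>z. \<Sum>n. fold partial vs (zak_term f (b n)) z) sequentially" .
  show zak: "zak E f = (\<lambda>z. \<Sum>n. zak_term f (b n) z)"
  proof
    fix z :: "(real^'n) \<times> (real^'n)"
    obtain M where M: "\<And>j z'. norm (fst z') \<le> max 1 (norm (fst z)) \<Longrightarrow> cmod (fold partial [] (zak_term f j) z') \<le> M * lat_weight j"
      using schwartz_term_bound[OF f, of "[]" "max 1 (norm (fst z))"] max.cobounded1[of 1 "norm (fst z)"]
      by (metis (no_types, lifting) empty_subsetI list.set(1))
    have "summable (\<lambda>n. norm (zak_term f (b n) z))"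
      by (rule summable_comparison_test'[OF summable_mult[OF sum, of M]]) (use M[of z] in auto)
    then have "((\<lambda>n. zak_term f (b n) z) has_sum (\<Sum>\<^sub>\<infinity>n. zak_term f (b n) z)) UNIV"
      by (intro has_sum_infsum norm_summable_imp_summable_on)
    then have "(\<Sum>\<^sub>\<infinity>n. zak_term f (b n) z) = (\<Sum>n. zak_term f (b n) z)"
      using has_sum_imp_sums sums_unique by blast
    then show "zak E f z = (\<Sum>n. zak_term f (b n) z)"
      by (simp add: zak_alt infsum_reindex_bij_betw[OF b, of "\<lambda>j. zak_term f j z"])
  qed
  have sm: "smooth (zak_term f j)" for j
    by (rule smooth_zak_term[OF schwartz_smooth[OF f]])
  have lim': "uniform_limit (cball 0 R) (\<lambda>N. fold partial vs (\<lambda>z. \<Sum>n<N. zak_term f (b n) z))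
      (\<lambda>z. \<Sum>n. fold partial vs (zak_term f (b n)) z) sequentially"
    if vs: "set vs \<subseteq> Basis" for vs R
  proof -
    have "fold partial vs (\<lambda>z. \<Sum>n<N. zak_term f (b n) z) = (\<lambda>z. \<Sum>n<N. fold partial vs (zak_term f (b n)) z)" for N
      by (rule fold_partial_sum[OF sm vs])
    moreover have "cball 0 R \<subseteq> {z :: (real^'n) \<times> (real^'n). norm (fst z) \<le> R}"
      using norm_fst_le order_trans by fastforce
    ultimately show ?thesis
      using uniform_limit_on_subset[OF lim[OF vs]] by simp
  qed
  note sl = smooth_limit[where f = "\<lambda>N z. \<Sum>n<N. zak_term f (b n) z"
      and g = "\<lambda>vs z. \<Sum>n. fold partial vs (zak_term f (b n)) z", OF smooth_sum[OF sm] lim']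
  show "smooth (zak E f)"
    unfolding zak using sl(1) by simp
  show "set vs \<subseteq> Basis \<Longrightarrow> fold partial vs (zak E f) = (\<lambda>z. \<Sum>n. fold partial vs (zak_term f (b n)) z)"
    unfolding zak using sl(2)[of vs] by simp
qed

lemma smooth_zak: "f \<in> schwartz \<Longrightarrow> smooth (zak E f)"
  using zak_series(4) lattice_enumeration by blast

lemma zak_derivative_bound:
  assumes "f \<in> schwartz" "set vs \<subseteq> Basis"
    "\<And>j. cmod (fold partial vs (zak_term f j) z) \<le> M * lat_weight j"
  shows "cmod (fold partial vs (zak E f) z) \<le> M * infsum lat_weight (lattice E)"
proof -
  obtain b :: "nat \<Rightarrow> real^'n" where b: "bij_betw b UNIV (lattice E)"
    using lattice_enumeration by blast
  note z = zak_series[OF assms(1) b]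
  have "((\<lambda>n. lat_weight (b n)) has_sum infsum lat_weight (lattice E)) UNIV"
    using lat_weight_summable has_sum_infsum has_sum_reindex_bij_betw[OF b, of lat_weight] by blast
  then have "infsum lat_weight (lattice E) = (\<Sum>n. lat_weight (b n))"
    using has_sum_imp_sums sums_unique by blast
  moreover have "cmod (\<Sum>n. fold partial vs (zak_term f (b n)) z) \<le> (\<Sum>n. M * lat_weight (b n))"
    by (rule norm_suminf_le[OF assms(3) summable_mult[OF z(1)]])
  ultimately show ?thesis
    using z(5)[OF assms(2)] suminf_mult[OF z(1), of M] by simp
qed

lemma quasi_periodic_zak: "quasi_periodic E (zak E f)"
  unfolding quasi_periodic_alt xi_periodic_def
proof (intro conjI allI ballI)
  fix z :: "(real^'n) \<times> (real^'n)" and \<kappa> assume "\<kappa> \<in> lattice E'"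
  then have "zak_term f j (z + (0, \<kappa>)) = zak_term f j z" if "j \<in> lattice E" for j
    using that by (simp add: zak_term_def chr_dual_periodic)
  then show "zak E f (z + (0, \<kappa>)) = zak E f z"
    unfolding zak_alt by (intro infsum_cong)
next
  fix z :: "(real^'n) \<times> (real^'n)" and k assume k: "k \<in> lattice E"
  have b: "bij_betw (\<lambda>j. j + k) (lattice E) (lattice E)"
    by (rule bij_betwI[where g = "\<lambda>j. j - k"])
      (use lattice_add[OF _ k] lattice_add[OF _ lattice_minus[OF k]] in auto)
  have "zak E f (z + (k, 0)) = (\<Sum>\<^sub>\<infinity>j\<in>lattice E. zak_term f (j + k) (z + (k, 0)))"
    unfolding zak_alt by (rule infsum_reindex_bij_betw[OF b, symmetric])
  also have "\<dots> = (\<Sum>\<^sub>\<infinity>j\<in>lattice E. chr k z * zak_term f j z)"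
    by (rule infsum_cong) (simp add: zak_term_def chr_def inner_add_left distrib_left exp_add)
  also have "\<dots> = chr k z * zak E f z"
    unfolding zak_alt by (rule infsum_cmult_right')
  finally show "zak E f (z + (k, 0)) = chr k z * zak E f z" .
qed

text \<open>The average is not exchanged with the infinite sum. Every partial sum that contains the
  lattice point 0 has average exactly f, since all other characters average to zero, and uniform
  convergence on the strip makes the remainder arbitrarily small.\<close>

lemma avg_zak:
  assumes f: "f \<in> schwartz"
  shows "avg dirs (zak E f) z = f (fst z)"
proof -
  obtain b :: "nat \<Rightarrow> real^'n" where b: "bij_betw b UNIV (lattice E)"
    using lattice_enumeration by blast
  note s = schwartz_smooth[OF f]
  have "inj b" and lat: "b n \<in> lattice E" for n using b by (auto simp: bij_betw_def)
  obtain n0 where n0: "b n0 = 0"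
    using zero_in_lattice[of E] b by (metis bij_betw_imp_surj_on imageE)
  define S where "S N = (\<lambda>z. \<Sum>n<N. zak_term f (b n) z)" for N
  have sm: "smooth (S N)" for N
    unfolding S_def by (intro smooth_sum smooth_zak_term s)
  have avgS: "avg dirs (S N) z = f (fst z)" if "N > n0" for N
  proof -
    have t: "avg dirs (zak_term f (b n)) z = (if n = n0 then f (fst z) else 0)" for n
    proof -
      have "b n = 0 \<longleftrightarrow> n = n0" using \<open>inj b\<close> n0 by (metis injD)
      then show ?thesis
        unfolding zak_term_def avg_chr_fst[OF smooth_translate[OF s] lat] by (simp add: n0)
    qed
    have "avg dirs (S N) z = (\<Sum>n<N. avg dirs (zak_term f (b n)) z)"
      unfolding S_def by (subst avg_sum) (auto intro: smooth_zak_term s)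
    also have "\<dots> = (\<Sum>n<N. if n = n0 then f (fst z) else 0)"
      by (simp only: t)
    finally show ?thesis using that by simp
  qed
  have "cmod (avg dirs (zak E f) z - f (fst z)) \<le> e" if "e > 0" for e
  proof -
    have "\<forall>\<^sub>F N in sequentially. \<forall>w\<in>{w. norm (fst w) \<le> norm (fst z)}. dist (S N w) (zak E f w) < e"
      using uniform_limitD[OF zak_series(2)[OF f b, of "[]"] that] by (simp add: S_def zak_series(3)[OF f b])
    then have "\<forall>\<^sub>F N in sequentially. (\<forall>w\<in>{w. norm (fst w) \<le> norm (fst z)}. dist (S N w) (zak E f w) < e) \<and> n0 < N"
      by (intro eventually_conj eventually_gt_at_top)
    from eventually_happens'[OF sequentially_bot this]
    obtain N where "(\<forall>w\<in>{w. norm (fst w) \<le> norm (fst z)}. dist (S N w) (zak E f w) < e) \<and> n0 < N" ..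
    then have N: "N > n0" "\<And>w. norm (fst w) \<le> norm (fst z) \<Longrightarrow> dist (S N w) (zak E f w) < e"
      by blast+
    have "cmod (avg dirs (\<lambda>w. zak E f w - S N w) z) \<le> e"
    proof (rule avg_bound[where P = "\<lambda>w. fst w = fst z"])
      fix w :: "(real^'n) \<times> (real^'n)" assume "fst w = fst z"
      then show "cmod (zak E f w - S N w) \<le> e"
        using N(2)[of w] by (simp add: dist_norm norm_minus_commute)
    qed (auto simp: dirs_def intro: smooth_diff smooth_zak f sm)
    then show ?thesis
      by (simp add: avg_diff smooth_zak f sm avgS N(1))
  qed
  then have "cmod (avg dirs (zak E f) z - f (fst z)) \<le> 0"
    by (rule field_le_epsilon) simp
  then show ?thesis by simp
qed

lemma zak_inv_zak: "f \<in> schwartz \<Longrightarrow> zak_inv (zak E f) = f"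
  by (simp add: zak_inv_def avg_zak)

text \<open>The \<xi>-derivatives of the average vanish, and integrating along the segment from z to
  z + (0, \<xi>) shows that it is constant.\<close>

lemma avg_xi_constant:
  assumes "smooth F" "xi_periodic F"
  shows "avg dirs F (z + (0, \<xi>)) = avg dirs F z"
proof -
  have \<xi>: "(0, \<xi>) = (\<Sum>l\<in>UNIV. (\<xi> \<bullet> E l / (2 * pi)) *\<^sub>R (0 :: real^'n, E' l))"
    by (simp add: prod_eq_iff fst_sum snd_sum flip: expand_dual)
  have "avg dirs (partial (0, \<xi>) F) = (\<lambda>_. 0)"
    unfolding \<xi> using assms basis_in_lattice[of E']
    by (intro avg_partial_zero) (auto simp: dirs_def coords xi_periodic_def simp del: split_paired_All)
  then have "partial (0, \<xi>) (avg dirs F) = (\<lambda>_. 0)"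
    by (simp add: partial_avg assms(1))
  then show ?thesis
    using segment_ftc[OF smooth_avg[OF assms(1), of dirs], of 0 1 "(0, \<xi>)" z]
    by (simp flip: zero_prod_def)
qed

text \<open>Not an exact fundamental domain: a compact set whose translates by both lattices cover
  the space, which is all that the estimates need.\<close>

definition fund :: "((real^'n) \<times> (real^'n)) set" where
  "fund = cball 0 (\<Sum>i\<in>UNIV. norm (E i)) \<times> cball 0 (\<Sum>i\<in>UNIV. norm (E' i))"

lemma compact_fund: "compact fund"
  by (simp add: fund_def compact_Times)

text \<open>The order of quantifiers matters: k and y depend on x alone and serve all multi-indices
  at once, because later \<gamma> is chosen according to which coordinates of k are large.\<close>

lemma zak_inv_representative:
  assumes "smooth F" "quasi_periodic E F"
  shows "\<exists>k y. norm y \<le> (\<Sum>i\<in>UNIV. norm (E i)) \<and> x = y + k \<and>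
    (\<forall>\<gamma> \<alpha> B. (\<forall>z\<in>fund. cmod (deriv_x \<alpha> (deriv_xi \<gamma> F) z) \<le> B) \<longrightarrow>
      \<bar>mi_power k \<gamma>\<bar> * cmod (deriv_mi \<alpha> (zak_inv F) x) \<le> B)"
proof -
  obtain k where k: "k \<in> lattice E" "norm (x - k) \<le> (\<Sum>i\<in>UNIV. norm (E i))"
    using near_lattice by blast
  have "\<bar>mi_power k \<gamma>\<bar> * cmod (deriv_mi \<alpha> (zak_inv F) x) \<le> B"
    if B: "\<And>z. z \<in> fund \<Longrightarrow> cmod (deriv_x \<alpha> (deriv_xi \<gamma> F) z) \<le> B" for \<gamma> \<alpha> B
  proof -
    let ?us = "mi_list (\<lambda>i. axis i 1) \<alpha> :: (real^'n) list"
      and ?vs = "mi_list (\<lambda>i. axis i 1) \<gamma> :: (real^'n) list"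
    let ?us' = "mi_list (\<lambda>i. (axis i 1, 0)) \<alpha> :: ((real^'n) \<times> (real^'n)) list"
      and ?vs' = "mi_list (\<lambda>i. (0, axis i 1)) \<gamma> :: ((real^'n) \<times> (real^'n)) list"
    have eq: "fold partial (map (Pair 0) ?vs) (fold partial (map (\<lambda>b. (b, 0)) ?us) F) = deriv_x \<alpha> (deriv_xi \<gamma> F)"
    proof -
      \<comment> \<open>\<open>zak_inv_bound\<close> differentiates in x first,
        \<open>deriv_x\<close> after \<open>deriv_xi\<close> does so last.\<close>
      have "fold partial (?us' @ ?vs') F = fold partial (?vs' @ ?us') F"
        by (intro fold_partial_mset assms(1)) (simp_all add: set_mi_list_axis)
      then show ?thesis by (simp add: map_mi_list deriv_x_deriv_xi)
    qed
    have "(\<Prod>b\<leftarrow>?vs. \<bar>k \<bullet> b\<bar>) * cmod (fold partial ?us (zak_inv F) ((x - k) + k)) \<le> B"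
    proof (rule zak_inv_bound[OF assms k(1) set_mi_list_axis(1) set_mi_list_axis(1)], unfold eq, rule B)
      fix \<xi> :: "real^'n" assume "norm \<xi> \<le> (\<Sum>i\<in>UNIV. norm (E' i))"
      then show "(x - k, \<xi>) \<in> fund" using k(2) by (simp add: fund_def)
    qed
    moreover have "(\<Prod>b\<leftarrow>vs. \<bar>k \<bullet> b\<bar>) = \<bar>\<Prod>b\<leftarrow>vs. k \<bullet> b\<bar>" for vs
      by (induction vs) (simp_all add: abs_mult)
    moreover have "(\<Prod>b\<leftarrow>?vs. k \<bullet> b) = mi_power k \<gamma>"
      using prod_list_axis[OF set_mi_list_axis(1)] by (simp add: count_mi_list[OF inj_axis])
    ultimately show ?thesis
      by (simp add: deriv_mi_def multi_partial_fold)
  qed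
  then show ?thesis
    using k by (intro exI[of _ k] exI[of _ "x - k"]) auto
qed

definition fund_radius :: real where
  "fund_radius = max 1 (\<Sum>i\<in>UNIV. norm (E i))"

lemma mi_power_representative:
  assumes "norm y \<le> (\<Sum>i\<in>UNIV. norm (E i))"
  shows "\<bar>mi_power (y + k) \<beta>\<bar> \<le> 2 ^ mi_size \<beta> * max_power fund_radius k \<beta>"
proof (rule max_power_ge)
  fix i
  have "\<bar>y $ i\<bar> \<le> fund_radius"
    using assms component_le_norm_cart[of y i] by (simp add: fund_radius_def)
  moreover have "fund_radius \<le> max fund_radius \<bar>k $ i\<bar>" "\<bar>k $ i\<bar> \<le> max fund_radius \<bar>k $ i\<bar>"
    by simp_all
  ultimately show "\<bar>(y + k) $ i\<bar> \<le> 2 * max fund_radius \<bar>k $ i\<bar>"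
    unfolding vector_add_component by linarith
qed

text \<open>Derivatives of a smooth function are bounded on the compact set \<open>fund\<close>, and
  this alone yields decay of every order. It lets the inversion formula be proved in the smooth
  class before any Gevrey bound is available.\<close>

lemma zak_inv_schwartz:
  assumes F: "smooth F" "quasi_periodic E F"
  shows "zak_inv F \<in> schwartz"
proof -
  obtain k y where ky: "\<And>x. norm (y x) \<le> (\<Sum>i\<in>UNIV. norm (E i))" "\<And>x. x = y x + k x"
    and bd: "\<And>x \<gamma> \<alpha> B. (\<And>z. z \<in> fund \<Longrightarrow> cmod (deriv_x \<alpha> (deriv_xi \<gamma> F) z) \<le> B) \<Longrightarrow>
      \<bar>mi_power (k x) \<gamma>\<bar> * cmod (deriv_mi \<alpha> (zak_inv F) x) \<le> B"
    using zak_inv_representative[OF F] by metis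
  have "\<exists>C. \<forall>x. cmod (of_real (mi_power x \<beta>) * deriv_mi \<alpha> (zak_inv F) x) \<le> C" for \<alpha> \<beta>
  proof -
    have "\<exists>B. \<forall>x\<in>UNIV. max_power fund_radius (k x) \<beta> * cmod (deriv_mi \<alpha> (zak_inv F) x) \<le> B"
    proof (rule max_power_bound)
      show "fund_radius > 0" by (simp add: fund_radius_def)
    next
      fix \<gamma> :: "'n \<Rightarrow> nat"
      have "smooth (deriv_x \<alpha> (deriv_xi \<gamma> F))"
        unfolding deriv_x_deriv_xi by (intro smooth_fold_partial F) (simp add: set_mi_list_axis)
      then have "bounded (deriv_x \<alpha> (deriv_xi \<gamma> F) ` fund)"
        by (intro compact_imp_bounded compact_continuous_image compact_fund smooth_continuous_on)
      then obtain B where "\<And>z. z \<in> fund \<Longrightarrow> cmod (deriv_x \<alpha> (deriv_xi \<gamma> F) z) \<le> B"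
        unfolding bounded_iff by blast
      then show "\<exists>C. \<forall>x\<in>UNIV. \<bar>mi_power (k x) \<gamma>\<bar> * cmod (deriv_mi \<alpha> (zak_inv F) x) \<le> C"
        using bd by blast
    qed auto
    then obtain B where B: "\<And>x. max_power fund_radius (k x) \<beta> * cmod (deriv_mi \<alpha> (zak_inv F) x) \<le> B"
      by blast
    have "cmod (of_real (mi_power x \<beta>) * deriv_mi \<alpha> (zak_inv F) x) \<le> 2 ^ mi_size \<beta> * B" for x
    proof -
      have "cmod (of_real (mi_power x \<beta>) * deriv_mi \<alpha> (zak_inv F) x)
          \<le> 2 ^ mi_size \<beta> * max_power fund_radius (k x) \<beta> * cmod (deriv_mi \<alpha> (zak_inv F) x)"
        using mi_power_representative[OF ky(1)[of x], of "k x" \<beta>] ky(2)[of x]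
        by (simp add: norm_mult mult_right_mono)
      also have "\<dots> \<le> 2 ^ mi_size \<beta> * B"
        using B[of x] by (simp add: mult.assoc)
      finally show ?thesis .
    qed
    then show ?thesis by blast
  qed
  then show ?thesis
    using smooth_zak_inv[OF F(1)] by (simp add: schwartz_def)
qed

text \<open>The difference of the two sides has zero average. By quasi-periodicity, its product with
  \<open>chr k\<close> is a translate of the difference, so all Fourier coefficients vanish.\<close>

lemma zak_zak_inv:
  assumes F: "smooth F" "quasi_periodic E F"
  shows "zak E (zak_inv F) = F"
proof -
  define H where "H = (\<lambda>z. F z - zak E (zak_inv F) z)"
  note sch = zak_inv_schwartz[OF F]
  have H: "smooth H"
    unfolding H_def by (intro smooth_diff F smooth_zak sch)
  have per: "xi_periodic H"
    using F(2) quasi_periodic_zak[of "zak_inv F"] unfolding H_def quasi_periodic_alt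
    by (simp add: xi_periodic_def)
  have shift: "H (z + (k, 0)) = chr k z * H z" if "k \<in> lattice E" for k z
  proof -
    have "G (z + (k, 0)) = chr k z * G z" if "quasi_periodic E G" for G
      using that \<open>k \<in> lattice E\<close> unfolding quasi_periodic_alt by blast
    from this[OF F(2)] this[OF quasi_periodic_zak] show ?thesis
      by (simp add: H_def right_diff_distrib)
  qed
  have avgH: "avg dirs H = (\<lambda>_. 0)"
  proof
    fix z :: "(real^'n) \<times> (real^'n)"
    obtain x \<xi> where z: "z = (x, 0) + (0, \<xi>)" by (cases z) auto
    have "avg dirs F z = zak_inv F x"
      unfolding z using avg_xi_constant[OF F(1)] F(2) by (simp add: quasi_periodic_alt zak_inv_def del: add_Pair)
    then show "avg dirs H z = 0"
      unfolding H_def by (simp add: avg_diff F smooth_zak sch avg_zak z)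
  qed
  have "H = (\<lambda>_. 0)"
  proof (rule fourier_uniqueness[OF H per])
    fix k assume k: "k \<in> lattice E"
    have "(\<lambda>z. chr k z * H z) = (\<lambda>z. H (z + (k, 0)))"
      by (rule ext) (rule shift[OF k, symmetric])
    then show "avg dirs (\<lambda>z. chr k z * H z) = (\<lambda>_. 0)"
      using avg_translate[of dirs H "(k, 0)"] by (simp add: avgH)
  qed
  then show ?thesis by (simp add: H_def fun_eq_iff)
qed

subsection \<open>Estimates\<close>

text \<open>C is fixed before f and M, so this is an operator bound between steps. The scale picks
  up 2 from |j_i| \<le> 2 * max and 2 powr s from shifting the factorial by 2d.\<close>

lemma zak_gevrey_bounded:
  fixes s \<sigma> h R :: real
  assumes "s > 0" "h > 0"
  shows "\<exists>C>0. \<forall>f M. smooth f \<longrightarrow> M \<ge> 0 \<longrightarrow> gs_bounded s \<sigma> (\<lambda>m. M * h ^ m) f \<longrightarrow>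
    gevrey_bounded \<sigma> s {z. norm (fst z) \<le> R} (\<lambda>m. C * M * (2 * 2 powr s * h) ^ m) (zak E f)"
proof -
  define r where "r = max 1 R"
  have r: "r \<ge> 1" "r > 0" by (auto simp: r_def)
  define d where "d = CARD('n)"
  \<comment> \<open>The rate is h itself, so that small coordinates contribute powers of h like the
    large ones and cause no further loss of scale.\<close>
  obtain C1 where C1: "C1 \<ge> 1" "\<And>\<alpha> :: 'n \<Rightarrow> nat. r ^ mi_size \<alpha> \<le> C1 * h ^ mi_size \<alpha> * mi_fact \<alpha> powr s"
    using power_mi_size_le[OF r(2) assms(2,1)] by blast
  obtain C2 where C2: "C2 \<ge> 1" "\<And>\<beta> :: 'n \<Rightarrow> nat.
      mi_fact (\<lambda>i. \<beta> i + 2 * d) powr s \<le> C2 * (2 powr s) ^ mi_size \<beta> * mi_fact \<beta> powr s"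
    using mi_fact_shift[OF assms(1)] by blast
  define \<Omega> where "\<Omega> = infsum lat_weight (lattice E)"
  define C where "C = lat_const * (C1 * C2 * h ^ (2 * d * d)) * (\<Omega> + 1)"
  have \<Omega>: "\<Omega> \<ge> 0"
    unfolding \<Omega>_def by (intro infsum_nonneg) (simp add: lat_weight_pos less_imp_le)
  have "C > 0"
    unfolding C_def using lat_const_ge C1(1) C2(1) assms(2) \<Omega> by (intro mult_pos_pos) auto
  moreover have "gevrey_bounded \<sigma> s {z. norm (fst z) \<le> R} (\<lambda>m. C * M * (2 * 2 powr s * h) ^ m) (zak E f)"
    if f: "smooth f" and M: "M \<ge> 0" and bd: "gs_bounded s \<sigma> (\<lambda>m. M * h ^ m) f" for f M
    unfolding gevrey_bounded_def
  proof (intro allI ballI)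
    fix \<alpha> \<beta> :: "'n \<Rightarrow> nat" and z :: "(real^'n) \<times> (real^'n)" assume "z \<in> {z. norm (fst z) \<le> R}"
    then have z: "norm (fst z) \<le> r" by (simp add: r_def)
    let ?vs = "mi_list (\<lambda>i. (0, axis i 1)) \<beta> @ mi_list (\<lambda>i. (axis i 1, 0)) \<alpha> :: ((real^'n) \<times> (real^'n)) list"
    have vs: "set ?vs \<subseteq> Basis" by (simp add: set_mi_list_axis)
    define N where "N = mi_size \<alpha> + mi_size \<beta>"
    define Q where "Q = mi_fact \<alpha> powr \<sigma> * mi_fact \<beta> powr s"
    define B where "B = C1 * C2 * h ^ (2 * d * d) * M * (2 powr s) ^ mi_size \<beta> * h ^ N * Q"
    \<comment> \<open>A shift by 2d in each of d coordinates raises the order by 2 * d * d, a fixed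
      power of h that goes into C.\<close>
    have sz: "mi_size (\<lambda>i::'n. \<beta> i + 2 * d) = mi_size \<beta> + 2 * d * d"
      by (simp add: mi_size_def sum.distrib d_def)
    have maxp: "max_power r y (\<lambda>i. \<beta> i + 2 * d) * cmod (deriv_mi \<alpha> f y) \<le> B" for y
    proof -
      obtain \<gamma> \<delta> :: "'n \<Rightarrow> nat" where gd: "max_power r y (\<lambda>i. \<beta> i + 2 * d) = \<bar>mi_power y \<gamma>\<bar> * r ^ mi_size \<delta>"
        "mi_size (\<lambda>i. \<beta> i + 2 * d) = mi_size \<gamma> + mi_size \<delta>"
        "mi_fact (\<lambda>i. \<beta> i + 2 * d) = mi_fact \<gamma> * mi_fact \<delta>"
        by (rule max_power_split[OF r(2), of y "\<lambda>i. \<beta> i + 2 * d"]) blast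
      have "max_power r y (\<lambda>i. \<beta> i + 2 * d) * cmod (deriv_mi \<alpha> f y)
          = r ^ mi_size \<delta> * cmod (of_real (mi_power y \<gamma>) * deriv_mi \<alpha> f y)"
        unfolding gd(1) by (simp add: norm_mult mult_ac)
      also have "\<dots> \<le> (C1 * h ^ mi_size \<delta> * mi_fact \<delta> powr s)
          * (M * h ^ (mi_size \<gamma> + mi_size \<alpha>) * (mi_fact \<gamma> powr s * mi_fact \<alpha> powr \<sigma>))"
        using C1 bd assms r by (intro mult_mono) (auto simp: gs_bounded_def)
      also have "\<dots> = C1 * M * h ^ (mi_size (\<lambda>i. \<beta> i + 2 * d) + mi_size \<alpha>)
          * (mi_fact (\<lambda>i. \<beta> i + 2 * d) powr s) * mi_fact \<alpha> powr \<sigma>"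
        unfolding gd(2,3) by (simp add: powr_mult power_add mult_ac)
      also have "\<dots> \<le> C1 * M * h ^ (mi_size (\<lambda>i. \<beta> i + 2 * d) + mi_size \<alpha>)
          * (C2 * (2 powr s) ^ mi_size \<beta> * mi_fact \<beta> powr s) * mi_fact \<alpha> powr \<sigma>"
        using C1(1) M assms by (intro mult_right_mono mult_left_mono C2) auto
      also have "\<dots> = B"
        unfolding sz B_def N_def Q_def by (simp add: power_add mult_ac)
      finally show ?thesis .
    qed
    have "cmod (fold partial ?vs (zak_term f j) z) \<le> (2 ^ mi_size \<beta> * lat_const * B) * lat_weight j" for j
      using zak_term_bound[OF f vs r(1) z, of B j] maxp by (simp add: dirs_mi_list d_def)
    then have "cmod (fold partial ?vs (zak E f) z) \<le> (2 ^ mi_size \<beta> * lat_const * B) * \<Omega>"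
      unfolding \<Omega>_def by (intro zak_derivative_bound gs_bounded_schwartz[OF f bd] vs)
    \<comment> \<open>The losses involve only the order in \<xi>; they are enlarged to the total
      order N since the weight depends on N alone. Using \<Omega> + 1 keeps C positive.\<close>
    also have "\<dots> \<le> (2 ^ N * lat_const * (C1 * C2 * h ^ (2 * d * d) * M * (2 powr s) ^ N * h ^ N * Q)) * (\<Omega> + 1)"
    proof -
      have B0: "B \<ge> 0"
        using C1 C2 assms M by (auto simp: B_def Q_def)
      have "(2 powr s) ^ mi_size \<beta> \<le> (2 powr s) ^ N"
        using assms(1) by (intro power_increasing ge_one_powr_ge_zero) (auto simp: N_def)
      then have "B \<le> C1 * C2 * h ^ (2 * d * d) * M * (2 powr s) ^ N * h ^ N * Q"
        unfolding B_def using C1 C2 assms M by (intro mult_right_mono mult_left_mono) (auto simp: Q_def)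
      moreover have "(2::real) ^ mi_size \<beta> \<le> 2 ^ N"
        by (intro power_increasing) (auto simp: N_def)
      ultimately show ?thesis
        using lat_const_ge B0 \<Omega> by (intro mult_mono) auto
    qed
    also have "\<dots> = C * M * (2 * 2 powr s * h) ^ N * Q"
      by (simp add: C_def power_mult_distrib mult_ac)
    finally show "cmod (deriv_x \<alpha> (deriv_xi \<beta> (zak E f)) z)
        \<le> C * M * (2 * 2 powr s * h) ^ (mi_size \<alpha> + mi_size \<beta>) * (mi_fact \<alpha> powr \<sigma> * mi_fact \<beta> powr s)"
      by (simp only: deriv_x_deriv_xi N_def Q_def)
  qed
  ultimately show ?thesis by blast
qed

text \<open>Splitting \<beta> into \<gamma> and \<delta>, the large coordinates of k are paid for by
  \<xi>-derivatives of order \<gamma> and the small ones by C * \<epsilon>^|\<delta>| * \<delta>!^s.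
  The order seen by the weight thus rises from |\<alpha>| + |\<gamma>| to |\<alpha>| + |\<beta>|,
  which is what the growth condition on W permits. It holds with \<epsilon> = h for W m = M * h^m,
  and with \<epsilon> = 1 for increasing W.\<close>

lemma zak_inv_gs_bounded:
  fixes s \<sigma> \<epsilon> :: real
  assumes "s > 0" "\<epsilon> > 0"
  shows "\<exists>C>0. \<forall>F W. smooth F \<longrightarrow> quasi_periodic E F \<longrightarrow> (\<forall>m. W m \<ge> 0) \<longrightarrow>
    (\<forall>l n. W l * \<epsilon> ^ n \<le> W (l + n)) \<longrightarrow> gevrey_bounded \<sigma> s fund W F \<longrightarrow>
    gs_bounded s \<sigma> (\<lambda>m. C * 2 ^ m * W m) (zak_inv F)"
proof -
  have r: "fund_radius > 0" by (simp add: fund_radius_def)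
  obtain C where C: "C \<ge> 1" "\<And>\<alpha> :: 'n \<Rightarrow> nat. fund_radius ^ mi_size \<alpha> \<le> C * \<epsilon> ^ mi_size \<alpha> * mi_fact \<alpha> powr s"
    using power_mi_size_le[OF r assms(2,1)] by blast
  have "gs_bounded s \<sigma> (\<lambda>m. C * 2 ^ m * W m) (zak_inv F)"
    if F: "smooth F" "quasi_periodic E F" and W: "\<And>m. W m \<ge> 0" "\<And>l n. W l * \<epsilon> ^ n \<le> W (l + n)"
      and bd: "gevrey_bounded \<sigma> s fund W F" for F W
    unfolding gs_bounded_def
  proof (intro allI)
    fix \<beta> \<alpha> :: "'n \<Rightarrow> nat" and x :: "real^'n"
    obtain k y where ky: "norm y \<le> (\<Sum>i\<in>UNIV. norm (E i))" "x = y + k"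
      and k: "\<And>\<gamma> \<alpha> B. (\<And>z. z \<in> fund \<Longrightarrow> cmod (deriv_x \<alpha> (deriv_xi \<gamma> F) z) \<le> B) \<Longrightarrow>
        \<bar>mi_power k \<gamma>\<bar> * cmod (deriv_mi \<alpha> (zak_inv F) x) \<le> B"
      using zak_inv_representative[OF F, of x] by metis
    obtain \<gamma> \<delta> :: "'n \<Rightarrow> nat" where gd: "max_power fund_radius k \<beta> = \<bar>mi_power k \<gamma>\<bar> * fund_radius ^ mi_size \<delta>"
      "mi_size \<beta> = mi_size \<gamma> + mi_size \<delta>" "mi_fact \<beta> = mi_fact \<gamma> * mi_fact \<delta>"
      by (rule max_power_split[OF r, of k \<beta>]) blast
    let ?D = "cmod (deriv_mi \<alpha> (zak_inv F) x)"
    have "cmod (of_real (mi_power x \<beta>) * deriv_mi \<alpha> (zak_inv F) x)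
        \<le> 2 ^ mi_size \<beta> * max_power fund_radius k \<beta> * ?D"
      using mi_power_representative[OF ky(1), of k \<beta>] by (simp add: norm_mult mult_right_mono ky(2))
    also have "\<dots> = 2 ^ mi_size \<beta> * (fund_radius ^ mi_size \<delta> * (\<bar>mi_power k \<gamma>\<bar> * ?D))"
      unfolding gd(1) by (simp add: mult_ac)
    also have "\<dots> \<le> 2 ^ mi_size \<beta> * ((C * \<epsilon> ^ mi_size \<delta> * mi_fact \<delta> powr s)
        * (W (mi_size \<alpha> + mi_size \<gamma>) * (mi_fact \<alpha> powr \<sigma> * mi_fact \<gamma> powr s)))"
      using C r bd assms(2) by (intro mult_left_mono mult_mono k) (auto simp: gevrey_bounded_def)
    also have "\<dots> = 2 ^ mi_size \<beta> * C * (W (mi_size \<alpha> + mi_size \<gamma>) * \<epsilon> ^ mi_size \<delta>)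
        * (mi_fact \<beta> powr s * mi_fact \<alpha> powr \<sigma>)"
      unfolding gd(3) by (simp add: powr_mult mult_ac)
    also have "\<dots> \<le> 2 ^ (mi_size \<beta> + mi_size \<alpha>) * C * W (mi_size \<beta> + mi_size \<alpha>)
        * (mi_fact \<beta> powr s * mi_fact \<alpha> powr \<sigma>)"
    proof (rule mult_right_mono[OF mult_mono])
      show "W (mi_size \<alpha> + mi_size \<gamma>) * \<epsilon> ^ mi_size \<delta> \<le> W (mi_size \<beta> + mi_size \<alpha>)"
        using W(2)[of "mi_size \<alpha> + mi_size \<gamma>" "mi_size \<delta>"] by (simp add: gd(2) ac_simps)
    qed (use C assms(2) W(1) in \<open>auto intro!: mult_right_mono power_increasing\<close>)
    finally show "cmod (of_real (mi_power x \<beta>) * deriv_mi \<alpha> (zak_inv F) x)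
        \<le> C * 2 ^ (mi_size \<beta> + mi_size \<alpha>) * W (mi_size \<beta> + mi_size \<alpha>) * (mi_fact \<beta> powr s * mi_fact \<alpha> powr \<sigma>)"
      by (simp add: mult_ac)
  qed
  then show ?thesis using C(1) by (intro exI[of _ C]) auto
qed

end

subsection \<open>Topologies defined by seminorms\<close>

text \<open>Extended seminorms, finite only on a subspace; the one inequality packages the triangle
  inequality and the bound for scalar multiples.\<close>

definition seminorm_on :: "('a \<Rightarrow> complex) set \<Rightarrow> (('a \<Rightarrow> complex) \<Rightarrow> ennreal) \<Rightarrow> bool" where
  "seminorm_on X p \<longleftrightarrow> (\<lambda>_. 0) \<in> X \<and> p (\<lambda>_. 0) = 0 \<and>
    (\<forall>f\<in>X. \<forall>g\<in>X. \<forall>a b. (\<lambda>x. a * f x + b * g x) \<in> X \<and>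
       p (\<lambda>x. a * f x + b * g x) \<le> ennreal (cmod a) * p f + ennreal (cmod b) * p g)"

lemma seminorm_onD:
  assumes "seminorm_on X p"
  shows "(\<lambda>_. 0) \<in> X" "p (\<lambda>_. 0) = 0"
    and "f \<in> X \<Longrightarrow> g \<in> X \<Longrightarrow> (\<lambda>x. a * f x + b * g x) \<in> X"
    and "f \<in> X \<Longrightarrow> g \<in> X \<Longrightarrow>
      p (\<lambda>x. a * f x + b * g x) \<le> ennreal (cmod a) * p f + ennreal (cmod b) * p g"
    and "f \<in> X \<Longrightarrow> g \<in> X \<Longrightarrow> (\<lambda>x. f x - g x) \<in> X"
    and "f \<in> X \<Longrightarrow> g \<in> X \<Longrightarrow> p (\<lambda>x. f x - g x) \<le> p f + p g"
    and "f \<in> X \<Longrightarrow> g \<in> X \<Longrightarrow> p (\<lambda>x. f x + g x) \<le> p f + p g"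
proof -
  have *: "(\<lambda>x. a * f x + b * g x) \<in> X"
    "p (\<lambda>x. a * f x + b * g x) \<le> ennreal (cmod a) * p f + ennreal (cmod b) * p g"
    if "f \<in> X" "g \<in> X" for f g a b
    using assms that by (auto simp: seminorm_on_def)
  show "(\<lambda>_. 0) \<in> X" "p (\<lambda>_. 0) = 0"
    using assms by (auto simp: seminorm_on_def)
  show "f \<in> X \<Longrightarrow> g \<in> X \<Longrightarrow> (\<lambda>x. a * f x + b * g x) \<in> X"
    and "f \<in> X \<Longrightarrow> g \<in> X \<Longrightarrow> p (\<lambda>x. a * f x + b * g x) \<le> ennreal (cmod a) * p f + ennreal (cmod b) * p g"
    by (auto intro: *)
  show "f \<in> X \<Longrightarrow> g \<in> X \<Longrightarrow> (\<lambda>x. f x - g x) \<in> X"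
    and "f \<in> X \<Longrightarrow> g \<in> X \<Longrightarrow> p (\<lambda>x. f x - g x) \<le> p f + p g"
    using *[of f g 1 "- 1"] by auto
  show "f \<in> X \<Longrightarrow> g \<in> X \<Longrightarrow> p (\<lambda>x. f x + g x) \<le> p f + p g"
    using *(2)[of f g 1 1] by auto
qed

text \<open>Suprema of weighted moduli of linear functionals: \<open>upper\<close> and
  \<open>least\<close> say that p is the supremum over I. The Gelfand-Shilov norms and the weighted
  Gevrey norms are both of this kind.\<close>

lemma seminorm_onI:
  assumes "(\<lambda>_. 0) \<in> X" "\<And>f g a b. f \<in> X \<Longrightarrow> g \<in> X \<Longrightarrow> (\<lambda>x. a * f x + b * g x) \<in> X"
    and lin: "\<And>i f g a b. i \<in> I \<Longrightarrow> f \<in> X \<Longrightarrow> g \<in> X \<Longrightarrow> L i (\<lambda>x. a * f x + b * g x) = a * L i f + b * L i g"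
    and w: "\<And>i. i \<in> I \<Longrightarrow> w i \<ge> 0"
    and upper: "\<And>i f. i \<in> I \<Longrightarrow> ennreal (cmod (L i f) / w i) \<le> p f"
    and least: "\<And>f c. (\<And>i. i \<in> I \<Longrightarrow> ennreal (cmod (L i f) / w i) \<le> c) \<Longrightarrow> p f \<le> c"
  shows "seminorm_on X p"
proof -
  have "p (\<lambda>x. a * f x + b * g x) \<le> ennreal (cmod a) * p f + ennreal (cmod b) * p g"
    if fg: "f \<in> X" "g \<in> X" for f g a b
  proof (rule least)
    fix i assume i: "i \<in> I"
    have "cmod (L i (\<lambda>x. a * f x + b * g x)) \<le> cmod a * cmod (L i f) + cmod b * cmod (L i g)"
      unfolding lin[OF i fg] by (rule order_trans[OF norm_triangle_ineq]) (simp add: norm_mult)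
    then have "cmod (L i (\<lambda>x. a * f x + b * g x)) / w i \<le> cmod a * (cmod (L i f) / w i) + cmod b * (cmod (L i g) / w i)"
      using w[OF i] divide_right_mono by (fastforce simp: add_divide_distrib)
    then have "ennreal (cmod (L i (\<lambda>x. a * f x + b * g x)) / w i)
        \<le> ennreal (cmod a * (cmod (L i f) / w i) + cmod b * (cmod (L i g) / w i))"
      by (rule ennreal_leI)
    also have "\<dots> = ennreal (cmod a) * ennreal (cmod (L i f) / w i) + ennreal (cmod b) * ennreal (cmod (L i g) / w i)"
      using w[OF i] by (simp add: ennreal_plus ennreal_mult del: times_divide_eq_right)
    also have "\<dots> \<le> ennreal (cmod a) * p f + ennreal (cmod b) * p g"
      by (intro add_mono mult_left_mono upper i) auto
    finally show "ennreal (cmod (L i (\<lambda>x. a * f x + b * g x)) / w i) \<le> ennreal (cmod a) * p f + ennreal (cmod b) * p g" .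
  qed
  moreover have "p (\<lambda>_. 0) \<le> 0"
    by (rule least) (use lin[OF _ assms(1,1), of _ 0 0] in simp)
  ultimately show ?thesis
    using assms(1,2) by (auto simp: seminorm_on_def)
qed

lemma ennreal_gap:
  assumes "a < (r::ennreal)"
  shows "\<exists>\<epsilon>>0. a + ennreal \<epsilon> \<le> r"
proof (cases "r = \<infinity>")
  case True
  then show ?thesis by (intro exI[of _ 1]) auto
next
  case False
  then obtain a' r' where "a = ennreal a'" "r = ennreal r'" "0 \<le> a'" "0 \<le> r'"
    using assms by (metis ennreal_cases infinity_ennreal_def less_top_ennreal top.extremum_strict)
  then show ?thesis
    using assms by (intro exI[of _ "r' - a'"]) (auto simp: ennreal_less_iff simp flip: ennreal_plus)
qed

lemma less_imp_neq_top: "a < b \<Longrightarrow> a \<noteq> (top :: ennreal)"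
  by auto

lemma openin_seminorm_ball:
  assumes p: "seminorm_on X p" and f: "f \<in> X"
  shows "openin (seminorm_topology X p) {g \<in> X. p g < \<infinity> \<and> p (\<lambda>x. g x - f x) < r}"
  unfolding openin_seminorm_topology
proof (intro conjI ballI)
  show "{g \<in> X. p g < \<infinity> \<and> p (\<lambda>x. g x - f x) < r} \<subseteq> {f \<in> X. p f < \<infinity>}" by auto
  fix g assume g: "g \<in> {g \<in> X. p g < \<infinity> \<and> p (\<lambda>x. g x - f x) < r}"
  then obtain \<epsilon> where e: "\<epsilon> > 0" "p (\<lambda>x. g x - f x) + ennreal \<epsilon> \<le> r"
    using ennreal_gap by blast
  have "p (\<lambda>x. g' x - f x) < r" if g': "g' \<in> X" "p (\<lambda>x. g' x - g x) < ennreal \<epsilon>" for g'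
  proof -
    have "p (\<lambda>x. g' x - f x) = p (\<lambda>x. (g x - f x) + (g' x - g x))"
      by (simp add: algebra_simps)
    also have "\<dots> \<le> p (\<lambda>x. g x - f x) + p (\<lambda>x. g' x - g x)"
      using g g' f by (intro seminorm_onD(7)[OF p] seminorm_onD(5)[OF p]) auto
    also have "\<dots> < p (\<lambda>x. g x - f x) + ennreal \<epsilon>"
      using g g' by (intro ennreal_add_left_cancel_less[THEN iffD2]) (auto dest: less_imp_neq_top)
    finally show ?thesis using e(2) by order
  qed
  then show "\<exists>\<epsilon>>0. {g' \<in> X. p g' < \<infinity> \<and> p (\<lambda>x. g' x - g x) < ennreal \<epsilon>}
      \<subseteq> {g \<in> X. p g < \<infinity> \<and> p (\<lambda>x. g x - f x) < r}"
    using e(1) by blast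
qed

lemma seminorm_zero_neighbourhood:
  assumes "openin (seminorm_topology X p) V" "(\<lambda>_. 0) \<in> V"
  shows "\<exists>\<epsilon>>0. {g \<in> X. p g < ennreal \<epsilon>} \<subseteq> V"
proof -
  have "\<forall>f\<in>V. \<exists>\<epsilon>>0. {g \<in> X. p g < \<infinity> \<and> p (\<lambda>x. g x - f x) < ennreal \<epsilon>} \<subseteq> V"
    using assms(1) by (simp add: openin_seminorm_topology)
  from bspec[OF this assms(2)]
  obtain \<epsilon> where "\<epsilon> > 0" "{g \<in> X. p g < \<infinity> \<and> p (\<lambda>x. g x - 0) < ennreal \<epsilon>} \<subseteq> V" by blast
  moreover have "p g < \<infinity>" if "p g < ennreal \<epsilon>" for g
    using that by (auto intro: order_less_trans)
  ultimately show ?thesis by (intro exI[of _ \<epsilon>]) auto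
qed

lemma ennreal_mult_less_ball:
  assumes "C > 0" "q \<le> ennreal C * p" "p < ennreal (\<epsilon> / C)"
  shows "q < ennreal \<epsilon>"
proof -
  have "ennreal C * p < ennreal C * ennreal (\<epsilon> / C)"
    using assms by (intro ennreal_mult_strict_left_mono) auto
  also have "\<dots> = ennreal \<epsilon>"
    using assms(1) by (simp flip: ennreal_mult')
  finally show ?thesis using assms(2) by order
qed

text \<open>The restriction to \<open>D\<close> admits maps such as \<open>zak_inv\<close>, which is
  estimated only on smooth quasi-periodic functions while the seminorm lives on all functions smooth
  near a compact set.\<close>

lemma continuous_map_seminorm:
  assumes p: "seminorm_on X p"
    and D: "D \<subseteq> {f \<in> X. p f < \<infinity>}"
    and T: "\<And>f. f \<in> D \<Longrightarrow> T f \<in> Y \<and> q (T f) < \<infinity>"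
    and C: "C > 0" "\<And>f g. f \<in> D \<Longrightarrow> g \<in> D \<Longrightarrow> q (\<lambda>x. T g x - T f x) \<le> ennreal C * p (\<lambda>x. g x - f x)"
  shows "continuous_map (subtopology (seminorm_topology X p) D) (seminorm_topology Y q) T"
  unfolding continuous_map
proof (intro conjI allI impI)
  show "T ` topspace (subtopology (seminorm_topology X p) D) \<subseteq> topspace (seminorm_topology Y q)"
    using T by (auto simp: topspace_seminorm_topology)
  fix V assume V: "openin (seminorm_topology Y q) V"
  have D': "topspace (subtopology (seminorm_topology X p) D) = D"
    using D by (auto simp: topspace_seminorm_topology)
  show "openin (subtopology (seminorm_topology X p) D) {x \<in> topspace (subtopology (seminorm_topology X p) D). T x \<in> V}"
    unfolding D'
  proof (subst openin_subopen, intro ballI)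
    fix f assume f: "f \<in> {x \<in> D. T x \<in> V}"
    then obtain \<epsilon> where e: "\<epsilon> > 0" "{g \<in> Y. q g < \<infinity> \<and> q (\<lambda>x. g x - T f x) < ennreal \<epsilon>} \<subseteq> V"
      using V unfolding openin_seminorm_topology by blast
    let ?B = "{g \<in> X. p g < \<infinity> \<and> p (\<lambda>x. g x - f x) < ennreal (\<epsilon> / C)}"
    have "openin (subtopology (seminorm_topology X p) D) (?B \<inter> D)"
      using f D by (intro openin_subtopology_Int openin_seminorm_ball p) auto
    moreover have "p (\<lambda>x. f x - f x) = 0"
      using seminorm_onD(2)[OF p] by simp
    then have "f \<in> ?B \<inter> D"
      using f D e(1) C(1) by auto
    moreover have "T g \<in> V" if "g \<in> ?B \<inter> D" for g
      using that f T e(2) ennreal_mult_less_ball[OF C(1) C(2)[of f g]] by auto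
    ultimately show "\<exists>U. openin (subtopology (seminorm_topology X p) D) U \<and> f \<in> U \<and> U \<subseteq> {x \<in> D. T x \<in> V}"
      by blast
  qed
qed

section \<open>Universal property of projective limits\<close>

lemma continuous_map_projective_limit:
  assumes "I \<noteq> {}" "\<And>i. i \<in> I \<Longrightarrow> continuous_map S (T i) g"
  shows "continuous_map S (projective_limit I T) g"
  unfolding projective_limit_def
proof (rule continuous_map_into_subtopology)
  show "continuous_map S (topology_generated_by (\<Union>i\<in>I. {V. openin (T i) V})) g"
  proof (rule continuous_on_generated_topo)
    fix U assume "U \<in> (\<Union>i\<in>I. {V. openin (T i) V})"
    then obtain i where i: "i \<in> I" "openin (T i) U" by blast
    have "openin S {x \<in> topspace S. g x \<in> U}"
      using assms(2)[OF i(1)] i(2) by (simp add: continuous_map)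
    moreover have "g -` U \<inter> topspace S = {x \<in> topspace S. g x \<in> U}" by blast
    ultimately show "openin S (g -` U \<inter> topspace S)" by simp
  next
    obtain i where i: "i \<in> I" using assms(1) by blast
    then show "g ` topspace S \<subseteq> \<Union> (\<Union>i\<in>I. {V. openin (T i) V})"
      using continuous_map_image_subset_topspace[OF assms(2)[OF i]] openin_topspace[of "T i"] by blast
  qed
  show "g \<in> topspace S \<rightarrow> (\<Inter>i\<in>I. topspace (T i))"
    using assms(2) continuous_map_image_subset_topspace by fastforce
qed

lemma continuous_map_from_projective_limit:
  assumes "i \<in> I"
  shows "continuous_map (projective_limit I T) (T i) id"
  unfolding continuous_map
proof (intro conjI allI impI)
  show "id ` topspace (projective_limit I T) \<subseteq> topspace (T i)"
    using assms topspace_projective_limit[of I T] by auto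
  fix V assume V: "openin (T i) V"
  have "openin (topology_generated_by (\<Union>i\<in>I. {V. openin (T i) V})) V"
    by (rule topology_generated_by_Basis) (use assms V in blast)
  then have "openin (projective_limit I T) (V \<inter> (\<Inter>i\<in>I. topspace (T i)))"
    unfolding projective_limit_def by (rule openin_subtopology_Int)
  moreover have "{x \<in> topspace (projective_limit I T). id x \<in> V} = V \<inter> (\<Inter>i\<in>I. topspace (T i))"
    using topspace_projective_limit[of I T] assms by auto
  ultimately show "openin (projective_limit I T) {x \<in> topspace (projective_limit I T). id x \<in> V}"
    by simp
qed

section \<open>Continuity and open balls in inductive limits\<close>

lemma abs_convex_seminorm_ball:
  assumes p: "seminorm_on X p"
  shows "abs_convex {g \<in> X. p g < ennreal \<epsilon>}"
  unfolding abs_convex_def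
proof (intro ballI allI impI)
  fix f g and a b :: complex
  assume fg: "f \<in> {g \<in> X. p g < ennreal \<epsilon>}" "g \<in> {g \<in> X. p g < ennreal \<epsilon>}" and ab: "cmod a + cmod b \<le> 1"
  have "p (\<lambda>x. a * f x + b * g x) \<le> ennreal (cmod a) * p f + ennreal (cmod b) * p g"
    using fg by (intro seminorm_onD(4)[OF p]) auto
  also have "\<dots> \<le> ennreal (cmod a) * max (p f) (p g) + ennreal (cmod b) * max (p f) (p g)"
    by (intro add_mono mult_left_mono) auto
  also have "\<dots> = ennreal (cmod a + cmod b) * max (p f) (p g)"
    by (simp add: ennreal_plus distrib_right)
  also have "ennreal (cmod a + cmod b) * max (p f) (p g) \<le> 1 * max (p f) (p g)"
    using ennreal_leI[OF ab] by (intro mult_right_mono) (auto simp del: ennreal_plus)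
  also have "\<dots> < ennreal \<epsilon>" using fg by simp
  finally show "(\<lambda>x. a * f x + b * g x) \<in> {g \<in> X. p g < ennreal \<epsilon>}"
    using fg seminorm_onD(3)[OF p] by auto
qed

text \<open>The preimage of an absolutely convex neighbourhood under a linear map is absolutely
  convex, and the bound from one step into some step makes it a neighbourhood in each step.
  Monotonicity in h enters only to make the union of the steps a vector space.\<close>

lemma continuous_map_inductive_limit:
  fixes p :: "real \<Rightarrow> ('a \<Rightarrow> complex) \<Rightarrow> ennreal" and q :: "real \<Rightarrow> ('b \<Rightarrow> complex) \<Rightarrow> ennreal"
  assumes p: "\<And>h. h > 0 \<Longrightarrow> seminorm_on X (p h)" and q: "\<And>h. h > 0 \<Longrightarrow> seminorm_on Y (q h)"
    and mono: "\<And>h h' f. 0 < h \<Longrightarrow> h \<le> h' \<Longrightarrow> p h' f \<le> p h f"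
    and lin: "\<And>f g a b. f \<in> (\<Union>h\<in>{0<..}. {f \<in> X. p h f < \<infinity>}) \<Longrightarrow> g \<in> (\<Union>h\<in>{0<..}. {f \<in> X. p h f < \<infinity>}) \<Longrightarrow>
      T (\<lambda>x. a * f x + b * g x) = (\<lambda>x. a * T f x + b * T g x)"
    and bd: "\<And>h. h > 0 \<Longrightarrow> \<exists>h'>0. \<exists>C>0. \<forall>f\<in>X. p h f < \<infinity> \<longrightarrow> T f \<in> Y \<and> q h' (T f) \<le> ennreal C * p h f"
  shows "continuous_map (inductive_limit {0<..} (\<lambda>h. seminorm_topology X (p h)))
    (inductive_limit {0<..} (\<lambda>h. seminorm_topology Y (q h))) T"
proof -
  define D where "D = (\<Union>h\<in>{0<..}. {f \<in> X. p h f < \<infinity>})"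
  define D' where "D' = (\<Union>h\<in>{0<..}. {f \<in> Y. q h f < \<infinity>})"
  have top: "topspace (inductive_limit {0<..} (\<lambda>h. seminorm_topology X (p h))) = D"
    by (subst topspace_inductive_limit)
      (auto simp: topspace_seminorm_topology D_def seminorm_onD(1,2)[OF p])
  have top': "topspace (inductive_limit {0<..} (\<lambda>h. seminorm_topology Y (q h))) = D'"
    by (subst topspace_inductive_limit)
      (auto simp: topspace_seminorm_topology D'_def seminorm_onD(1,2)[OF q])
  have Dcomb: "(\<lambda>x. a * f x + b * g x) \<in> D" if fg: "f \<in> D" "g \<in> D" for f g a b
  proof -
    obtain h h' where h: "h > 0" "f \<in> X" "p h f < \<infinity>" "h' > 0" "g \<in> X" "p h' g < \<infinity>"
      using fg by (auto simp: D_def)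
    let ?h = "max h h'"
    have fin: "p ?h f < \<infinity>" "p ?h g < \<infinity>"
      using mono[of h ?h f] mono[of h' ?h g] h by (auto intro: order_le_less_trans)
    have "p ?h (\<lambda>x. a * f x + b * g x) \<le> ennreal (cmod a) * p ?h f + ennreal (cmod b) * p ?h g"
      using h by (intro seminorm_onD(4)[OF p]) auto
    also have "\<dots> < \<infinity>" using fin by (simp add: ennreal_mult_less_top)
    finally show ?thesis
      unfolding D_def using h seminorm_onD(3)[OF p[of ?h]] by (intro UN_I[of ?h]) auto
  qed
  have TD: "T f \<in> D'" if f: "f \<in> D" for f
  proof -
    obtain h where h: "h > 0" "f \<in> X" "p h f < \<infinity>" using f by (auto simp: D_def)
    then obtain h' C where "h' > 0" "C > 0" "T f \<in> Y" "q h' (T f) \<le> ennreal C * p h f"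
      using bd[OF h(1)] by blast
    moreover from this h have "q h' (T f) < \<infinity>"
      by (auto simp: ennreal_mult_less_top intro: order_le_less_trans)
    ultimately show ?thesis by (auto simp: D'_def)
  qed
  show ?thesis
    unfolding continuous_map top top'
  proof (intro conjI allI impI)
    show "T ` D \<subseteq> D'" using TD by blast
    fix W assume W: "openin (inductive_limit {0<..} (\<lambda>h. seminorm_topology Y (q h))) W"
    show "openin (inductive_limit {0<..} (\<lambda>h. seminorm_topology X (p h))) {f \<in> D. T f \<in> W}"
      unfolding openin_inductive_limit topspace_seminorm_topology D_def[symmetric]
    proof (intro conjI ballI)
      show "{f \<in> D. T f \<in> W} \<subseteq> D" by blast
      fix f assume f: "f \<in> {f \<in> D. T f \<in> W}"
      then obtain U where U: "abs_convex U"
        "\<And>h. h > 0 \<Longrightarrow> \<exists>V. openin (seminorm_topology Y (q h)) V \<and> (\<lambda>_. 0) \<in> V \<and> V \<subseteq> U"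
        "{g \<in> D'. (\<lambda>x. g x - T f x) \<in> U} \<subseteq> W"
        using W unfolding openin_inductive_limit topspace_seminorm_topology D'_def[symmetric] by fastforce
      let ?U = "{g \<in> D. T g \<in> U}"
      show "\<exists>U. abs_convex U \<and> (\<forall>i\<in>{0<..}. \<exists>V. openin (seminorm_topology X (p i)) V \<and> (\<lambda>_. 0) \<in> V \<and> V \<subseteq> U)
          \<and> {g \<in> D. (\<lambda>x. g x - f x) \<in> U} \<subseteq> {f \<in> D. T f \<in> W}"
      proof (rule exI[of _ ?U], intro conjI ballI)
        show "abs_convex ?U"
          using U(1) Dcomb lin unfolding abs_convex_def D_def[symmetric] by simp
      next
        fix h :: real assume "h \<in> {0<..}"
        then have h: "h > 0" by simp
        obtain h' C where h': "h' > 0" "C > 0" "\<And>f. f \<in> X \<Longrightarrow> p h f < \<infinity> \<Longrightarrow> T f \<in> Y \<and> q h' (T f) \<le> ennreal C * p h f"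
          using bd[OF h] by blast
        obtain V where V: "openin (seminorm_topology Y (q h')) V" "(\<lambda>_. 0) \<in> V" "V \<subseteq> U" using U(2)[OF h'(1)] by blast
        obtain \<epsilon> where e: "\<epsilon> > 0" "{g \<in> Y. q h' g < ennreal \<epsilon>} \<subseteq> U"
          using seminorm_zero_neighbourhood[OF V(1,2)] V(3) by blast
        let ?V = "{g \<in> X. p h g < \<infinity> \<and> p h (\<lambda>x. g x - 0) < ennreal (\<epsilon> / C)}"
        have "openin (seminorm_topology X (p h)) ?V"
          by (rule openin_seminorm_ball[OF p[OF h] seminorm_onD(1)[OF p[OF h]]])
        moreover have "(\<lambda>_. 0) \<in> ?V"
          using seminorm_onD(1,2)[OF p[OF h]] e(1) h'(2) by simp
        moreover have "?V \<subseteq> ?U"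
        proof
          fix g assume g: "g \<in> ?V"
          then have gX: "g \<in> X" "p h g < \<infinity>" "p h g < ennreal (\<epsilon> / C)" by simp_all
          have "q h' (T g) < ennreal \<epsilon>"
            by (rule ennreal_mult_less_ball[OF h'(2) conjunct2[OF h'(3)[OF gX(1,2)]] gX(3)])
          then have "T g \<in> U" using h'(3)[OF gX(1,2)] e(2) by blast
          moreover have "g \<in> D" unfolding D_def using gX h by blast
          ultimately show "g \<in> ?U" by blast
        qed
        ultimately show "\<exists>V. openin (seminorm_topology X (p h)) V \<and> (\<lambda>_. 0) \<in> V \<and> V \<subseteq> ?U" by blast
      next
        show "{g \<in> D. (\<lambda>x. g x - f x) \<in> ?U} \<subseteq> {f \<in> D. T f \<in> W}"
        proof
          fix g assume g: "g \<in> {g \<in> D. (\<lambda>x. g x - f x) \<in> ?U}"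
          have "T (\<lambda>x. g x - f x) = (\<lambda>x. T g x - T f x)"
            using lin[unfolded D_def[symmetric], of g f 1 "- 1"] f g by simp
          then show "g \<in> {f \<in> D. T f \<in> W}" using g U(3) TD by auto
        qed
      qed
    qed
  qed
qed

text \<open>Here q need not be one of the defining seminorms; being dominated by a multiple of each
  of them makes it continuous on the inductive limit. It is applied to weighted seminorms.\<close>

lemma openin_inductive_limit_ball:
  fixes p :: "real \<Rightarrow> ('a \<Rightarrow> complex) \<Rightarrow> ennreal"
  assumes p: "\<And>h. h > 0 \<Longrightarrow> seminorm_on X (p h)" and q: "seminorm_on X q"
    and bd: "\<And>h. h > 0 \<Longrightarrow> \<exists>C>0. \<forall>f\<in>X. q f \<le> ennreal C * p h f"
    and f0: "f0 \<in> X"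
  shows "openin (inductive_limit {0<..} (\<lambda>h. seminorm_topology X (p h)))
    {f \<in> (\<Union>h\<in>{0<..}. {f \<in> X. p h f < \<infinity>}). q (\<lambda>x. f x - f0 x) < 1}"
  unfolding openin_inductive_limit topspace_seminorm_topology
proof (intro conjI ballI)
  let ?D = "\<Union>h\<in>{0<..}. {f \<in> X. p h f < \<infinity>}"
  fix f assume f: "f \<in> {f \<in> ?D. q (\<lambda>x. f x - f0 x) < 1}"
  then have fX: "f \<in> X" by blast
  obtain \<epsilon> where e: "\<epsilon> > 0" "q (\<lambda>x. f x - f0 x) + ennreal \<epsilon> \<le> 1"
    using f ennreal_gap by blast
  let ?U = "{g \<in> X. q g < ennreal \<epsilon>}"
  show "\<exists>U. abs_convex U \<and> (\<forall>i\<in>{0<..}. \<exists>V. openin (seminorm_topology X (p i)) V \<and> (\<lambda>_. 0) \<in> V \<and> V \<subseteq> U)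
      \<and> {g \<in> ?D. (\<lambda>x. g x - f x) \<in> U} \<subseteq> {f \<in> ?D. q (\<lambda>x. f x - f0 x) < 1}"
  proof (rule exI[of _ ?U], intro conjI ballI)
    show "abs_convex ?U" by (rule abs_convex_seminorm_ball[OF q])
  next
    fix h :: real assume "h \<in> {0<..}"
    then have h: "h > 0" by simp
    obtain C where C: "C > 0" "\<And>f. f \<in> X \<Longrightarrow> q f \<le> ennreal C * p h f" using bd[OF h] by blast
    let ?V = "{g \<in> X. p h g < \<infinity> \<and> p h (\<lambda>x. g x - 0) < ennreal (\<epsilon> / C)}"
    have "openin (seminorm_topology X (p h)) ?V"
      by (rule openin_seminorm_ball[OF p[OF h] seminorm_onD(1)[OF p[OF h]]])
    moreover have "(\<lambda>_. 0) \<in> ?V"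
      using seminorm_onD(1,2)[OF p[OF h]] e(1) C(1) by simp
    moreover have "?V \<subseteq> ?U"
      using ennreal_mult_less_ball[OF C(1) C(2)] by auto
    ultimately show "\<exists>V. openin (seminorm_topology X (p h)) V \<and> (\<lambda>_. 0) \<in> V \<and> V \<subseteq> ?U" by blast
  next
    show "{g \<in> ?D. (\<lambda>x. g x - f x) \<in> ?U} \<subseteq> {f \<in> ?D. q (\<lambda>x. f x - f0 x) < 1}"
    proof
      fix g assume g: "g \<in> {g \<in> ?D. (\<lambda>x. g x - f x) \<in> ?U}"
      have "q (\<lambda>x. g x - f0 x) = q (\<lambda>x. (f x - f0 x) + (g x - f x))"
        by (simp add: algebra_simps)
      also have "\<dots> \<le> q (\<lambda>x. f x - f0 x) + q (\<lambda>x. g x - f x)"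
        using g fX f0 by (intro seminorm_onD(7)[OF q] seminorm_onD(5)[OF q]) auto
      also have "\<dots> < q (\<lambda>x. f x - f0 x) + ennreal \<epsilon>"
        using f g by (intro ennreal_add_left_cancel_less[THEN iffD2]) (auto dest: less_imp_neq_top)
      finally have "q (\<lambda>x. g x - f0 x) < 1" using e(2) by order
      then show "g \<in> {f \<in> ?D. q (\<lambda>x. f x - f0 x) < 1}" using g by blast
    qed
  qed
qed blast

subsection \<open>The seminorms of the Gelfand--Shilov and Gevrey classes\<close>

lemma partial_cong_open:
  fixes f g :: "'v::euclidean_space \<Rightarrow> complex"
  assumes "open U" "z \<in> U" "\<And>y. y \<in> U \<Longrightarrow> f y = g y"
  shows "partial v f z = partial v g z"
proof -
  have "isCont (\<lambda>t. z + t *\<^sub>R v) 0" by (intro continuous_intros)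
  then have "((\<lambda>t. z + t *\<^sub>R v) \<longlongrightarrow> z) (nhds 0)"
    by (simp add: isCont_def tendsto_nhds_iff)
  then have "\<forall>\<^sub>F t in nhds 0. z + t *\<^sub>R v \<in> U"
    using assms(1,2) topological_tendstoD by blast
  then have "\<forall>\<^sub>F t in nhds 0. t \<in> UNIV \<longrightarrow> f (z + t *\<^sub>R v) = g (z + t *\<^sub>R v)"
    by eventually_elim (simp add: assms(3))
  then show ?thesis
    unfolding partial_def by (rule vector_derivative_cong_eq) auto
qed

lemma smooth_on_differentiable_at:
  assumes "open U" "smooth_on U f" "set vs \<subseteq> Basis" "z \<in> U"
  shows "fold partial vs f differentiable (at z)"
  using assms unfolding smooth_on_def by (meson differentiable_on_eq_differentiable_at)

text \<open>Members of the Gevrey steps are smooth only near K, and elsewhere \<open>partial\<close>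
  has no meaning, so linearity is available only inside an open set. The induction peels off the
  outermost derivative: the inner functions agree on U, hence so do their derivatives there.\<close>

lemma fold_partial_comb_open:
  assumes "open U" "smooth_on U f" "smooth_on U g" "set vs \<subseteq> Basis" "z \<in> U"
  shows "fold partial vs (\<lambda>x. a * f x + b * g x) z = a * fold partial vs f z + b * fold partial vs g z"
  using assms(4,5)
proof (induction vs arbitrary: z rule: rev_induct)
  case (snoc v vs)
  have "partial v (fold partial vs (\<lambda>x. a * f x + b * g x)) z
      = partial v (\<lambda>x. a * fold partial vs f x + b * fold partial vs g x) z"
    using snoc by (intro partial_cong_open[OF assms(1)]) auto
  also have "\<dots> = a * partial v (fold partial vs f) z + b * partial v (fold partial vs g) z"
    using snoc.prems by (intro partial_comb_at smooth_on_differentiable_at[OF assms(1)] assms) auto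
  finally show ?case by simp
qed simp

lemma smooth_on_comb_open:
  assumes "open U" "smooth_on U f" "smooth_on U g"
  shows "smooth_on U (\<lambda>x. a * f x + b * g x)"
  unfolding smooth_on_def differentiable_on_eq_differentiable_at[OF assms(1)]
proof (intro allI impI ballI)
  fix vs :: "'a list" and z assume vs: "set vs \<subseteq> Basis" and z: "z \<in> U"
  have "(\<lambda>x. a * fold partial vs f x + b * fold partial vs g x) differentiable (at z)"
    using smooth_on_differentiable_at[OF assms(1,2) vs z] smooth_on_differentiable_at[OF assms(1,3) vs z]
    by (intro differentiable_add differentiable_mult) auto
  then obtain D where "((\<lambda>x. a * fold partial vs f x + b * fold partial vs g x) has_derivative D) (at z)"
    by (auto simp: differentiable_def)
  then have "(fold partial vs (\<lambda>x. a * f x + b * g x) has_derivative D) (at z)"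
    by (rule has_derivative_transform_within_open[OF _ assms(1) z])
      (simp add: fold_partial_comb_open[OF assms vs])
  then show "fold partial vs (\<lambda>x. a * f x + b * g x) differentiable (at z)"
    by (auto simp: differentiable_def)
qed

lemma smooth_on_subset: "smooth_on U f \<Longrightarrow> V \<subseteq> U \<Longrightarrow> smooth_on V f"
  unfolding smooth_on_def using differentiable_on_subset by blast

lemma smooth_near_comb:
  assumes "smooth_near K f" "smooth_near K g"
  shows "smooth_near K (\<lambda>x. a * f x + b * g x)"
    and "set vs \<subseteq> Basis \<Longrightarrow> z \<in> K \<Longrightarrow>
      fold partial vs (\<lambda>x. a * f x + b * g x) z = a * fold partial vs f z + b * fold partial vs g z"
proof -
  obtain U V where UV: "open U" "K \<subseteq> U" "smooth_on U f" "open V" "K \<subseteq> V" "smooth_on V g"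
    using assms by (auto simp: smooth_near_def)
  then have W: "open (U \<inter> V)" "K \<subseteq> U \<inter> V" "smooth_on (U \<inter> V) f" "smooth_on (U \<inter> V) g"
    by (auto intro: smooth_on_subset)
  show "smooth_near K (\<lambda>x. a * f x + b * g x)"
    unfolding smooth_near_def by (rule exI[of _ "U \<inter> V"]) (simp add: W(1) UV(2,5) smooth_on_comb_open[OF W(1,3,4)])
  show "set vs \<subseteq> Basis \<Longrightarrow> z \<in> K \<Longrightarrow>
      fold partial vs (\<lambda>x. a * f x + b * g x) z = a * fold partial vs f z + b * fold partial vs g z"
    using W by (intro fold_partial_comb_open[of "U \<inter> V"]) auto
qed

lemma smooth_near_smooth: "smooth F \<Longrightarrow> smooth_near K F"
  unfolding smooth_near_def by (intro exI[of _ UNIV]) auto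

definition gevrey_wnorm ::
    "real \<Rightarrow> real \<Rightarrow> ((real^'n::finite) \<times> (real^'n)) set \<Rightarrow> (nat \<Rightarrow> real) \<Rightarrow> ((real^'n) \<times> (real^'n) \<Rightarrow> complex) \<Rightarrow> ennreal"
  where "gevrey_wnorm \<sigma> s K W F = (SUP \<alpha>. SUP \<beta>. SUP z\<in>K.
     ennreal (cmod (deriv_x \<alpha> (deriv_xi \<beta> F) z) /
       (W (mi_size \<alpha> + mi_size \<beta>) * mi_fact \<alpha> powr \<sigma> * mi_fact \<beta> powr s)))"

lemma gevrey_norm_wnorm: "gevrey_norm \<sigma> s K h = gevrey_wnorm \<sigma> s K (\<lambda>m. h ^ m)"
  by (simp add: gevrey_norm_def gevrey_wnorm_def fun_eq_iff)

lemma mi_fact_powr_pos: "mi_fact \<alpha> powr s > 0"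
  using mi_fact_pos[of \<alpha>] by simp

lemma ennreal_quotient_le:
  assumes "w > 0" "C \<ge> 0"
  shows "ennreal (x / (w * mi_fact \<alpha> powr a * mi_fact \<beta> powr b)) \<le> ennreal C
    \<longleftrightarrow> x \<le> C * w * (mi_fact \<alpha> powr a * mi_fact \<beta> powr b)"
proof -
  have "w * mi_fact \<alpha> powr a * mi_fact \<beta> powr b > 0"
    using assms(1) mi_fact_powr_pos[of \<alpha> a] mi_fact_powr_pos[of \<beta> b] by (intro mult_pos_pos)
  then show ?thesis
    using assms(2) by (simp add: ennreal_le_iff pos_divide_le_eq mult.assoc)
qed

lemma gevrey_wnorm_le:
  assumes "\<And>m. W m > 0" "C \<ge> 0"
  shows "gevrey_wnorm \<sigma> s K W F \<le> ennreal C \<longleftrightarrow> gevrey_bounded \<sigma> s K (\<lambda>m. C * W m) F"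
  unfolding gevrey_wnorm_def gevrey_bounded_def SUP_le_iff ennreal_quotient_le[OF assms] by blast

lemma gs_norm_le:
  assumes "h > 0" "C \<ge> 0"
  shows "gs_norm s \<sigma> h f \<le> ennreal C \<longleftrightarrow> gs_bounded s \<sigma> (\<lambda>m. C * h ^ m) f"
  unfolding gs_norm_def gs_bounded_def SUP_le_iff ennreal_quotient_le[OF zero_less_power[OF assms(1)] assms(2)]
  by blast

lemma seminorm_gevrey_wnorm:
  fixes K :: "((real^'n::finite) \<times> (real^'n)) set"
  assumes "\<And>m. W m > 0"
  shows "seminorm_on {F. smooth_near K F} (gevrey_wnorm \<sigma> s K W)"
proof (rule seminorm_onI[where I = "UNIV \<times> UNIV \<times> K"
      and L = "\<lambda>(\<alpha>, \<beta>, z) F. deriv_x \<alpha> (deriv_xi \<beta> F) z"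
      and w = "\<lambda>(\<alpha>, \<beta>, z). W (mi_size \<alpha> + mi_size \<beta>) * mi_fact \<alpha> powr \<sigma> * mi_fact \<beta> powr s"])
  show "(\<lambda>_. 0) \<in> {F. smooth_near K F}" by (simp add: smooth_near_smooth smooth_const)
next
  fix i :: "('n \<Rightarrow> nat) \<times> ('n \<Rightarrow> nat) \<times> (real^'n) \<times> (real^'n)" and F assume "i \<in> UNIV \<times> UNIV \<times> K"
  then obtain \<alpha> \<beta> z where i: "i = (\<alpha>, \<beta>, z)" "z \<in> K" by auto
  show "ennreal (cmod ((case i of (\<alpha>, \<beta>, z) \<Rightarrow> \<lambda>F. deriv_x \<alpha> (deriv_xi \<beta> F) z) F) /
      (case i of (\<alpha>, \<beta>, z) \<Rightarrow> W (mi_size \<alpha> + mi_size \<beta>) * mi_fact \<alpha> powr \<sigma> * mi_fact \<beta> powr s))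
    \<le> gevrey_wnorm \<sigma> s K W F"
    unfolding gevrey_wnorm_def i
    by (rule SUP_upper2[where i = \<alpha>], simp, rule SUP_upper2[where i = \<beta>], simp, rule SUP_upper2[where i = z])
      (simp_all add: i(2))
next
  fix F :: "(real^'n) \<times> (real^'n) \<Rightarrow> complex" and c assume "\<And>i. i \<in> UNIV \<times> UNIV \<times> K \<Longrightarrow>
      ennreal (cmod ((case i of (\<alpha>, \<beta>, z) \<Rightarrow> \<lambda>F. deriv_x \<alpha> (deriv_xi \<beta> F) z) F) /
      (case i of (\<alpha>, \<beta>, z) \<Rightarrow> W (mi_size \<alpha> + mi_size \<beta>) * mi_fact \<alpha> powr \<sigma> * mi_fact \<beta> powr s)) \<le> c"
  then show "gevrey_wnorm \<sigma> s K W F \<le> c"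
    unfolding gevrey_wnorm_def by (intro SUP_least) force
next
  fix i :: "('n \<Rightarrow> nat) \<times> ('n \<Rightarrow> nat) \<times> (real^'n) \<times> (real^'n)"
    and F G and a b :: complex
  assume i: "i \<in> UNIV \<times> UNIV \<times> K" and FG: "F \<in> {F. smooth_near K F}" "G \<in> {F. smooth_near K F}"
  obtain \<alpha> \<beta> z where i: "i = (\<alpha>, \<beta>, z)" "z \<in> K" using i by auto
  show "(case i of (\<alpha>, \<beta>, z) \<Rightarrow> \<lambda>F. deriv_x \<alpha> (deriv_xi \<beta> F) z) (\<lambda>x. a * F x + b * G x)
      = a * (case i of (\<alpha>, \<beta>, z) \<Rightarrow> \<lambda>F. deriv_x \<alpha> (deriv_xi \<beta> F) z) F
        + b * (case i of (\<alpha>, \<beta>, z) \<Rightarrow> \<lambda>F. deriv_x \<alpha> (deriv_xi \<beta> F) z) G"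
    unfolding i prod.case deriv_x_deriv_xi using FG i
    by (intro smooth_near_comb) (simp_all add: set_mi_list_axis)
qed (use assms mi_fact_powr_pos in \<open>auto simp: smooth_near_comb less_imp_le\<close>)

lemma seminorm_gs_norm:
  assumes "h > 0"
  shows "seminorm_on {f :: real^'n::finite \<Rightarrow> complex. smooth f} (gs_norm s \<sigma> h)"
proof (rule seminorm_onI[where I = UNIV
      and L = "\<lambda>(\<alpha>, \<beta>, x) f. of_real (mi_power x \<alpha>) * deriv_mi \<beta> f x"
      and w = "\<lambda>(\<alpha>, \<beta>, x). h ^ (mi_size \<alpha> + mi_size \<beta>) * mi_fact \<alpha> powr s * mi_fact \<beta> powr \<sigma>"])
  show "(\<lambda>_. 0) \<in> {f. smooth f}" by (simp add: smooth_const)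
next
  fix i :: "('n \<Rightarrow> nat) \<times> ('n \<Rightarrow> nat) \<times> (real^'n)" and f
  obtain \<alpha> \<beta> x where i: "i = (\<alpha>, \<beta>, x)" by (cases i) auto
  show "ennreal (cmod ((case i of (\<alpha>, \<beta>, x) \<Rightarrow> \<lambda>f. of_real (mi_power x \<alpha>) * deriv_mi \<beta> f x) f) /
      (case i of (\<alpha>, \<beta>, x) \<Rightarrow> h ^ (mi_size \<alpha> + mi_size \<beta>) * mi_fact \<alpha> powr s * mi_fact \<beta> powr \<sigma>))
    \<le> gs_norm s \<sigma> h f"
    unfolding gs_norm_def i
    by (rule SUP_upper2[where i = \<alpha>], simp, rule SUP_upper2[where i = \<beta>], simp, rule SUP_upper2[where i = x]) simp_all
next
  fix f :: "real^'n \<Rightarrow> complex" and c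
  assume "\<And>i. i \<in> UNIV \<Longrightarrow>
      ennreal (cmod ((case i of (\<alpha>, \<beta>, x) \<Rightarrow> \<lambda>f. of_real (mi_power x \<alpha>) * deriv_mi \<beta> f x) f) /
      (case i of (\<alpha>, \<beta>, x) \<Rightarrow> h ^ (mi_size \<alpha> + mi_size \<beta>) * mi_fact \<alpha> powr s * mi_fact \<beta> powr \<sigma>)) \<le> c"
  then show "gs_norm s \<sigma> h f \<le> c"
    unfolding gs_norm_def by (intro SUP_least) force
next
  fix i :: "('n \<Rightarrow> nat) \<times> ('n \<Rightarrow> nat) \<times> (real^'n)" and f g :: "real^'n \<Rightarrow> complex" and a b :: complex
  assume fg: "f \<in> {f. smooth f}" "g \<in> {f. smooth f}"
  obtain \<alpha> \<beta> x where i: "i = (\<alpha>, \<beta>, x)" by (cases i) auto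
  have "deriv_mi \<beta> (\<lambda>x. a * f x + b * g x) = (\<lambda>x. a * deriv_mi \<beta> f x + b * deriv_mi \<beta> g x)"
    unfolding deriv_mi_def multi_partial_fold using fg
    by (intro fold_partial_comb) (simp_all add: set_mi_list_axis)
  then show "(case i of (\<alpha>, \<beta>, x) \<Rightarrow> \<lambda>f. of_real (mi_power x \<alpha>) * deriv_mi \<beta> f x) (\<lambda>x. a * f x + b * g x)
      = a * (case i of (\<alpha>, \<beta>, x) \<Rightarrow> \<lambda>f. of_real (mi_power x \<alpha>) * deriv_mi \<beta> f x) f
        + b * (case i of (\<alpha>, \<beta>, x) \<Rightarrow> \<lambda>f. of_real (mi_power x \<alpha>) * deriv_mi \<beta> f x) g"
    by (simp add: i algebra_simps)
qed (use assms mi_fact_powr_pos in \<open>auto simp: smooth_comb less_imp_le\<close>)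

lemma gs_norm_antimono:
  assumes "0 < h" "h \<le> h'"
  shows "gs_norm s \<sigma> h' f \<le> gs_norm s \<sigma> h f"
  unfolding gs_norm_def using assms mi_fact_powr_pos
  by (intro SUP_mono' ennreal_leI divide_left_mono mult_right_mono power_mono mult_pos_pos)
    (auto simp: less_imp_le)

lemma gs_bounded_mono:
  "gs_bounded s \<sigma> W f \<Longrightarrow> (\<And>m. W m \<le> W' m) \<Longrightarrow> gs_bounded s \<sigma> W' f"
  unfolding gs_bounded_def using mi_fact_powr_pos
  by (meson less_imp_le mult_nonneg_nonneg mult_right_mono order_trans)

lemma deriv_mi_comb:
  assumes "smooth f" "smooth g"
  shows "deriv_mi \<beta> (\<lambda>x. a * f x + b * g x) = (\<lambda>x. a * deriv_mi \<beta> f x + b * deriv_mi \<beta> g x)"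
  unfolding deriv_mi_def multi_partial_fold using assms
  by (intro fold_partial_comb) (simp_all add: set_mi_list_axis)

lemma gs_bounded_comb:
  assumes "smooth f" "smooth g" "gs_bounded s \<sigma> V f" "gs_bounded s \<sigma> W g"
  shows "gs_bounded s \<sigma> (\<lambda>m. cmod a * V m + cmod b * W m) (\<lambda>x. a * f x + b * g x)"
  unfolding gs_bounded_def
proof (intro allI)
  fix \<alpha> \<beta> :: "'a \<Rightarrow> nat" and x :: "real^'a"
  let ?m = "mi_size \<alpha> + mi_size \<beta>" and ?c = "mi_fact \<alpha> powr s * mi_fact \<beta> powr \<sigma>"
  let ?D = "\<lambda>f. of_real (mi_power x \<alpha>) * deriv_mi \<beta> f x"
  have "cmod (?D (\<lambda>x. a * f x + b * g x)) = cmod (a * ?D f + b * ?D g)"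
    by (simp add: deriv_mi_comb[OF assms(1,2)] algebra_simps)
  also have "\<dots> \<le> cmod a * cmod (?D f) + cmod b * cmod (?D g)"
    by (rule order_trans[OF norm_triangle_ineq]) (simp add: norm_mult)
  also have "\<dots> \<le> cmod a * (V ?m * ?c) + cmod b * (W ?m * ?c)"
    using assms(3,4) by (intro add_mono mult_left_mono) (auto simp: gs_bounded_def)
  finally show "cmod (?D (\<lambda>x. a * f x + b * g x)) \<le> (cmod a * V ?m + cmod b * W ?m) * ?c"
    by (simp add: algebra_simps)
qed

subsection \<open>Bounded sequences have convergent subsequences\<close>

lemma lipschitz_fold_partial:
  fixes f :: "real^'n::finite \<Rightarrow> complex"
  assumes f: "smooth f" and vs: "set vs \<subseteq> Basis"
    and B: "\<And>b x. b \<in> Basis \<Longrightarrow> cmod (fold partial (vs @ [b]) f x) \<le> B b"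
  shows "cmod (fold partial vs f x - fold partial vs f y) \<le> (\<Sum>b\<in>Basis. B b) * norm (x - y)"
proof (rule differentiable_bound[OF convex_UNIV])
  fix z
  show "(fold partial vs f has_derivative
      (\<lambda>v. \<Sum>b\<in>Basis. (v \<bullet> b) *\<^sub>R partial b (fold partial vs f) z)) (at z within UNIV)"
    using has_derivative_partials[OF smooth_differentiable[OF smooth_fold_partial[OF f vs]]] by simp
  show "onorm (\<lambda>v. \<Sum>b\<in>Basis. (v \<bullet> b) *\<^sub>R partial b (fold partial vs f) z) \<le> (\<Sum>b\<in>Basis. B b)"
  proof (rule onorm_le)
    fix v :: "real^'n"
    have "norm (\<Sum>b\<in>Basis. (v \<bullet> b) *\<^sub>R partial b (fold partial vs f) z) \<le> (\<Sum>b\<in>Basis. norm v * B b)"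
    proof (rule sum_norm_le)
      fix b :: "real^'n" assume b: "b \<in> Basis"
      show "norm ((v \<bullet> b) *\<^sub>R partial b (fold partial vs f) z) \<le> norm v * B b"
        unfolding norm_scaleR using Basis_le_norm[OF b, of v] B[OF b, of z] by (intro mult_mono) auto
    qed
    then show "norm (\<Sum>b\<in>Basis. (v \<bullet> b) *\<^sub>R partial b (fold partial vs f) z) \<le> (\<Sum>b\<in>Basis. B b) * norm v"
      by (simp add: sum_distrib_left mult.commute[of _ "norm v"])
  qed
qed auto

lemma eventually_pair_sequentially_finite:
  assumes "finite A" "\<And>a. a \<in> A \<Longrightarrow> \<exists>N. \<forall>k\<ge>N. \<forall>l\<ge>N. P a k l"
  shows "\<exists>N::nat. \<forall>k\<ge>N. \<forall>l\<ge>N. \<forall>a\<in>A. P a k l"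
proof -
  obtain N where N: "\<And>a k l. a \<in> A \<Longrightarrow> k \<ge> N a \<Longrightarrow> l \<ge> N a \<Longrightarrow> P a k l"
    using assms(2) by metis
  have "N a \<le> Max (N ` A)" if "a \<in> A" for a
    using assms(1) that by auto
  then show ?thesis
    using N by (intro exI[of _ "Max (N ` A)"]) (meson order_trans)
qed

lemma finite_mi_size_less: "finite {(\<alpha> :: 'n::finite \<Rightarrow> nat, \<beta> :: 'n \<Rightarrow> nat). mi_size \<alpha> + mi_size \<beta> < m}"
proof -
  have "\<alpha> i \<le> mi_size \<alpha>" for i and \<alpha> :: "'n \<Rightarrow> nat"
    unfolding mi_size_def by (rule member_le_sum) auto
  then have le: "mi_size \<alpha> < m \<Longrightarrow> \<alpha> i \<le> m" for i and \<alpha> :: "'n \<Rightarrow> nat"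
    by (meson le_trans less_imp_le)
  have "{(\<alpha> :: 'n \<Rightarrow> nat, \<beta> :: 'n \<Rightarrow> nat). mi_size \<alpha> + mi_size \<beta> < m}
      \<subseteq> {\<alpha>. \<forall>i. \<alpha> i \<le> m} \<times> {\<beta>. \<forall>i. \<beta> i \<le> m}"
    using le by fastforce
  then show ?thesis
    by (rule finite_subset) (simp add: finite_mi_below)
qed

lemma mi_power_zero: "mi_power x (\<lambda>_. 0) = 1"
  by (simp add: mi_power_def)

lemma mi_power_Suc: "mi_power x (\<alpha>(i := Suc (\<alpha> i))) = x $ i * mi_power x \<alpha>"
  unfolding mi_power_def by (subst (1 2) prod.remove[of UNIV i]) (auto intro!: prod.cong)

text \<open>An Arzela-Ascoli argument for all derivatives at once. Three regions are treated
  differently: bounded x by equicontinuity, large x by one extra power of a coordinate, and high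
  orders by the decay of (h / h')^m, which is why the scale has to grow.\<close>

lemma gs_compactness:
  fixes f :: "nat \<Rightarrow> real^'n::finite \<Rightarrow> complex"
  assumes f: "\<And>k. smooth (f k)" and bd: "\<And>k. gs_bounded s \<sigma> (\<lambda>m. M * h ^ m) (f k)"
    and h: "0 < h" "h < h'" and M: "M \<ge> 0"
  shows "\<exists>r g. strict_mono (r :: nat \<Rightarrow> nat) \<and> smooth g \<and>
    (\<forall>\<beta> x. (\<lambda>k. deriv_mi \<beta> (f (r k)) x) \<longlonglongrightarrow> deriv_mi \<beta> g x) \<and>
    (\<forall>\<eta>>0. \<exists>N. \<forall>k\<ge>N. gs_bounded s \<sigma> (\<lambda>m. \<eta> * h' ^ m) (\<lambda>x. f (r k) x - g x))"
proof -
  define B where "B vs = M * h ^ mi_size (\<lambda>i::'n. count_list vs (axis i (1::real)))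
      * mi_fact (\<lambda>i::'n. count_list vs (axis i (1::real))) powr \<sigma>" for vs :: "(real^'n) list"
  have B: "cmod (fold partial vs (f k) x) \<le> B vs" if "set vs \<subseteq> Basis" for vs k x
  proof -
    have "mi_fact (\<lambda>_::'n. 0) = 1" "mi_size (\<lambda>_::'n. 0) = 0"
      by (simp_all add: mi_fact_def mi_size_def)
    then show ?thesis
      using bd[of k, unfolded gs_bounded_def, rule_format, of x "\<lambda>_. 0" "\<lambda>i. count_list vs (axis i 1)"] that
      by (simp add: fold_partial_deriv_mi[OF f] B_def mi_power_zero)
  qed
  have B0: "B vs \<ge> 0" for vs using h M by (simp add: B_def)
  obtain D :: "(real^'n) set" where D: "countable D" "\<And>X. open X \<Longrightarrow> X \<noteq> {} \<Longrightarrow> \<exists>d\<in>D. d \<in> X"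
    by (rule countable_dense_setE) blast
  let ?L = "{vs :: (real^'n) list. set vs \<subseteq> Basis}"
  have "countable ?L"
    using countable_lists[of "Basis :: (real^'n) set"] by (simp add: lists_eq_set countable_finite)
  then have "countable (?L \<times> D)" using D(1) by simp
  \<comment> \<open>The diagonal selection works on one countable family, indexed by derivative and
    dense point. Division by B vs + 1 normalizes it to a common bound 1.\<close>
  moreover have "norm ((\<lambda>(vs, x). fold partial vs (f k) x / of_real (B vs + 1)) y) \<le> 1" if "y \<in> ?L \<times> D" for k y
  proof -
    obtain vs x where y: "y = (vs, x)" "set vs \<subseteq> Basis" using \<open>y \<in> ?L \<times> D\<close> by auto
    then show ?thesis
      using B[OF y(2), of k x] B0[of vs] by (simp add: norm_divide del: of_real_add)
  qed
  ultimately obtain r where r: "strict_mono (r :: nat \<Rightarrow> nat)" and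
    rl: "\<And>y. y \<in> ?L \<times> D \<Longrightarrow> \<exists>l. (\<lambda>k. (\<lambda>(vs, x). fold partial vs (f (r k)) x / of_real (B vs + 1)) y) \<longlonglongrightarrow> l"
    by (rule function_convergent_subsequence[where f = "\<lambda>k (vs, x). fold partial vs (f k) x / of_real (B vs + 1)"]) auto
  have cauchyD: "Cauchy (\<lambda>k. fold partial vs (f (r k)) x)" if vx: "set vs \<subseteq> Basis" "x \<in> D" for vs x
  proof -
    obtain l where "(\<lambda>k. fold partial vs (f (r k)) x / of_real (B vs + 1)) \<longlonglongrightarrow> l"
      using rl[of "(vs, x)"] vx by auto
    then have "(\<lambda>k. fold partial vs (f (r k)) x / of_real (B vs + 1) * of_real (B vs + 1)) \<longlonglongrightarrow> l * of_real (B vs + 1)"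
      by (rule tendsto_mult_right)
    moreover have "of_real (B vs + 1) \<noteq> (0 :: complex)" using B0[of vs] by (simp only: of_real_eq_0_iff)
    ultimately have "(\<lambda>k. fold partial vs (f (r k)) x) \<longlonglongrightarrow> l * of_real (B vs + 1)"
      by simp
    then show ?thesis using LIMSEQ_imp_Cauchy by blast
  qed
  have loc: "\<exists>N. \<forall>k\<ge>N. \<forall>l\<ge>N. \<forall>x\<in>cball 0 \<rho>. cmod (fold partial vs (f (r k)) x - fold partial vs (f (r l)) x) < \<epsilon>"
    if vs: "set vs \<subseteq> Basis" and e: "\<epsilon> > 0" for vs \<rho> \<epsilon>
  proof -
    define L where "L = (\<Sum>b\<in>Basis. B (vs @ [b])) + 1"
    have L: "L > 0" unfolding L_def using B0 by (simp add: add_nonneg_pos sum_nonneg)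
    have lip: "cmod (fold partial vs (f k) x - fold partial vs (f k) y) \<le> L * norm (x - y)" for k x y
    proof -
      have "cmod (fold partial vs (f k) x - fold partial vs (f k) y) \<le> (\<Sum>b\<in>Basis. B (vs @ [b])) * norm (x - y)"
        using vs B[of "vs @ [b]" for b] by (intro lipschitz_fold_partial f) simp_all
      also have "\<dots> \<le> L * norm (x - y)" by (intro mult_right_mono) (auto simp: L_def)
      finally show ?thesis .
    qed
    \<comment> \<open>Passing from x to a point of the finite net and back costs two Lipschitz
      errors of at most \<epsilon> / 4; the net point contributes less than \<epsilon> / 2.\<close>
    define \<eta> where "\<eta> = \<epsilon> / (4 * L)"
    have eta: "\<eta> > 0" using e L by (simp add: \<eta>_def)
    have "cball 0 \<rho> \<subseteq> (\<Union>d\<in>D. ball d \<eta>)"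
    proof
      fix x :: "real^'n"
      obtain d where "d \<in> D" "d \<in> ball x \<eta>" using D(2)[of "ball x \<eta>"] eta by auto
      then show "x \<in> (\<Union>d\<in>D. ball d \<eta>)" by (auto simp: dist_commute)
    qed
    then obtain D' where D': "D' \<subseteq> D" "finite D'" "cball 0 \<rho> \<subseteq> (\<Union>d\<in>D'. ball d \<eta>)"
      using compactE_image[OF compact_cball, of D "\<lambda>d. ball d \<eta>" 0 \<rho>] by auto
    have "\<exists>N. \<forall>k\<ge>N. \<forall>l\<ge>N. \<forall>d\<in>D'. cmod (fold partial vs (f (r k)) d - fold partial vs (f (r l)) d) < \<epsilon> / 2"
    proof (rule eventually_pair_sequentially_finite[OF D'(2)])
      fix d assume "d \<in> D'"
      then have "Cauchy (\<lambda>k. fold partial vs (f (r k)) d)" using cauchyD[OF vs] D'(1) by blast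
      then show "\<exists>N. \<forall>k\<ge>N. \<forall>l\<ge>N. cmod (fold partial vs (f (r k)) d - fold partial vs (f (r l)) d) < \<epsilon> / 2"
        using half_gt_zero[OF e] unfolding Cauchy_def dist_norm by blast
    qed
    then obtain N where N: "\<And>k l d. k \<ge> N \<Longrightarrow> l \<ge> N \<Longrightarrow> d \<in> D' \<Longrightarrow>
        cmod (fold partial vs (f (r k)) d - fold partial vs (f (r l)) d) < \<epsilon> / 2" by blast
    have "cmod (fold partial vs (f (r k)) x - fold partial vs (f (r l)) x) < \<epsilon>"
      if kl: "k \<ge> N" "l \<ge> N" and x: "x \<in> cball 0 \<rho>" for k l x
    proof -
      obtain d where d: "d \<in> D'" "norm (x - d) < \<eta>"
        using D'(3) x by (auto simp: dist_norm norm_minus_commute)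
      have near: "cmod (fold partial vs (f j) x - fold partial vs (f j) d) \<le> \<epsilon> / 4" for j
      proof -
        have "cmod (fold partial vs (f j) x - fold partial vs (f j) d) \<le> L * norm (x - d)" by (rule lip)
        also have "\<dots> \<le> L * \<eta>" using d L by (intro mult_left_mono) auto
        finally show ?thesis using L by (simp add: \<eta>_def)
      qed
      have "cmod (fold partial vs (f (r k)) x - fold partial vs (f (r l)) x)
          = cmod ((fold partial vs (f (r k)) x - fold partial vs (f (r k)) d)
            + (fold partial vs (f (r k)) d - fold partial vs (f (r l)) d)
            - (fold partial vs (f (r l)) x - fold partial vs (f (r l)) d))"
        by simp
      also have "\<dots> \<le> cmod (fold partial vs (f (r k)) x - fold partial vs (f (r k)) d)
          + cmod (fold partial vs (f (r k)) d - fold partial vs (f (r l)) d)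
          + cmod (fold partial vs (f (r l)) x - fold partial vs (f (r l)) d)"
        by (intro order_trans[OF norm_triangle_ineq4] add_right_mono norm_triangle_ineq)
      also have "\<dots> < \<epsilon>"
        using near[of "r k"] near[of "r l"] N[OF kl d(1)] by linarith
      finally show ?thesis .
    qed
    then show ?thesis by blast
  qed
  define G where "G vs x = lim (\<lambda>k. fold partial vs (f (r k)) x)" for vs x
  have unif: "uniform_limit (cball 0 \<rho>) (\<lambda>k. fold partial vs (f (r k))) (G vs) sequentially"
    if "set vs \<subseteq> Basis" for vs \<rho>
  proof -
    have "uniformly_Cauchy_on (cball 0 \<rho>) (\<lambda>k. fold partial vs (f (r k)))"
      unfolding uniformly_Cauchy_on_def dist_norm using loc[OF that] by blast
    then show ?thesis
      unfolding G_def
      using Cauchy_uniformly_convergent uniformly_convergent_uniform_limit_iff by blast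
  qed
  define g where "g = G []"
  have g: "smooth g" "\<And>vs. set vs \<subseteq> Basis \<Longrightarrow> fold partial vs g = G vs"
    unfolding g_def using smooth_limit[where f = "\<lambda>k. f (r k)" and g = G, OF f unif] by auto
  have lim: "(\<lambda>k. deriv_mi \<beta> (f (r k)) x) \<longlonglongrightarrow> deriv_mi \<beta> g x" for \<beta> x
    unfolding deriv_mi_def multi_partial_fold
    using tendsto_uniform_limitI[OF unif[OF set_mi_list_axis(1)], of x "norm x" \<beta>]
    by (simp add: g(2) set_mi_list_axis)
  have diff: "gs_bounded s \<sigma> (\<lambda>m. 2 * M * h ^ m) (\<lambda>x. f k x - f l x)" for k l
    using gs_bounded_comb[OF f[of k] f[of l] bd[of k] bd[of l], of 1 "- 1"] by (simp add: mult.assoc)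
  have dd: "deriv_mi \<beta> (\<lambda>x. f k x - f l x) = (\<lambda>x. deriv_mi \<beta> (f k) x - deriv_mi \<beta> (f l) x)" for \<beta> k l
    using deriv_mi_comb[OF f[of k] f[of l], of \<beta> 1 "- 1"] by simp
  have pair: "\<exists>N. \<forall>k\<ge>N. \<forall>l\<ge>N. \<forall>x. cmod (of_real (mi_power x \<alpha>) * deriv_mi \<beta> (\<lambda>x. f (r k) x - f (r l) x) x) \<le> \<tau>"
    if t: "\<tau> > 0" for \<alpha> \<beta> \<tau>
  proof -
    \<comment> \<open>The a priori bound with the exponent of x_i raised by one, so that it gives
      decay like 1 / |x_i|.\<close>
    define Q where "Q i = 2 * M * h ^ (mi_size (\<alpha>(i := Suc (\<alpha> i))) + mi_size \<beta>)
        * (mi_fact (\<alpha>(i := Suc (\<alpha> i))) powr s * mi_fact \<beta> powr \<sigma>)" for i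
    have Q0: "Q i \<ge> 0" for i using h M by (simp add: Q_def)
    have Q: "\<bar>x $ i\<bar> * cmod (of_real (mi_power x \<alpha>) * deriv_mi \<beta> (\<lambda>x. f k x - f l x) x) \<le> Q i" for i x k l
      using diff[of k l, unfolded gs_bounded_def, rule_format, of x "\<alpha>(i := Suc (\<alpha> i))" \<beta>]
      by (simp add: mi_power_Suc norm_mult Q_def mult.assoc)
    \<comment> \<open>Large enough that Q i \<le> \<rho> * \<tau>: as soon as some |x_i| exceeds
      \<rho>, the extra power alone makes the expression at most \<tau>. The remaining cube lies in
      a ball of radius d * \<rho>.\<close>
    define \<rho> where "\<rho> = 1 + (\<Sum>i\<in>UNIV. Q i) / \<tau>"
    have rho: "\<rho> \<ge> 1" using t Q0 by (simp add: \<rho>_def sum_nonneg)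
    have Qr: "Q i \<le> \<rho> * \<tau>" for i
    proof -
      have "Q i \<le> (\<Sum>i\<in>UNIV. Q i)" using Q0 by (intro member_le_sum) auto
      also have "\<dots> \<le> \<rho> * \<tau>" using t by (simp add: \<rho>_def field_simps)
      finally show ?thesis .
    qed
    have "\<tau> / \<rho> ^ mi_size \<alpha> > 0" using t rho by simp
    from loc[OF set_mi_list_axis(1)[of \<beta>] this, of "real CARD('n) * \<rho>"]
    obtain N where N0: "\<forall>k\<ge>N. \<forall>l\<ge>N. \<forall>x\<in>cball 0 (real CARD('n) * \<rho>).
        cmod (deriv_mi \<beta> (f (r k)) x - deriv_mi \<beta> (f (r l)) x) < \<tau> / \<rho> ^ mi_size \<alpha>"
      unfolding deriv_mi_def multi_partial_fold ..
    have N: "cmod (deriv_mi \<beta> (f (r k)) x - deriv_mi \<beta> (f (r l)) x) < \<tau> / \<rho> ^ mi_size \<alpha>"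
      if "k \<ge> N" "l \<ge> N" "norm x \<le> real CARD('n) * \<rho>" for k l x
      using N0 that by simp
    have "cmod (of_real (mi_power x \<alpha>) * deriv_mi \<beta> (\<lambda>x. f (r k) x - f (r l) x) x) \<le> \<tau>"
      if kl: "k \<ge> N" "l \<ge> N" for k l x
    proof (cases "\<exists>i. \<bar>x $ i\<bar> > \<rho>")
      case True
      then obtain i where i: "\<bar>x $ i\<bar> > \<rho>" by blast
      let ?v = "cmod (of_real (mi_power x \<alpha>) * deriv_mi \<beta> (\<lambda>x. f (r k) x - f (r l) x) x)"
      have "\<rho> * ?v \<le> \<bar>x $ i\<bar> * ?v" using i by (intro mult_right_mono) auto
      also have "\<dots> \<le> \<rho> * \<tau>" using Q Qr order_trans by blast
      finally show ?thesis using rho by simp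
    next
      case False
      then have xi: "\<bar>x $ i\<bar> \<le> \<rho>" for i by (meson not_le)
      then have "norm x \<le> (\<Sum>i\<in>(UNIV::'n set). \<rho>)"
        by (intro order_trans[OF norm_le_l1_cart] sum_mono)
      then have "cmod (deriv_mi \<beta> (f (r k)) x - deriv_mi \<beta> (f (r l)) x) < \<tau> / \<rho> ^ mi_size \<alpha>"
        using N[OF kl] by simp
      moreover have "\<bar>mi_power x \<alpha>\<bar> \<le> \<rho> ^ mi_size \<alpha>"
        unfolding mi_power_def abs_prod power_abs power_mi_size using xi by (intro prod_mono) (auto intro: power_mono)
      ultimately have "\<bar>mi_power x \<alpha>\<bar> * cmod (deriv_mi \<beta> (f (r k)) x - deriv_mi \<beta> (f (r l)) x)
          \<le> \<rho> ^ mi_size \<alpha> * (\<tau> / \<rho> ^ mi_size \<alpha>)"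
        using rho by (intro mult_mono) auto
      then show ?thesis using rho by (simp add: dd norm_mult)
    qed
    then show ?thesis by blast
  qed
  have "\<exists>N. \<forall>k\<ge>N. gs_bounded s \<sigma> (\<lambda>m. \<eta> * h' ^ m) (\<lambda>x. f (r k) x - g x)" if eta: "\<eta> > 0" for \<eta>
  proof -
    have "(\<lambda>m. 2 * M * (h / h') ^ m) \<longlonglongrightarrow> 2 * M * 0"
      using h by (intro tendsto_mult_left LIMSEQ_power_zero) auto
    then have "\<forall>\<^sub>F m in sequentially. 2 * M * (h / h') ^ m < \<eta>"
      using eta by (intro order_tendstoD(2)) auto
    \<comment> \<open>Orders from m0 on are small uniformly in k and l by the change of scale; below
      m0 there are only finitely many pairs of multi-indices.\<close>
    then obtain m0 where m0: "\<And>m. m \<ge> m0 \<Longrightarrow> 2 * M * (h / h') ^ m < \<eta>"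
      by (auto simp: eventually_sequentially)
    let ?c = "\<lambda>\<alpha> \<beta>. \<eta> * h' ^ (mi_size \<alpha> + mi_size \<beta>) * (mi_fact \<alpha> powr s * mi_fact \<beta> powr \<sigma>)"
    have "\<exists>N. \<forall>k\<ge>N. \<forall>l\<ge>N. \<forall>y\<in>{(\<alpha> :: 'n \<Rightarrow> nat, \<beta> :: 'n \<Rightarrow> nat). mi_size \<alpha> + mi_size \<beta> < m0}. \<forall>x.
        cmod (of_real (mi_power x (fst y)) * deriv_mi (snd y) (\<lambda>x. f (r k) x - f (r l) x) x) \<le> ?c (fst y) (snd y)"
      using eta h mi_fact_powr_pos by (intro eventually_pair_sequentially_finite finite_mi_size_less pair mult_pos_pos) auto
    then obtain N where N: "\<And>k l \<alpha> \<beta> x. k \<ge> N \<Longrightarrow> l \<ge> N \<Longrightarrow> mi_size \<alpha> + mi_size \<beta> < m0 \<Longrightarrow>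
        cmod (of_real (mi_power x \<alpha>) * deriv_mi \<beta> (\<lambda>x. f (r k) x - f (r l) x) x) \<le> ?c \<alpha> \<beta>"
      by fastforce
    \<comment> \<open>The estimate for the difference of the terms k and l is uniform in l, so l may
      tend to infinity.\<close>
    have "cmod (of_real (mi_power x \<alpha>) * deriv_mi \<beta> (\<lambda>x. f (r k) x - g x) x) \<le> ?c \<alpha> \<beta>"
      if k: "k \<ge> N" for k \<alpha> \<beta> x
    proof (rule LIMSEQ_le_const2)
      have "deriv_mi \<beta> (\<lambda>x. f (r k) x - g x) = (\<lambda>x. deriv_mi \<beta> (f (r k)) x - deriv_mi \<beta> g x)"
        using deriv_mi_comb[OF f[of "r k"] g(1), of \<beta> 1 "- 1"] by simp
      then show "(\<lambda>l. cmod (of_real (mi_power x \<alpha>) * deriv_mi \<beta> (\<lambda>x. f (r k) x - f (r l) x) x))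
          \<longlonglongrightarrow> cmod (of_real (mi_power x \<alpha>) * deriv_mi \<beta> (\<lambda>x. f (r k) x - g x) x)"
        unfolding dd by (auto intro!: tendsto_intros lim)
      show "\<exists>N. \<forall>l\<ge>N. cmod (of_real (mi_power x \<alpha>) * deriv_mi \<beta> (\<lambda>x. f (r k) x - f (r l) x) x) \<le> ?c \<alpha> \<beta>"
      proof (intro exI[of _ N] allI impI)
        fix l assume l: "l \<ge> N"
        show "cmod (of_real (mi_power x \<alpha>) * deriv_mi \<beta> (\<lambda>x. f (r k) x - f (r l) x) x) \<le> ?c \<alpha> \<beta>"
        proof (cases "mi_size \<alpha> + mi_size \<beta> < m0")
          case True
          then show ?thesis using N[OF k l] by blast
        next
          case False
          let ?m = "mi_size \<alpha> + mi_size \<beta>"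
          have "2 * M * (h / h') ^ ?m * h' ^ ?m \<le> \<eta> * h' ^ ?m"
            using m0[of ?m] False h by (intro mult_right_mono) auto
          then have "2 * M * h ^ ?m \<le> \<eta> * h' ^ ?m"
            using h by (simp add: power_divide)
          then have "2 * M * h ^ ?m * (mi_fact \<alpha> powr s * mi_fact \<beta> powr \<sigma>) \<le> ?c \<alpha> \<beta>"
            by (intro mult_right_mono) auto
          then show ?thesis
            using diff[of "r k" "r l", unfolded gs_bounded_def] order_trans by blast
        qed
      qed
    qed
    then show ?thesis unfolding gs_bounded_def by blast
  qed
  then show ?thesis using r g(1) lim by blast
qed

subsection \<open>Zero neighbourhoods of the inductive limit contain weighted balls\<close>

lemma gs_bounded_zero: "(\<And>m. W m \<ge> 0) \<Longrightarrow> gs_bounded s \<sigma> W (\<lambda>_. 0)"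
  using mi_fact_powr_pos
  by (simp add: gs_bounded_def deriv_mi_def multi_partial_zero less_imp_le)

lemma gs_bounded_zero_eq: "gs_bounded s \<sigma> (\<lambda>_. 0) f \<Longrightarrow> f = (\<lambda>_. 0)"
proof
  fix x
  assume "gs_bounded s \<sigma> (\<lambda>_. 0) f"
  then have "cmod (of_real (mi_power x (\<lambda>_. 0)) * deriv_mi (\<lambda>_. 0) f x) \<le> 0"
    unfolding gs_bounded_def by (metis mult_zero_left)
  moreover have "deriv_mi (\<lambda>_. 0) f = f"
    by (simp add: deriv_mi_def multi_partial_fold mi_list_def concat_eq_Nil_conv[THEN iffD2])
  ultimately show "f x = 0" by (simp add: mi_power_zero)
qed

lemma abs_convexD:
  assumes "abs_convex U" "f \<in> U" "g \<in> U" "cmod a + cmod b \<le> 1"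
  shows "(\<lambda>x. a * f x + b * g x) \<in> U"
  using assms unfolding abs_convex_def by blast

text \<open>Passing from the weight \<open>A\<close> to \<open>max A (\<delta> * h ^ m)\<close> for small \<open>\<delta>\<close> costs only an
  arbitrarily small dilation of \<open>U\<close>; otherwise a sequence of counterexamples for \<open>\<delta> \<longlonglongrightarrow> 0\<close> would
  converge to an element of the smaller ball.\<close>
lemma gs_weight_step:
  assumes U: "abs_convex U"
    and nbhd: "\<And>h. h > 0 \<Longrightarrow> \<exists>\<epsilon>>0. \<forall>f :: real^'n::finite \<Rightarrow> complex. smooth f \<longrightarrow> gs_bounded s \<sigma> (\<lambda>m. \<epsilon> * h ^ m) f \<longrightarrow> f \<in> U"
    and A: "\<And>m. A m \<ge> 0" "\<And>m. A m \<le> M * h ^ m" and h: "h > 0" and \<delta>0: "\<delta>0 > 0"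
    and t: "0 < t'" "t' < t"
    and AU: "\<And>f :: real^'n \<Rightarrow> complex. smooth f \<Longrightarrow> gs_bounded s \<sigma> A f \<Longrightarrow> (\<lambda>x. of_real t * f x) \<in> U"
  shows "\<exists>\<delta>>0. \<delta> \<le> \<delta>0 \<and> (\<forall>f :: real^'n \<Rightarrow> complex. smooth f \<longrightarrow> gs_bounded s \<sigma> (\<lambda>m. max (A m) (\<delta> * h ^ m)) f \<longrightarrow> (\<lambda>x. of_real t' * f x) \<in> U)"
proof (rule ccontr)
  define d where "d k = \<delta>0 / real (Suc k)" for k
  have d: "d k > 0" "d k \<le> \<delta>0" for k
    using \<delta>0 by (auto simp: d_def field_simps)
  assume "\<not> ?thesis"
  then have "\<exists>f :: real^'n \<Rightarrow> complex. smooth f \<and> gs_bounded s \<sigma> (\<lambda>m. max (A m) (d k * h ^ m)) f \<and> (\<lambda>x. of_real t' * f x) \<notin> U" for k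
    using d[of k] by blast
  then obtain f :: "nat \<Rightarrow> real^'n \<Rightarrow> complex" where f: "\<And>k. smooth (f k)"
    "\<And>k. gs_bounded s \<sigma> (\<lambda>m. max (A m) (d k * h ^ m)) (f k)" "\<And>k. (\<lambda>x. of_real t' * f k x) \<notin> U"
    by metis
  have M: "M \<ge> 0" using A[of 0] by simp
  \<comment> \<open>All counterexamples share the scale h and a common constant, so compactness
    applies, with convergence at the scale 2 * h.\<close>
  have bd: "gs_bounded s \<sigma> (\<lambda>m. (M + \<delta>0) * h ^ m) (f k)" for k
  proof (rule gs_bounded_mono[OF f(2)])
    fix m
    have "d k * h ^ m \<le> \<delta>0 * h ^ m" "0 \<le> M * h ^ m" "0 \<le> \<delta>0 * h ^ m"
      using d h \<delta>0 M by auto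
    then show "max (A m) (d k * h ^ m) \<le> (M + \<delta>0) * h ^ m"
      using A(2)[of m] by (simp add: distrib_right)
  qed
  obtain r g where r: "strict_mono r" and g: "smooth g"
    and lim: "\<And>\<beta> x. (\<lambda>k. deriv_mi \<beta> (f (r k)) x) \<longlonglongrightarrow> deriv_mi \<beta> g x"
    and conv: "\<And>\<eta>. \<eta> > 0 \<Longrightarrow> \<exists>N. \<forall>k\<ge>N. gs_bounded s \<sigma> (\<lambda>m. \<eta> * (2 * h) ^ m) (\<lambda>x. f (r k) x - g x)"
    using gs_compactness[where f = f, OF f(1) bd h, of "2 * h"] h M \<delta>0 by auto
  \<comment> \<open>Derivatives converge pointwise while d (r k) tends to 0, so the limit satisfies
    the bound with the weight max (A m) 0 = A m.\<close>
  have "gs_bounded s \<sigma> A g"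
    unfolding gs_bounded_def
  proof (intro allI)
    fix \<alpha> \<beta> :: "'n \<Rightarrow> nat" and x :: "real^'n"
    let ?m = "mi_size \<alpha> + mi_size \<beta>" and ?c = "mi_fact \<alpha> powr s * mi_fact \<beta> powr \<sigma>"
    have "(\<lambda>k. \<delta>0 * (1 / real (Suc k))) \<longlonglongrightarrow> \<delta>0 * 0"
      using LIMSEQ_inverse_real_of_nat by (intro tendsto_mult_left) (simp add: inverse_eq_divide)
    then have "(\<lambda>k. d k) \<longlonglongrightarrow> 0" by (simp add: d_def)
    then have "(\<lambda>k. d (r k)) \<longlonglongrightarrow> 0"
      using LIMSEQ_subseq_LIMSEQ[OF _ r] by (auto simp: comp_def)
    then have l1: "(\<lambda>k. max (A ?m) (d (r k) * h ^ ?m) * ?c) \<longlonglongrightarrow> max (A ?m) (0 * h ^ ?m) * ?c"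
      by (intro tendsto_intros)
    have l2: "(\<lambda>k. cmod (of_real (mi_power x \<alpha>) * deriv_mi \<beta> (f (r k)) x))
        \<longlonglongrightarrow> cmod (of_real (mi_power x \<alpha>) * deriv_mi \<beta> g x)"
      by (intro tendsto_intros lim)
    have "cmod (of_real (mi_power x \<alpha>) * deriv_mi \<beta> g x) \<le> max (A ?m) (0 * h ^ ?m) * ?c"
      by (rule LIMSEQ_le[OF l2 l1]) (use f(2) in \<open>auto simp: gs_bounded_def\<close>)
    then show "cmod (of_real (mi_power x \<alpha>) * deriv_mi \<beta> g x) \<le> A ?m * ?c"
      using A(1)[of ?m] by simp
  qed
  then have gU: "(\<lambda>x. of_real t * g x) \<in> U" by (rule AU[OF g])
  \<comment> \<open>The weights are chosen to write t' * f as \<theta> * (t * g) + (1 - \<theta>) *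
    (c * (f - g)), a convex combination of two elements of U: the first by the bound on g, the
    second because f - g is eventually small at scale 2 * h.\<close>
  define \<theta> where "\<theta> = t' / t"
  have \<theta>: "0 < \<theta>" "\<theta> < 1" using t by (simp_all add: \<theta>_def)
  define c where "c = t' / (1 - \<theta>)"
  have c: "c > 0" using t \<theta> by (simp add: c_def)
  obtain \<epsilon> where e: "\<epsilon> > 0" "\<And>f :: real^'n \<Rightarrow> complex. smooth f \<Longrightarrow> gs_bounded s \<sigma> (\<lambda>m. \<epsilon> * (2 * h) ^ m) f \<Longrightarrow> f \<in> U"
    using nbhd[of "2 * h"] h by auto
  obtain k where k: "gs_bounded s \<sigma> (\<lambda>m. (\<epsilon> / c) * (2 * h) ^ m) (\<lambda>x. f (r k) x - g x)"
    using conv[of "\<epsilon> / c"] e(1) c by auto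
  have cU: "(\<lambda>x. of_real c * (f (r k) x - g x)) \<in> U"
  proof (rule e(2))
    show "smooth (\<lambda>x. of_real c * (f (r k) x - g x))"
      by (intro smooth_cmult smooth_diff f g)
    show "gs_bounded s \<sigma> (\<lambda>m. \<epsilon> * (2 * h) ^ m) (\<lambda>x. of_real c * (f (r k) x - g x))"
      using gs_bounded_comb[OF smooth_diff[OF f(1) g] smooth_const[of 0] k gs_bounded_zero[of "\<lambda>_. 0"], of "of_real c" 0] c
      by simp
  qed
  have "cmod (of_real \<theta>) + cmod (of_real (1 - \<theta>)) \<le> 1"
    using \<theta> unfolding norm_of_real by simp
  then have "(\<lambda>x. of_real \<theta> * (of_real t * g x) + of_real (1 - \<theta>) * (of_real c * (f (r k) x - g x))) \<in> U"
    by (rule abs_convexD[OF U gU cU])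
  moreover have "of_real \<theta> * (of_real t * g x) + of_real (1 - \<theta>) * (of_real c * (f (r k) x - g x)) = of_real t' * f (r k) x" for x
  proof -
    have "\<theta> * t = t'" "(1 - \<theta>) * c = t'" using t \<theta> by (simp_all add: \<theta>_def c_def)
    then have "of_real \<theta> * of_real t = (of_real t' :: complex)" "of_real (1 - \<theta>) * of_real c = (of_real t' :: complex)"
      by (simp_all only: of_real_mult[symmetric])
    then show ?thesis
      by (simp only: mult.assoc[symmetric]) (simp add: algebra_simps)
  qed
  ultimately show False using f(3)[of "r k"] by simp
qed

text \<open>An increasing sequence of weights \<open>A n\<close> is built: step n lifts the weight
  above a multiple of (n + 1)^m without touching entries below n, so the entries stabilize to W.
  Each step shrinks the dilation t n towards 1. For a fixed f bounded at some scale, finitely many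
  steps suffice, because the bounds of high order are automatic.\<close>

lemma gs_weight:
  fixes U :: "(real^'n::finite \<Rightarrow> complex) set"
  assumes U: "abs_convex U"
    and nbhd: "\<And>h. h > 0 \<Longrightarrow> \<exists>\<epsilon>>0. \<forall>f. smooth f \<longrightarrow> gs_bounded s \<sigma> (\<lambda>m. \<epsilon> * h ^ m) f \<longrightarrow> f \<in> U"
  shows "\<exists>W. (\<forall>h>0. \<exists>\<delta>>0. \<forall>m. \<delta> * h ^ m \<le> W m) \<and>
    (\<forall>f h C. smooth f \<longrightarrow> h > 0 \<longrightarrow> gs_bounded s \<sigma> (\<lambda>m. C * h ^ m) f \<longrightarrow> gs_bounded s \<sigma> W f \<longrightarrow> f \<in> U)"
proof -
  \<comment> \<open>Decreasing to 1 and always above it: each step has room for a dilation, and all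
    steps together never use up the ball.\<close>
  define t where "t n = 1 + 1 / real (Suc n)" for n
  have t1: "t n > 1" and t_dec: "t (Suc n) < t n" for n
    by (simp_all add: t_def divide_strict_left_mono)
  define P where "P n A \<longleftrightarrow> (\<forall>m. A m \<ge> 0) \<and> (n > 0 \<longrightarrow> (\<forall>m. A m > 0)) \<and> (\<exists>M. \<forall>m. A m \<le> M * real (Suc n) ^ m) \<and>
    (\<forall>f. smooth f \<longrightarrow> gs_bounded s \<sigma> A f \<longrightarrow> (\<lambda>x. of_real (t n) * f x) \<in> U)" for n and A :: "nat \<Rightarrow> real"
  define Q where "Q n A A' \<longleftrightarrow> (\<exists>\<delta>>0. \<forall>m. \<delta> * real (Suc n) ^ m \<le> A' m) \<and> (\<forall>m. A m \<le> A' m) \<and> (\<forall>m<n. A' m = A m)"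
    for n and A A' :: "nat \<Rightarrow> real"
  have "\<exists>A. \<forall>n. P n (A n) \<and> Q n (A n) (A (Suc n))"
  proof (rule dependent_nat_choice)
    obtain \<epsilon> where "\<epsilon> > 0" "\<And>f. smooth f \<Longrightarrow> gs_bounded s \<sigma> (\<lambda>m. \<epsilon> * 1 ^ m) f \<Longrightarrow> f \<in> U"
      using nbhd[of 1] by auto
    \<comment> \<open>The construction starts with the weight 0, whose ball contains only the zero
      function.\<close>
    then have "(\<lambda>_. 0) \<in> U" using gs_bounded_zero[of "\<lambda>m. \<epsilon> * 1 ^ m"] smooth_const by auto
    then show "\<exists>A. P 0 A"
      unfolding P_def by (intro exI[of _ "\<lambda>_. 0"]) (auto dest!: gs_bounded_zero_eq intro: exI[of _ 0])
  next
    fix A n assume PnA: "P n A"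
    obtain M where A: "\<And>m. A m \<ge> 0" "\<And>m. n > 0 \<Longrightarrow> A m > 0" "\<And>m. A m \<le> M * real (Suc n) ^ m"
      "\<And>f. smooth f \<Longrightarrow> gs_bounded s \<sigma> A f \<Longrightarrow> (\<lambda>x. of_real (t n) * f x) \<in> U"
      using PnA unfolding P_def by blast
    \<comment> \<open>With \<delta> below these quotients the maximum leaves the entries m < n
      unchanged. For n = 0 the set of quotients is empty, so strict positivity of the weights is
      needed only from n = 1 on.\<close>
    define \<delta>0 where "\<delta>0 = Min (insert 1 ((\<lambda>m. A m / real (Suc n) ^ m) ` {..<n}))"
    have \<delta>0: "\<delta>0 > 0" unfolding \<delta>0_def using A(2) by (subst Min_gr_iff) auto
    have \<delta>0A: "\<delta>0 * real (Suc n) ^ m \<le> A m" if "m < n" for m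
    proof -
      have "\<delta>0 \<le> A m / real (Suc n) ^ m" unfolding \<delta>0_def using that by (intro Min_le) auto
      then show ?thesis by (simp add: pos_le_divide_eq del: of_nat_Suc)
    qed
    obtain \<delta> where \<delta>: "\<delta> > 0" "\<delta> \<le> \<delta>0" "\<And>f. smooth f \<Longrightarrow>
        gs_bounded s \<sigma> (\<lambda>m. max (A m) (\<delta> * real (Suc n) ^ m)) f \<Longrightarrow> (\<lambda>x. of_real (t (Suc n)) * f x) \<in> U"
      using gs_weight_step[OF U nbhd A(1,3) _ \<delta>0 _ t_dec A(4)] t1[of "Suc n"] by fastforce
    let ?A = "\<lambda>m. max (A m) (\<delta> * real (Suc n) ^ m)"
    have "?A m \<le> max M \<delta> * real (Suc (Suc n)) ^ m" for m
    proof -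
      have "M \<ge> 0" using A(1)[of 0] A(3)[of 0] by simp
      have "real (Suc n) ^ m \<le> real (Suc (Suc n)) ^ m" by (intro power_mono) auto
      then have "max M \<delta> * real (Suc n) ^ m \<le> max M \<delta> * real (Suc (Suc n)) ^ m"
        using \<delta>(1) by (intro mult_left_mono) auto
      moreover have "M * real (Suc n) ^ m \<le> max M \<delta> * real (Suc n) ^ m" "\<delta> * real (Suc n) ^ m \<le> max M \<delta> * real (Suc n) ^ m"
        by (auto intro!: mult_right_mono)
      ultimately show ?thesis using A(3)[of m] by linarith
    qed
    moreover have "?A m > 0" for m using \<delta>(1) by (simp add: less_max_iff_disj)
    ultimately have P: "P (Suc n) ?A"
      unfolding P_def using \<delta>(3) by (auto simp: less_imp_le)
    have eq: "?A m = A m" if "m < n" for m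
    proof -
      have "\<delta> * real (Suc n) ^ m \<le> \<delta>0 * real (Suc n) ^ m" using \<delta>(2) by (intro mult_right_mono) auto
      then have "\<delta> * real (Suc n) ^ m \<le> A m" using \<delta>0A[OF that] by linarith
      then show ?thesis by (rule max.absorb1)
    qed
    have Q: "Q n A ?A"
      unfolding Q_def using \<delta>(1) eq by auto
    show "\<exists>A'. P (Suc n) A' \<and> Q n A A'"
      by (rule exI[of _ ?A]) (rule conjI[OF P Q])
  qed
  then obtain A where PA: "\<And>n. P n (A n)" and QA: "\<And>n. Q n (A n) (A (Suc n))" by blast
  have mono: "A n m \<le> A n' m" if "n \<le> n'" for n n' m
  proof (rule lift_Suc_mono_le[of "\<lambda>n. A n m", OF _ that])
    show "A n m \<le> A (Suc n) m" for n using QA[of n] unfolding Q_def by blast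
  qed
  \<comment> \<open>Step n freezes the indices m < n, so entry m is final from n = Suc m on.\<close>
  have const: "A n m = A (Suc m) m" if "n \<ge> Suc m" for n m
    using that
  proof (induction n rule: dec_induct)
    case (step k)
    then show ?case using QA[of k] by (simp add: Q_def)
  qed simp
  define W where "W m = A (Suc m) m" for m
  have AW: "A n m \<le> W m" for n m
    using mono[of n "max n (Suc m)" m] const[of m "max n (Suc m)"] by (simp add: W_def)
  have low: "\<exists>\<delta>>0. \<exists>n0. \<forall>n\<ge>n0. \<forall>m. \<delta> * h ^ m \<le> A n m" if h: "h > 0" for h :: real
  proof -
    obtain n where n: "h \<le> real (Suc n)"
      by (meson le_SucI of_nat_le_iff order_trans real_arch_simple)
    obtain \<delta> where \<delta>: "\<delta> > 0" "\<And>m. \<delta> * real (Suc n) ^ m \<le> A (Suc n) m"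
      using QA[of n] by (auto simp: Q_def)
    have "\<delta> * h ^ m \<le> A k m" if "k \<ge> Suc n" for k m
    proof -
      have "\<delta> * h ^ m \<le> \<delta> * real (Suc n) ^ m" using n h \<delta>(1) by (intro mult_left_mono power_mono) auto
      then show ?thesis using \<delta>(2)[of m] mono[OF that, of m] by linarith
    qed
    then show ?thesis using \<delta>(1) by blast
  qed
  have "f \<in> U" if f: "smooth f" "h > 0" "gs_bounded s \<sigma> (\<lambda>m. C * h ^ m) f" "gs_bounded s \<sigma> W f" for f h C
  proof -
    \<comment> \<open>The scale 2 * h leaves a factor 2^m that eventually exceeds C / \<delta>. Thus
      from order m0 on the given bound already lies below \<open>A N\<close>, and below m0 the
      weights \<open>A N\<close> and W coincide.\<close>
    obtain \<delta> n0 where \<delta>: "\<delta> > 0" "\<And>n m. n \<ge> n0 \<Longrightarrow> \<delta> * (2 * h) ^ m \<le> A n m"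
      using low[of "2 * h"] f(2) by auto
    obtain m0 where m0: "C / \<delta> < 2 ^ m0"
      using real_arch_pow[of 2 "C / \<delta>"] by auto
    define N where "N = max n0 (Suc m0)"
    have "gs_bounded s \<sigma> (A N) f"
      unfolding gs_bounded_def
    proof (intro allI)
      fix \<alpha> \<beta> :: "'n \<Rightarrow> nat" and x :: "real^'n"
      let ?m = "mi_size \<alpha> + mi_size \<beta>" and ?c = "mi_fact \<alpha> powr s * mi_fact \<beta> powr \<sigma>"
      have "?c \<ge> 0" by simp
      consider "W ?m = A N ?m" | "C * h ^ ?m \<le> A N ?m"
      proof (cases "?m < m0")
        case True
        then have "W ?m = A N ?m"
          using const[of ?m N] by (simp add: W_def N_def)
        then show ?thesis using that by blast
      next
        case False
        have "C < \<delta> * 2 ^ m0" using m0 \<delta>(1) by (simp add: pos_divide_less_eq mult.commute)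
        also have "\<dots> \<le> \<delta> * 2 ^ ?m" using False \<delta>(1) by (intro mult_left_mono power_increasing) auto
        finally have "C * h ^ ?m \<le> \<delta> * 2 ^ ?m * h ^ ?m" using f(2) by (intro mult_right_mono) auto
        also have "\<dots> \<le> A N ?m" using \<delta>(2)[of N ?m] by (simp add: N_def power_mult_distrib mult.assoc)
        finally show ?thesis using that by blast
      qed
      then show "cmod (of_real (mi_power x \<alpha>) * deriv_mi \<beta> f x) \<le> A N ?m * ?c"
      proof cases
        case 1
        then show ?thesis using f(4) unfolding gs_bounded_def by metis
      next
        case 2
        have "cmod (of_real (mi_power x \<alpha>) * deriv_mi \<beta> f x) \<le> C * h ^ ?m * ?c"
          using f(3) unfolding gs_bounded_def by blast
        also have "\<dots> \<le> A N ?m * ?c" using 2 \<open>?c \<ge> 0\<close> by (rule mult_right_mono)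
        finally show ?thesis .
      qed
    qed
    then have tf: "(\<lambda>x. of_real (t N) * f x) \<in> U"
      using PA[of N] f(1) by (simp add: P_def)
    \<comment> \<open>Since t N > 1, absolute convexity allows multiplication by 1 / t N and undoes
      the dilation.\<close>
    have "cmod (of_real (1 / t N)) + cmod 0 \<le> 1"
      using t1[of N] unfolding norm_of_real by simp
    then have "(\<lambda>x. of_real (1 / t N) * (of_real (t N) * f x) + 0 * (of_real (t N) * f x)) \<in> U"
      by (rule abs_convexD[OF U tf tf])
    moreover have "of_real (1 / t N) * (of_real (t N) * f x) + 0 * (of_real (t N) * f x) = f x" for x
      using t1[of N] by simp
    ultimately show "f \<in> U" by simp
  qed
  moreover have "\<exists>\<delta>>0. \<forall>m. \<delta> * h ^ m \<le> W m" if h: "h > 0" for h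
  proof -
    obtain \<delta> n where "\<delta> > 0" "\<And>m. \<delta> * h ^ m \<le> A n m" using low[OF h] by blast
    then show ?thesis using AW[of n] by (intro exI[of _ \<delta>]) (auto intro: order_trans)
  qed
  ultimately show ?thesis by (intro exI[of _ W]) auto
qed

subsection \<open>Continuity of the Zak transform and its inverse\<close>

lemma finite_norm_real: "p < (\<infinity> :: ennreal) \<Longrightarrow> \<exists>M\<ge>0. p = ennreal M"
  by (cases p) auto

lemma gs_norm_finite:
  assumes "h > 0" "gs_norm s \<sigma> h f < \<infinity>"
  shows "\<exists>M\<ge>0. gs_norm s \<sigma> h f = ennreal M \<and> gs_bounded s \<sigma> (\<lambda>m. M * h ^ m) f"
proof -
  obtain M where M: "M \<ge> 0" "gs_norm s \<sigma> h f = ennreal M"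
    using finite_norm_real[OF assms(2)] by blast
  then have "gs_bounded s \<sigma> (\<lambda>m. M * h ^ m) f"
    using gs_norm_le[OF assms(1) M(1), of s \<sigma> f] by simp
  with M show ?thesis by blast
qed

lemma gevrey_norm_finite:
  assumes "h > 0" "gevrey_norm \<sigma> s K h F < \<infinity>"
  shows "\<exists>M\<ge>0. gevrey_norm \<sigma> s K h F = ennreal M \<and> gevrey_bounded \<sigma> s K (\<lambda>m. M * h ^ m) F"
proof -
  obtain M where M: "M \<ge> 0" "gevrey_norm \<sigma> s K h F = ennreal M"
    using finite_norm_real[OF assms(2)] by blast
  have "h ^ m > 0" for m using assms(1) by simp
  from gevrey_wnorm_le[where W = "\<lambda>m. h ^ m", OF this M(1), of \<sigma> s K F]
  have "gevrey_bounded \<sigma> s K (\<lambda>m. M * h ^ m) F"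
    using M(2) by (simp add: gevrey_norm_wnorm)
  with M show ?thesis by blast
qed

lemma gevrey_bounded_subset: "gevrey_bounded \<sigma> s K W F \<Longrightarrow> L \<subseteq> K \<Longrightarrow> gevrey_bounded \<sigma> s L W F"
  unfolding gevrey_bounded_def by blast

lemma gs_step_alt: "gs_step s \<sigma> = (\<lambda>h. seminorm_topology {f. smooth f} (gs_norm s \<sigma> h))"
  by (simp add: gs_step_def fun_eq_iff)

lemma gevrey_step_alt: "gevrey_step \<sigma> s K = (\<lambda>h. seminorm_topology {F. smooth_near K F} (gevrey_norm \<sigma> s K h))"
  by (simp add: gevrey_step_def fun_eq_iff)

lemma seminorm_gevrey_norm:
  fixes K :: "((real^'n::finite) \<times> (real^'n)) set"
  shows "h > 0 \<Longrightarrow> seminorm_on {F. smooth_near K F} (gevrey_norm \<sigma> s K h)"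
  unfolding gevrey_norm_wnorm by (rule seminorm_gevrey_wnorm) simp

lemma gs_norm_schwartz:
  assumes "smooth f" "h > 0" "gs_norm s \<sigma> h f < \<infinity>"
  shows "f \<in> schwartz"
proof -
  obtain M where "gs_bounded s \<sigma> (\<lambda>m. M * h ^ m) f"
    using gs_norm_finite[OF assms(2,3)] by blast
  then show ?thesis by (rule gs_bounded_schwartz[OF assms(1)])
qed

lemma gs_roumieu_schwartz: "topspace (gs_roumieu s \<sigma>) \<subseteq> schwartz"
  unfolding topspace_gs_roumieu by (auto intro: gs_norm_schwartz)

lemma gs_beurling_schwartz: "topspace (gs_beurling s \<sigma>) \<subseteq> schwartz"
proof
  fix f :: "real^'a \<Rightarrow> complex"
  assume "f \<in> topspace (gs_beurling s \<sigma>)"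
  then have "smooth f" "gs_norm s \<sigma> 1 f < \<infinity>"
    by (simp_all add: topspace_gs_beurling)
  then show "f \<in> schwartz" by (intro gs_norm_schwartz[OF _ zero_less_one])
qed

lemma exhaustion_compact:
  assumes "exhaustion K" "compact Q"
  shows "\<exists>j. Q \<subseteq> K j"
proof -
  have K: "K j \<subseteq> interior (K (Suc j))" "(\<Union>j. K j) = UNIV" for j
    using assms(1) by (auto simp: exhaustion_def)
  have mono: "K i \<subseteq> K j" if "i \<le> j" for i j
  proof (rule lift_Suc_mono_le[of K, OF _ that])
    show "K n \<subseteq> K (Suc n)" for n using K(1)[of n] interior_subset by blast
  qed
  have "Q \<subseteq> (\<Union>j\<in>UNIV. interior (K (Suc j)))"
  proof
    fix x
    obtain i where "x \<in> K i" using K(2) by blast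
    then show "x \<in> (\<Union>j\<in>UNIV. interior (K (Suc j)))" using K(1)[of i] by blast
  qed
  then obtain J where J: "finite J" "Q \<subseteq> (\<Union>j\<in>J. interior (K (Suc j)))"
    using compactE_image[OF assms(2), of UNIV "\<lambda>j. interior (K (Suc j))"] by auto
  have "interior (K (Suc j)) \<subseteq> K (Suc (Max J))" if "j \<in> J" for j
    using mono[of "Suc j" "Suc (Max J)"] J(1) that interior_subset by fastforce
  with J(2) show ?thesis by blast
qed

lemma compact_fst_bounded:
  assumes "compact (Q :: ((real^'n) \<times> (real^'n)) set)"
  shows "\<exists>R. Q \<subseteq> {z. norm (fst z) \<le> R}"
proof -
  obtain R where R: "\<forall>z\<in>Q. norm z \<le> R"
    using compact_imp_bounded[OF assms] unfolding bounded_iff by blast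
  then have "norm (fst z) \<le> R" if "z \<in> Q" for z
  proof -
    have "norm z \<le> R" using R that by simp
    then show ?thesis using norm_fst_le[of "fst z" "snd z"] by simp
  qed
  then show ?thesis by (intro exI[of _ R]) auto
qed

lemma gevrey_wnorm_compare:
  assumes "h > 0" "\<delta> > 0" "\<And>m. \<delta> * h ^ m \<le> W m"
  shows "gevrey_wnorm \<sigma> s K W F \<le> ennreal (1 / \<delta>) * gevrey_norm \<sigma> s K h F"
proof (cases "gevrey_norm \<sigma> s K h F < \<infinity>")
  case True
  then obtain M where M: "M \<ge> 0" "gevrey_norm \<sigma> s K h F = ennreal M"
    "gevrey_bounded \<sigma> s K (\<lambda>m. M * h ^ m) F"
    using gevrey_norm_finite[OF assms(1)] by blast
  have W: "W m > 0" for m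
    using assms(3)[of m] mult_pos_pos[OF assms(2) zero_less_power[OF assms(1), of m]] by linarith
  have "M * h ^ m \<le> 1 / \<delta> * M * W m" for m
    using mult_left_mono[OF assms(3)[of m] M(1)] assms(2) by (simp add: field_simps)
  then have "M * h ^ m * c \<le> 1 / \<delta> * M * W m * c" if "c \<ge> 0" for m c
    using that by (rule mult_right_mono)
  then have "gevrey_bounded \<sigma> s K (\<lambda>m. 1 / \<delta> * M * W m) F"
    using M(3) unfolding gevrey_bounded_def by (meson mult_nonneg_nonneg order_trans powr_ge_zero)
  then have "gevrey_wnorm \<sigma> s K W F \<le> ennreal (1 / \<delta> * M)"
    using assms(2) M(1) by (subst gevrey_wnorm_le[OF W]) auto
  also have "ennreal (1 / \<delta> * M) = ennreal (1 / \<delta>) * gevrey_norm \<sigma> s K h F"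
    unfolding M(2) using assms(2) M(1) by (intro ennreal_mult) auto
  finally show ?thesis .
next
  case False
  then have "gevrey_norm \<sigma> s K h F = top" by (simp add: not_less top_unique)
  then show ?thesis using assms(2) by (simp add: ennreal_mult_top)
qed

lemma quasi_periodic_comb:
  "quasi_periodic E F \<Longrightarrow> quasi_periodic E G \<Longrightarrow> quasi_periodic E (\<lambda>z. a * F z + b * G z)"
  by (simp add: quasi_periodic_def algebra_simps)

lemma quasi_periodic_diff:
  "quasi_periodic E F \<Longrightarrow> quasi_periodic E G \<Longrightarrow> quasi_periodic E (\<lambda>z. F z - G z)"
  using quasi_periodic_comb[of E F G 1 "- 1"] by simp

context zak_basis
begin

text \<open>Linearity is transferred from the inverse: the right-hand side is smooth and
  quasi-periodic, so it equals the Zak transform of its own inverse image. No manipulation of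
  infinite sums is required.\<close>

lemma zak_comb:
  assumes "f \<in> schwartz" "g \<in> schwartz"
  shows "zak E (\<lambda>x. a * f x + b * g x) = (\<lambda>z. a * zak E f z + b * zak E g z)"
proof -
  let ?H = "\<lambda>z. a * zak E f z + b * zak E g z"
  have "zak_inv ?H = (\<lambda>x. a * f x + b * g x)"
    using assms by (simp add: zak_inv_comb smooth_zak zak_inv_zak)
  moreover have "zak E (zak_inv ?H) = ?H"
    using assms by (intro zak_zak_inv smooth_comb smooth_zak quasi_periodic_comb quasi_periodic_zak)
  ultimately show ?thesis by simp
qed

lemma zak_diff:
  "f \<in> schwartz \<Longrightarrow> g \<in> schwartz \<Longrightarrow> zak E (\<lambda>x. f x - g x) = (\<lambda>z. zak E f z - zak E g z)"
  using zak_comb[of f g 1 "- 1"] by simp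

lemma zak_inv_diff:
  "smooth F \<Longrightarrow> smooth G \<Longrightarrow> zak_inv (\<lambda>x. F x - G x) = (\<lambda>x. zak_inv F x - zak_inv G x)"
  using zak_inv_comb[of F G 1 "- 1"] by simp

lemma zak_norm_bound:
  assumes "s > 0" "h > 0" "compact Q"
  shows "\<exists>C>0. \<forall>f. smooth f \<longrightarrow> gs_norm s \<sigma> h f < \<infinity> \<longrightarrow>
    smooth_near Q (zak E f) \<and> gevrey_norm \<sigma> s Q (2 * 2 powr s * h) (zak E f) \<le> ennreal C * gs_norm s \<sigma> h f"
proof -
  obtain R where R: "Q \<subseteq> {z. norm (fst z) \<le> R}"
    using compact_fst_bounded[OF assms(3)] by blast
  obtain C where C: "C > 0" "\<And>f M. smooth f \<Longrightarrow> M \<ge> 0 \<Longrightarrow> gs_bounded s \<sigma> (\<lambda>m. M * h ^ m) f \<Longrightarrow>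
      gevrey_bounded \<sigma> s {z. norm (fst z) \<le> R} (\<lambda>m. C * M * (2 * 2 powr s * h) ^ m) (zak E f)"
    using zak_gevrey_bounded[OF assms(1,2), of \<sigma> R] by blast
  have "smooth_near Q (zak E f) \<and> gevrey_norm \<sigma> s Q (2 * 2 powr s * h) (zak E f) \<le> ennreal C * gs_norm s \<sigma> h f"
    if f: "smooth f" "gs_norm s \<sigma> h f < \<infinity>" for f
  proof -
    obtain M where M: "M \<ge> 0" "gs_norm s \<sigma> h f = ennreal M" "gs_bounded s \<sigma> (\<lambda>m. M * h ^ m) f"
      using gs_norm_finite[OF assms(2) f(2)] by blast
    have pos: "(2 * 2 powr s * h) ^ m > 0" for m using assms(2) by simp
    have CM: "C * M \<ge> 0" using C(1) M(1) by simp
    have "gevrey_norm \<sigma> s Q (2 * 2 powr s * h) (zak E f) \<le> ennreal (C * M)"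
      unfolding gevrey_norm_wnorm gevrey_wnorm_le[OF pos CM]
      using gevrey_bounded_subset[OF C(2)[OF f(1) M(1,3)] R] .
    moreover have "smooth_near Q (zak E f)"
      by (intro smooth_near_smooth smooth_zak gs_bounded_schwartz[OF f(1) M(3)])
    ultimately show ?thesis
      using C(1) M(1,2) by (simp add: ennreal_mult)
  qed
  then show ?thesis using C(1) by blast
qed

lemma zak_inv_norm_bound:
  assumes "s > 0" "h > 0" "fund \<subseteq> Q"
  shows "\<exists>C>0. \<forall>F. smooth F \<longrightarrow> quasi_periodic E F \<longrightarrow> gevrey_norm \<sigma> s Q h F < \<infinity> \<longrightarrow>
    gs_norm s \<sigma> (2 * h) (zak_inv F) \<le> ennreal C * gevrey_norm \<sigma> s Q h F"
proof -
  obtain C where C: "C > 0" "\<And>F W. smooth F \<Longrightarrow> quasi_periodic E F \<Longrightarrow> (\<And>m. W m \<ge> 0) \<Longrightarrow>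
    (\<And>l n. W l * h ^ n \<le> W (l + n)) \<Longrightarrow> gevrey_bounded \<sigma> s fund W F \<Longrightarrow>
    gs_bounded s \<sigma> (\<lambda>m. C * 2 ^ m * W m) (zak_inv F)"
    using zak_inv_gs_bounded[OF assms(1,2), of \<sigma>] by blast
  have "gs_norm s \<sigma> (2 * h) (zak_inv F) \<le> ennreal C * gevrey_norm \<sigma> s Q h F"
    if F: "smooth F" "quasi_periodic E F" "gevrey_norm \<sigma> s Q h F < \<infinity>" for F
  proof -
    obtain M where M: "M \<ge> 0" "gevrey_norm \<sigma> s Q h F = ennreal M" "gevrey_bounded \<sigma> s Q (\<lambda>m. M * h ^ m) F"
      using gevrey_norm_finite[OF assms(2) F(3)] by blast
    have "gs_bounded s \<sigma> (\<lambda>m. C * 2 ^ m * (M * h ^ m)) (zak_inv F)"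
      using M(1) assms(2) by (intro C(2) F gevrey_bounded_subset[OF M(3) assms(3)]) (auto simp: power_add)
    then have "gs_bounded s \<sigma> (\<lambda>m. (C * M) * (2 * h) ^ m) (zak_inv F)"
      by (simp add: power_mult_distrib mult_ac)
    then have "gs_norm s \<sigma> (2 * h) (zak_inv F) \<le> ennreal (C * M)"
      using assms(2) C(1) M(1) by (subst gs_norm_le) auto
    then show ?thesis using C(1) M by (simp add: ennreal_mult)
  qed
  then show ?thesis using C(1) by blast
qed

lemma continuous_zak_roumieu:
  assumes "s > 0" "exhaustion K"
  shows "continuous_map (gs_roumieu s \<sigma>) (gevrey_roumieu_qp K \<sigma> s E) (zak E)"
  unfolding gevrey_roumieu_qp_def
proof (rule continuous_map_into_subtopology)
  show "zak E \<in> topspace (gs_roumieu s \<sigma>) \<rightarrow> {F. quasi_periodic E F}"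
    by (simp add: quasi_periodic_zak)
  show "continuous_map (gs_roumieu s \<sigma>) (gevrey_roumieu K \<sigma> s) (zak E)"
    unfolding gevrey_roumieu_def
  proof (rule continuous_map_projective_limit)
    fix j
    have K: "compact (K j)" using assms(2) by (simp add: exhaustion_def)
    show "continuous_map (gs_roumieu s \<sigma>) (gevrey_roumieu_on \<sigma> s (K j)) (zak E)"
      unfolding gs_roumieu_def gevrey_roumieu_on_def gs_step_alt gevrey_step_alt
    proof (rule continuous_map_inductive_limit)
      fix f g :: "real^'n \<Rightarrow> complex" and a b :: complex
      assume "f \<in> (\<Union>h\<in>{0<..}. {f \<in> {f. smooth f}. gs_norm s \<sigma> h f < \<infinity>})"
        "g \<in> (\<Union>h\<in>{0<..}. {f \<in> {f. smooth f}. gs_norm s \<sigma> h f < \<infinity>})"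
      then have "f \<in> schwartz" "g \<in> schwartz"
        by (auto intro: gs_norm_schwartz)
      then show "zak E (\<lambda>x. a * f x + b * g x) = (\<lambda>x. a * zak E f x + b * zak E g x)"
        by (rule zak_comb)
    next
      fix h :: real assume h: "h > 0"
      show "\<exists>h'>0. \<exists>C>0. \<forall>f\<in>{f. smooth f}. gs_norm s \<sigma> h f < \<infinity> \<longrightarrow>
          zak E f \<in> {F. smooth_near (K j) F} \<and> gevrey_norm \<sigma> s (K j) h' (zak E f) \<le> ennreal C * gs_norm s \<sigma> h f"
      proof (rule exI[of _ "2 * 2 powr s * h"], rule conjI)
        show "2 * 2 powr s * h > 0" using h by simp
      qed (use zak_norm_bound[OF assms(1) h K, of \<sigma>] in simp)
    qed (auto intro: seminorm_gs_norm seminorm_gevrey_norm gs_norm_antimono)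
  qed simp
qed

lemma continuous_zak_beurling:
  assumes "s > 0" "exhaustion K"
  shows "continuous_map (gs_beurling s \<sigma>) (gevrey_beurling_qp K \<sigma> s E) (zak E)"
  unfolding gevrey_beurling_qp_def
proof (rule continuous_map_into_subtopology)
  show "zak E \<in> topspace (gs_beurling s \<sigma>) \<rightarrow> {F. quasi_periodic E F}"
    by (simp add: quasi_periodic_zak)
  show "continuous_map (gs_beurling s \<sigma>) (gevrey_beurling K \<sigma> s) (zak E)"
    unfolding gevrey_beurling_def gevrey_beurling_on_def
  proof (intro continuous_map_projective_limit)
    fix j and h' :: real assume "h' \<in> {0<..}"
    then have h': "h' > 0" by simp
    \<comment> \<open>The source scale is chosen so that the loss 2 * 2 powr s leads exactly to the
      given target scale; every h > 0 is available in the projective limit.\<close>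
    define h where "h = h' / (2 * 2 powr s)"
    have h: "h > 0" "2 * 2 powr s * h = h'" using h' by (simp_all add: h_def)
    have K: "compact (K j)" using assms(2) by (simp add: exhaustion_def)
    obtain C where C: "C > 0" "\<And>f. smooth f \<Longrightarrow> gs_norm s \<sigma> h f < \<infinity> \<Longrightarrow>
        smooth_near (K j) (zak E f) \<and> gevrey_norm \<sigma> s (K j) h' (zak E f) \<le> ennreal C * gs_norm s \<sigma> h f"
      using zak_norm_bound[OF assms(1) h(1) K, of \<sigma>] unfolding h(2) by blast
    let ?D = "{f \<in> {f :: real^'n \<Rightarrow> complex. smooth f}. gs_norm s \<sigma> h f < \<infinity>}"
    note sn = seminorm_gs_norm[OF h(1), of s \<sigma>, where 'n = 'n]
    have "continuous_map (subtopology (seminorm_topology {f. smooth f} (gs_norm s \<sigma> h)) ?D)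
        (seminorm_topology {F. smooth_near (K j) F} (gevrey_norm \<sigma> s (K j) h')) (zak E)"
    proof (rule continuous_map_seminorm[OF sn order_refl _ C(1)])
      fix f assume f: "f \<in> ?D"
      then have "gevrey_norm \<sigma> s (K j) h' (zak E f) \<le> ennreal C * gs_norm s \<sigma> h f" using C(2) by blast
      also have "\<dots> < \<infinity>" using f by (simp add: ennreal_mult_less_top)
      finally show "zak E f \<in> {F. smooth_near (K j) F} \<and> gevrey_norm \<sigma> s (K j) h' (zak E f) < \<infinity>"
        using f C(2) by blast
    next
      fix f g assume fg: "f \<in> ?D" "g \<in> ?D"
      then have "f \<in> schwartz" "g \<in> schwartz"
        by (auto intro: gs_norm_schwartz[OF _ h(1)])
      moreover have "smooth (\<lambda>x. g x - f x)" using fg by (simp add: smooth_diff)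
      moreover have "gs_norm s \<sigma> h (\<lambda>x. g x - f x) < \<infinity>"
      proof (rule order_le_less_trans)
        show "gs_norm s \<sigma> h (\<lambda>x. g x - f x) \<le> gs_norm s \<sigma> h g + gs_norm s \<sigma> h f"
          using fg by (intro seminorm_onD(6)[OF sn]) auto
      qed (use fg in simp)
      ultimately show "gevrey_norm \<sigma> s (K j) h' (\<lambda>x. zak E g x - zak E f x) \<le> ennreal C * gs_norm s \<sigma> h (\<lambda>x. g x - f x)"
        using C(2)[of "\<lambda>x. g x - f x"] by (simp add: zak_diff)
    qed
    moreover have "subtopology (seminorm_topology {f. smooth f} (gs_norm s \<sigma> h)) ?D = gs_step s \<sigma> h"
      by (metis gs_step_alt subtopology_topspace topspace_seminorm_topology)
    ultimately have zak: "continuous_map (gs_step s \<sigma> h) (gevrey_step \<sigma> s (K j) h') (zak E)"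
      by (simp add: gevrey_step_def)
    have "continuous_map (gs_beurling s \<sigma>) (gs_step s \<sigma> h) id"
      unfolding gs_beurling_def using h(1) by (intro continuous_map_from_projective_limit) auto
    from continuous_map_compose[OF this zak]
    show "continuous_map (gs_beurling s \<sigma>) (gevrey_step \<sigma> s (K j) h') (zak E)"
      by simp
  qed auto
qed

lemma continuous_zak_inv_beurling:
  assumes "s > 0" "exhaustion K"
  shows "continuous_map (gevrey_beurling_qp K \<sigma> s E) (gs_beurling s \<sigma>) zak_inv"
  unfolding gs_beurling_def
proof (rule continuous_map_projective_limit)
  fix h' :: real assume "h' \<in> {0<..}"
  then have h': "h' > 0" by simp
  define h where "h = h' / 2"
  have h: "h > 0" "2 * h = h'" using h' by (simp_all add: h_def)
  obtain j where j: "fund \<subseteq> K j" using exhaustion_compact[OF assms(2) compact_fund] by blast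
  obtain C where C: "C > 0" "\<And>F. smooth F \<Longrightarrow> quasi_periodic E F \<Longrightarrow> gevrey_norm \<sigma> s (K j) h F < \<infinity> \<Longrightarrow>
      gs_norm s \<sigma> h' (zak_inv F) \<le> ennreal C * gevrey_norm \<sigma> s (K j) h F"
    using zak_inv_norm_bound[OF assms(1) h(1) j, of \<sigma>] unfolding h(2) by blast
  let ?D = "{F. smooth F \<and> quasi_periodic E F \<and> gevrey_norm \<sigma> s (K j) h F < \<infinity>}"
  note sn = seminorm_gevrey_norm[OF h(1), of "K j" \<sigma> s]
  have inv: "continuous_map (subtopology (seminorm_topology {F. smooth_near (K j) F} (gevrey_norm \<sigma> s (K j) h)) ?D)
      (gs_step s \<sigma> h') zak_inv"
    unfolding gs_step_def
  proof (rule continuous_map_seminorm[OF sn _ _ C(1)])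
    show "?D \<subseteq> {F \<in> {F. smooth_near (K j) F}. gevrey_norm \<sigma> s (K j) h F < \<infinity>}"
      by (auto intro: smooth_near_smooth)
  next
    fix F assume F: "F \<in> ?D"
    then have "gs_norm s \<sigma> h' (zak_inv F) \<le> ennreal C * gevrey_norm \<sigma> s (K j) h F" using C(2) by blast
    also have "\<dots> < \<infinity>" using F by (simp add: ennreal_mult_less_top)
    finally show "zak_inv F \<in> {f. smooth f} \<and> gs_norm s \<sigma> h' (zak_inv F) < \<infinity>"
      using F by (simp add: smooth_zak_inv)
  next
    fix F G assume FG: "F \<in> ?D" "G \<in> ?D"
    moreover have "gevrey_norm \<sigma> s (K j) h (\<lambda>x. G x - F x) < \<infinity>"
    proof (rule order_le_less_trans)
      show "gevrey_norm \<sigma> s (K j) h (\<lambda>x. G x - F x) \<le> gevrey_norm \<sigma> s (K j) h G + gevrey_norm \<sigma> s (K j) h F"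
        using FG by (intro seminorm_onD(6)[OF sn]) (auto intro: smooth_near_smooth)
    qed (use FG in simp)
    ultimately show "gs_norm s \<sigma> h' (\<lambda>x. zak_inv G x - zak_inv F x) \<le> ennreal C * gevrey_norm \<sigma> s (K j) h (\<lambda>x. G x - F x)"
      using C(2)[of "\<lambda>x. G x - F x"] by (simp add: zak_inv_diff smooth_diff quasi_periodic_diff)
  qed
  have "continuous_map (gevrey_beurling_qp K \<sigma> s E)
      (subtopology (seminorm_topology {F. smooth_near (K j) F} (gevrey_norm \<sigma> s (K j) h)) ?D) id"
  proof (rule continuous_map_into_subtopology)
    have "continuous_map (gevrey_beurling K \<sigma> s) (gevrey_beurling_on \<sigma> s (K j)) id"
      unfolding gevrey_beurling_def by (rule continuous_map_from_projective_limit) simp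
    moreover have "continuous_map (gevrey_beurling_on \<sigma> s (K j)) (gevrey_step \<sigma> s (K j) h) id"
      unfolding gevrey_beurling_on_def using h(1) by (intro continuous_map_from_projective_limit) auto
    ultimately have "continuous_map (gevrey_beurling K \<sigma> s) (gevrey_step \<sigma> s (K j) h) (id \<circ> id)"
      by (rule continuous_map_compose)
    then show "continuous_map (gevrey_beurling_qp K \<sigma> s E)
        (seminorm_topology {F. smooth_near (K j) F} (gevrey_norm \<sigma> s (K j) h)) id"
      unfolding gevrey_beurling_qp_def gevrey_step_def by (simp add: continuous_map_from_subtopology)
    show "id \<in> topspace (gevrey_beurling_qp K \<sigma> s E) \<rightarrow> ?D"
      using h(1) by (auto simp: topspace_gevrey_beurling_qp[OF assms(2)])
  qed
  from continuous_map_compose[OF this inv]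
  show "continuous_map (gevrey_beurling_qp K \<sigma> s E) (gs_step s \<sigma> h') zak_inv"
    by simp
qed auto

lemma zak_inv_roumieu:
  assumes "s > 0" "exhaustion K" "F \<in> topspace (gevrey_roumieu_qp K \<sigma> s E)"
  shows "zak_inv F \<in> topspace (gs_roumieu s \<sigma>)"
proof -
  obtain j where j: "fund \<subseteq> K j" using exhaustion_compact[OF assms(2) compact_fund] by blast
  obtain h where h: "h > 0" "gevrey_norm \<sigma> s (K j) h F < \<infinity>" and F: "smooth F" "quasi_periodic E F"
    using assms(3) unfolding topspace_gevrey_roumieu_qp[OF assms(2)] by blast
  obtain C where "gs_norm s \<sigma> (2 * h) (zak_inv F) \<le> ennreal C * gevrey_norm \<sigma> s (K j) h F"
    using zak_inv_norm_bound[OF assms(1) h(1) j, of \<sigma>] F h(2) by blast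
  also have "\<dots> < \<infinity>" using h(2) by (simp add: ennreal_mult_less_top)
  finally show ?thesis
    unfolding topspace_gs_roumieu using h(1) smooth_zak_inv[OF F(1)] by (auto intro!: exI[of _ "2 * h"])
qed

text \<open>The subspace topology could a priori be coarser than the inductive limit of the subspaces. The
  weighted seminorm is defined on the whole Gevrey class, not just on quasi-periodic functions, which
  makes its unit ball a neighbourhood in the ambient topology.\<close>
lemma continuous_zak_inv_roumieu:
  assumes "s > 0" "exhaustion K"
  shows "continuous_map (gevrey_roumieu_qp K \<sigma> s E) (gs_roumieu s \<sigma>) zak_inv"
  unfolding continuous_map
proof (intro conjI allI impI)
  let ?Y = "gevrey_roumieu_qp K \<sigma> s E"
  show "zak_inv ` topspace ?Y \<subseteq> topspace (gs_roumieu s \<sigma>)"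
    using zak_inv_roumieu[OF assms] by blast
  fix V :: "(real^'n \<Rightarrow> complex) set" assume V: "openin (gs_roumieu s \<sigma>) V"
  obtain j where j: "fund \<subseteq> K j" using exhaustion_compact[OF assms(2) compact_fund] by blast
  show "openin ?Y {F \<in> topspace ?Y. zak_inv F \<in> V}"
  proof (subst openin_subopen, intro ballI)
    fix F0 assume F0: "F0 \<in> {F \<in> topspace ?Y. zak_inv F \<in> V}"
    have union: "(\<Union>h\<in>{0<..}. topspace (gs_step s \<sigma> h)) = topspace (gs_roumieu s \<sigma>)"
      unfolding topspace_gs_roumieu by (auto simp: topspace_gs_step)
    obtain U where U: "abs_convex U"
      "\<And>h. h > 0 \<Longrightarrow> \<exists>V. openin (gs_step s \<sigma> h) V \<and> (\<lambda>_. 0) \<in> V \<and> V \<subseteq> U"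
      "{g \<in> topspace (gs_roumieu s \<sigma>). (\<lambda>x. g x - zak_inv F0 x) \<in> U} \<subseteq> V"
      using V F0 unfolding gs_roumieu_def[of s \<sigma>] openin_inductive_limit union[unfolded gs_roumieu_def] by fastforce
    have nbhd: "\<exists>\<epsilon>>0. \<forall>f. smooth f \<longrightarrow> gs_bounded s \<sigma> (\<lambda>m. \<epsilon> * h ^ m) f \<longrightarrow> f \<in> U" if h: "h > 0" for h
    proof -
      obtain V' where V': "openin (gs_step s \<sigma> h) V'" "(\<lambda>_. 0) \<in> V'" "V' \<subseteq> U" using U(2)[OF h] by blast
      obtain \<epsilon> where e: "\<epsilon> > 0" "{g \<in> {f. smooth f}. gs_norm s \<sigma> h g < ennreal \<epsilon>} \<subseteq> V'"
        using seminorm_zero_neighbourhood[OF V'(1)[unfolded gs_step_def] V'(2)] by blast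
      have "f \<in> U" if f: "smooth f" "gs_bounded s \<sigma> (\<lambda>m. \<epsilon> / 2 * h ^ m) f" for f
      proof -
        have "gs_norm s \<sigma> h f \<le> ennreal (\<epsilon> / 2)" using f(2) e(1) h by (subst gs_norm_le) auto
        also have "\<dots> < ennreal \<epsilon>" using e(1) by (simp add: ennreal_less_iff)
        finally show ?thesis using e(2) f(1) V'(3) by blast
      qed
      then show ?thesis using e(1) by (intro exI[of _ "\<epsilon> / 2"]) auto
    qed
    obtain W where W: "\<And>h. h > 0 \<Longrightarrow> \<exists>\<delta>>0. \<forall>m. \<delta> * h ^ m \<le> W m"
      and WU: "\<And>f h C. smooth f \<Longrightarrow> h > 0 \<Longrightarrow> gs_bounded s \<sigma> (\<lambda>m. C * h ^ m) f \<Longrightarrow> gs_bounded s \<sigma> W f \<Longrightarrow> f \<in> U"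
      using gs_weight[OF U(1) nbhd] by blast
    obtain C where C: "C > 0" "\<And>F W. smooth F \<Longrightarrow> quasi_periodic E F \<Longrightarrow> (\<And>m. W m \<ge> 0) \<Longrightarrow>
        (\<And>l n. W l * 1 ^ n \<le> W (l + n)) \<Longrightarrow> gevrey_bounded \<sigma> s fund W F \<Longrightarrow>
        gs_bounded s \<sigma> (\<lambda>m. C * 2 ^ m * W m) (zak_inv F)"
      using zak_inv_gs_bounded[OF assms(1) zero_less_one, of \<sigma>] by blast
    \<comment> \<open>The largest increasing sequence below W m / (C * 2^m). Monotonicity is the
      growth condition of \<open>zak_inv_gs_bounded\<close> with \<epsilon> = 1, and the division
      compensates for the loss in that estimate.\<close>
    define V' where "V' l = (INF n. W (l + n) / (C * 2 ^ (l + n)))" for l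
    have W0: "W m \<ge> 0" for m
    proof -
      obtain \<delta> where "\<delta> > 0" "\<delta> * 1 ^ m \<le> W m" using W[of 1] by auto
      then show ?thesis by simp
    qed
    have bdd: "bdd_below (range (\<lambda>n. W (l + n) / (C * 2 ^ (l + n))))" for l
      using W0 C(1) by (intro bdd_belowI[of _ 0]) auto
    have V'W: "V' (l + n) \<le> W (l + n + m) / (C * 2 ^ (l + n + m))" for l n m
      unfolding V'_def by (rule cINF_lower[OF bdd]) simp
    have V'_mono: "V' l \<le> V' (l + n)" for l n
      unfolding V'_def[of "l + n"]
    proof (rule cINF_greatest)
      fix m
      show "V' l \<le> W (l + n + m) / (C * 2 ^ (l + n + m))"
        using V'W[of l 0 "n + m"] by (simp add: add.assoc)
    qed simp
    have V'_low: "\<exists>\<delta>>0. \<forall>m. \<delta> * h ^ m \<le> V' m" if h: "h > 0" for h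
    proof -
      \<comment> \<open>H \<ge> 1 gives h^l \<le> H^(l + n) for every n in the infimum, and the
        lower bound of W at scale 2 * H cancels the division by 2^(l + n).\<close>
      define H where "H = max h 1"
      obtain \<delta> where \<delta>: "\<delta> > 0" "\<And>m. \<delta> * (2 * H) ^ m \<le> W m"
        using W[of "2 * H"] by (auto simp: H_def)
      have "\<delta> / C * h ^ l \<le> V' l" for l
        unfolding V'_def
      proof (rule cINF_greatest)
        fix n
        have "h ^ l \<le> H ^ l" using h by (intro power_mono) (auto simp: H_def)
        also have "\<dots> \<le> H ^ (l + n)" by (intro power_increasing) (auto simp: H_def)
        finally have "\<delta> / C * h ^ l \<le> \<delta> / C * H ^ (l + n)" using \<delta>(1) C(1) by (intro mult_left_mono) auto
        also have "\<dots> = \<delta> * (2 * H) ^ (l + n) / (C * 2 ^ (l + n))"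
          by (simp add: power_mult_distrib)
        also have "\<dots> \<le> W (l + n) / (C * 2 ^ (l + n))" using \<delta>(2)[of "l + n"] C(1) by (intro divide_right_mono) auto
        finally show "\<delta> / C * h ^ l \<le> W (l + n) / (C * 2 ^ (l + n))" .
      qed simp
      then show ?thesis using \<delta>(1) C(1) by (intro exI[of _ "\<delta> / C"]) auto
    qed
    have V'_pos: "V' m > 0" for m
    proof -
      obtain \<delta> where "\<delta> > 0" "\<delta> * 1 ^ m \<le> V' m" using V'_low[of 1] by auto
      then show ?thesis by simp
    qed
    let ?q = "gevrey_wnorm \<sigma> s (K j) V'"
    let ?O = "{F \<in> (\<Union>h\<in>{0<..}. {F \<in> {F. smooth_near (K j) F}. gevrey_norm \<sigma> s (K j) h F < \<infinity>}). ?q (\<lambda>x. F x - F0 x) < 1}"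
    have q: "seminorm_on {F. smooth_near (K j) F} ?q"
      by (rule seminorm_gevrey_wnorm[OF V'_pos])
    have F0': "smooth F0" "quasi_periodic E F0"
      using F0 by (auto simp: topspace_gevrey_roumieu_qp[OF assms(2)])
    have "openin (gevrey_roumieu_on \<sigma> s (K j)) ?O"
      unfolding gevrey_roumieu_on_def gevrey_step_alt
    proof (rule openin_inductive_limit_ball[OF seminorm_gevrey_norm q])
      fix h :: real assume h: "h > 0"
      obtain \<delta> where \<delta>: "\<delta> > 0" "\<And>m. \<delta> * h ^ m \<le> V' m" using V'_low[OF h] by blast
      then show "\<exists>C>0. \<forall>f\<in>{F. smooth_near (K j) F}. ?q f \<le> ennreal C * gevrey_norm \<sigma> s (K j) h f"
        using gevrey_wnorm_compare[OF h \<delta>, of \<sigma> s "K j"] by (intro exI[of _ "1 / \<delta>"]) auto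
    qed (use F0' in \<open>auto intro: smooth_near_smooth\<close>)
    moreover have "continuous_map ?Y (gevrey_roumieu_on \<sigma> s (K j)) id"
      unfolding gevrey_roumieu_qp_def gevrey_roumieu_def
      by (intro continuous_map_from_subtopology continuous_map_from_projective_limit) simp
    ultimately have "openin ?Y {F \<in> topspace ?Y. id F \<in> ?O}"
      unfolding continuous_map by blast
    moreover have "F0 \<in> {F \<in> topspace ?Y. id F \<in> ?O}"
      using F0 seminorm_onD(2)[OF q]
      by (auto simp: topspace_gevrey_roumieu_qp[OF assms(2)] smooth_near_smooth)
    moreover have "{F \<in> topspace ?Y. id F \<in> ?O} \<subseteq> {F \<in> topspace ?Y. zak_inv F \<in> V}"
    proof
      fix F assume "F \<in> {F \<in> topspace ?Y. id F \<in> ?O}"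
      then have F: "F \<in> topspace ?Y" "?q (\<lambda>x. F x - F0 x) < 1" by auto
      then have F': "smooth F" "quasi_periodic E F"
        by (auto simp: topspace_gevrey_roumieu_qp[OF assms(2)])
      let ?d = "\<lambda>x. zak_inv F x - zak_inv F0 x"
      have d: "?d = zak_inv (\<lambda>x. F x - F0 x)" by (simp add: zak_inv_diff F' F0')
      have "?q (\<lambda>x. F x - F0 x) \<le> ennreal 1" using F(2) by simp
      then have "gevrey_bounded \<sigma> s (K j) (\<lambda>m. 1 * V' m) (\<lambda>x. F x - F0 x)"
        by (subst (asm) gevrey_wnorm_le[OF V'_pos]) auto
      then have "gevrey_bounded \<sigma> s fund V' (\<lambda>x. F x - F0 x)"
        using gevrey_bounded_subset[OF _ j] by simp
      then have "gs_bounded s \<sigma> (\<lambda>m. C * 2 ^ m * V' m) ?d"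
        unfolding d using F' F0' V'_mono V'_pos
        by (intro C(2) smooth_diff quasi_periodic_diff) (auto simp: less_imp_le)
      then have "gs_bounded s \<sigma> W ?d"
      proof (rule gs_bounded_mono)
        fix m
        have "V' m \<le> W m / (C * 2 ^ m)" using V'W[of m 0 0] by simp
        then show "C * 2 ^ m * V' m \<le> W m" using C(1) by (simp add: field_simps)
      qed
      \<comment> \<open>The weighted ball is known to lie in U only for functions bounded at some
        scale h, so the difference must first be placed in one step of the inductive limit.\<close>
      moreover have "\<exists>h>0. \<exists>M. gs_bounded s \<sigma> (\<lambda>m. M * h ^ m) ?d"
      proof -
        have "\<exists>h>0. \<exists>M\<ge>0. gs_bounded s \<sigma> (\<lambda>m. M * h ^ m) (zak_inv G)" if "G \<in> topspace ?Y" for G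
          using zak_inv_roumieu[OF assms that] gs_norm_finite unfolding topspace_gs_roumieu by blast
        then obtain h1 M1 h2 M2 where hM: "h1 > 0" "M1 \<ge> 0" "gs_bounded s \<sigma> (\<lambda>m. M1 * h1 ^ m) (zak_inv F)"
          "h2 > 0" "M2 \<ge> 0" "gs_bounded s \<sigma> (\<lambda>m. M2 * h2 ^ m) (zak_inv F0)"
          using F(1) F0 by blast
        have "gs_bounded s \<sigma> (\<lambda>m. M1 * h1 ^ m + M2 * h2 ^ m) ?d"
          using gs_bounded_comb[OF smooth_zak_inv[OF F'(1)] smooth_zak_inv[OF F0'(1)] hM(3,6), of 1 "- 1"] by simp
        then have "gs_bounded s \<sigma> (\<lambda>m. (M1 + M2) * max h1 h2 ^ m) ?d"
        proof (rule gs_bounded_mono)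
          fix m
          have "M1 * h1 ^ m \<le> M1 * max h1 h2 ^ m" "M2 * h2 ^ m \<le> M2 * max h1 h2 ^ m"
            using hM by (auto intro!: mult_left_mono power_mono)
          then show "M1 * h1 ^ m + M2 * h2 ^ m \<le> (M1 + M2) * max h1 h2 ^ m"
            by (simp add: distrib_right)
        qed
        then show ?thesis using hM(1) by (intro exI[of _ "max h1 h2"]) auto
      qed
      moreover have "smooth ?d"
        by (intro smooth_diff smooth_zak_inv F' F0')
      ultimately have "?d \<in> U" using WU by blast
      then show "F \<in> {F \<in> topspace ?Y. zak_inv F \<in> V}"
        using U(3) F(1) zak_inv_roumieu[OF assms F(1)] by blast
    qed
    ultimately show "\<exists>T. openin ?Y T \<and> F0 \<in> T \<and> T \<subseteq> {F \<in> topspace ?Y. zak_inv F \<in> V}" by blast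
  qed
qed

end

theorem theorem3p2:
  fixes s \<sigma> :: real
    and E :: "'n::finite \<Rightarrow> real^'n"
    and K :: "nat \<Rightarrow> ((real^'n) \<times> (real^'n)) set"
  assumes "s > 0" "\<sigma> > 0"
    and "ordered_basis E"
    and "exhaustion K"
  shows "zak E ` schwartz \<subseteq> {F. smooth_on UNIV F}
    \<and> topspace (gs_roumieu s \<sigma>) \<subseteq> (schwartz :: (real^'n \<Rightarrow> complex) set)
    \<and> homeomorphic_map (gs_roumieu s \<sigma>) (gevrey_roumieu_qp K \<sigma> s E) (zak E)
    \<and> topspace (gs_beurling s \<sigma>) \<subseteq> (schwartz :: (real^'n \<Rightarrow> complex) set)
    \<and> homeomorphic_map (gs_beurling s \<sigma>) (gevrey_beurling_qp K \<sigma> s E) (zak E)"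
proof -
  interpret zak_basis E by unfold_locales (rule assms(3))
  have "homeomorphic_maps (gs_roumieu s \<sigma>) (gevrey_roumieu_qp K \<sigma> s E) (zak E) zak_inv"
    unfolding homeomorphic_maps_def
    using continuous_zak_roumieu[OF assms(1,4)] continuous_zak_inv_roumieu[OF assms(1,4)]
      gs_roumieu_schwartz[THEN subsetD, THEN zak_inv_zak] zak_zak_inv
    by (auto simp: topspace_gevrey_roumieu_qp[OF assms(4)])
  moreover have "homeomorphic_maps (gs_beurling s \<sigma>) (gevrey_beurling_qp K \<sigma> s E) (zak E) zak_inv"
    unfolding homeomorphic_maps_def
    using continuous_zak_beurling[OF assms(1,4)] continuous_zak_inv_beurling[OF assms(1,4)]
      gs_beurling_schwartz[THEN subsetD, THEN zak_inv_zak] zak_zak_inv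
    by (auto simp: topspace_gevrey_beurling_qp[OF assms(4)])
  ultimately show ?thesis
    using smooth_zak gs_roumieu_schwartz gs_beurling_schwartz
    unfolding homeomorphic_map_maps by blast
qed

end
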